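(* Let $\mathcal{A}=(A,B,\beta,T)$ be a relative Rota-Baxter group and $\mathcal{K}=(K,L,\alpha,S)$ a module over $\mathcal{A}$ with respect to the action $(\nu,\mu,\sigma,f)$. If $T$ and $S$ are bijections and $K$ and $L$ are abelian, then $\Lambda\Pi\Psi:\operatorname{H}^2_{RRB}(\mathcal{A},\mathcal{K})\to\operatorname{H}^2_N(A_T,K_S)$ is an isomorphism of groups.
   Context: **Relative Rota-Baxter groups.** A relative Rota-Baxter group is a quadruple $(H,G,\phi,R)$ with $H,G$ groups, $\phi:G\to\operatorname{Aut}(H)$, $g\mapsto\phi_g$, a homomorphism, and $R:H\to G$ a map with $R(h_1)R(h_2)=R(h_1\phi_{R(h_1)}(h_2))$. It is trivial if $\phi$ is trivial (then $R$ is a homomorphism). A homomorphism $(\psi,\eta):(H,G,\phi,R)\to(H',G',\phi',R')$ is a pair of group homomorphisms with $\eta R=R'\psi$, $\psi\phi_g=\phi'_{\eta(g)}\psi$. An extension of $(A,B,\beta,T)$ by $(K,L,\alpha,S)$ is a relative Rota-Baxter group $(H,G,\phi,R)$ with an injective homomorphism $(i_1,i_2)$ from $(K,L,\alpha,S)$ and a surjective homomorphism $(\pi_1,\pi_2)$ onto $(A,B,\beta,T)$ such that $\operatorname{im} i_j=\ker\pi_j$, $j=1,2$; equivalence of extensions is isomorphism inducing identities on $(K,L,\alpha,S)$ and $(A,B,\beta,T)$. **Skew left braces.** A skew left brace is $(H,\cdot,\circ)$ with $(H,\cdot)$, $(H,\circ)$ groups and $a\circ(b\cdot c)=(a\circ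 b)\cdot a^{-1}\cdot(a\circ c)$. A relative Rota-Baxter group $(H,G,\phi,R)$ induces the skew left brace $H_R=(H,\cdot,\circ_R)$, $h_1\circ_Rh_2=h_1\phi_{R(h_1)}(h_2)$. An extension of relative Rota-Baxter groups induces the extension of skew left braces $1\to K_S\to H_R\to A_T\to 1$. Two extensions of skew left braces are equivalent if there is an isomorphism of the middle terms inducing identities on the ends. **Modules.** $\mathcal{K}=(K,L,\alpha,S)$, a trivial relative Rota-Baxter group with $K,L$ abelian, is an $\mathcal{A}$-module with action $(\nu,\mu,\sigma,f)$ if: (1) $\nu:B\to\operatorname{Aut}(K)$ is a homomorphism and $\mu:A\to\operatorname{Aut}(K)$ an anti-homomorphism; (2) $\sigma:B\to\operatorname{Aut}(L)$ is an anti-homomorphism; (3) $f:L\times A\to K$ satisfies $f(l_1l_2,a)=f(l_1,a)f(l_2,a)$ and $f(l,a_1a_2)=\mu_{a_2}(f(l,a_1))f(l,a_2)$; (4) $S(\nu^{-1}_{T(a)}(\mu_a(k))\,\nu^{-1}_{T(a)}(f(S(k),a)))=\sigma_{T(a)}(S(k))$; (5) $\nu_b(\mu_a(k))=\mu_{\beta_b(a)}(\nu_b(k))$; (6) $\nu_b(f(\sigma_b(l),a))=f(l,\beta_b(a))$. **$\operatorname{H}^2_{RRB}$.** $C^n(X,Y)$ (and $C(A\times B,K)$, $C(A,L)$, etc.) denote groups of maps sending tuples having an entry $1$ to $1$. $C^1_{RRB}=C^1(A,K)\oplus C^1(B,L)$, $C^2_{RRB}=C^2(A,K)\oplus C^2(B,L)\oplus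 C(A\times B,K)\oplus C(A,L)$. Put $\partial^1_\mu(\theta)(a_1,a_2)=\theta(a_2)\theta(a_1a_2)^{-1}\mu_{a_2}(\theta(a_1))$, $\partial^2_\mu(\tau)(a_1,a_2,a_3)=\tau(a_2,a_3)\tau(a_1a_2,a_3)^{-1}\tau(a_1,a_2a_3)\mu_{a_3}(\tau(a_1,a_2))^{-1}$, similarly $\partial^1_\sigma,\partial^2_\sigma$ with $(B,L,\sigma)$, and $\delta^1_\sigma(\chi)(a_1,a_2)=\chi(a_2)\chi(a_1\circ_Ta_2)^{-1}\sigma_{T(a_2)}(\chi(a_1))$. $\partial^1_{RRB}(\theta_1,\theta_2)=(\partial^1_\mu(\theta_1),\partial^1_\sigma(\theta_2),\lambda_1,\lambda_2)$, $\lambda_1(a,b)=\nu_b(f(\theta_2(b),a)\theta_1(a))\theta_1(\beta_b(a))^{-1}$, $\lambda_2(a)=S(\nu^{-1}_{T(a)}(\theta_1(a)))\theta_2(T(a))^{-1}$. $\partial^2_{RRB}(\tau_1,\tau_2,\rho,\chi)=(\partial^2_\mu(\tau_1),\partial^2_\sigma(\tau_2),\gamma_1,\gamma_2,\gamma_3)$ with $\gamma_1(a,b_1,b_2)=\rho(a,b_1b_2)\nu_{b_1b_2}(f(\tau_2(b_1,b_2),a))\rho(\beta_{b_2}(a),b_1)^{-1}\nu_{b_1}(\rho(a,b_2))^{-1}$, $\gamma_2(a_1,a_2,b)=\rho(a_1a_2,b)\nu_b(\tau_1(a_1,a_2))\mu_{\beta_b(a_2)}(\rho(a_1,b))^{-1}\rho(a_2,b)^{-1}\tau_1(\beta_b(a_1),\beta_b(a_2))^{-1}$,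 $\gamma_3(a_1,a_2)=S(\nu^{-1}_{T(a_1\circ_Ta_2)}(\rho(a_2,T(a_1))\tau_1(a_1,\beta_{T(a_1)}(a_2))\nu_{T(a_1)}(f(\chi(a_1),a_2))))\tau_2(T(a_1),T(a_2))^{-1}\delta^1_\sigma(\chi)(a_1,a_2)^{-1}$. $\operatorname{H}^2_{RRB}(\mathcal{A},\mathcal{K})=\ker\partial^2_{RRB}/\operatorname{im}\partial^1_{RRB}$. **$\operatorname{H}^2_N$.** Write $M=A_T=(A,\cdot,\circ)$ with $\circ=\circ_T$ and $I=K_S$ (the abelian group $K$ viewed as a trivial brace). Put $\xi_a=\nu_{T(a)}$, $\zeta_a=\mu_a$, $\epsilon_a(k)=\mu_{\beta_{T(a)^{-1}}(a)}(\nu_{T(a)^{-1}}(k))\,\nu_{T(a)^{-1}}(f(S(k),a))$. $\operatorname{Z}^2_N(M,I)$ is the group (under pointwise multiplication) of pairs $(g,h)$ of maps $M\times M\to I$ vanishing on degenerate tuples with, for all $m_i\in M$: $g(m_2,m_3)\,g(m_1m_2,m_3)^{-1}g(m_1,m_2m_3)\,\zeta_{m_3}(g(m_1,m_2))^{-1}=1$; $\xi_{m_1}(h(m_2,m_3))\,h(m_1\circ m_2,m_3)^{-1}h(m_1,m_2\circ m_3)\,\xi_{m_1\circ m_2\circ m_3}(\epsilon_{m_3}(\xi^{-1}_{m_1\circ m_2}(h(m_1,m_2))))^{-1}=1$; $\xi_{m_1}(g(m_2,m_3))\,\zeta_{m_1\circ m_3}(g(m_1,m_1^{-1}))\,\zeta_{m_1\circ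 m_3}(g(m_1\circ m_2,m_1^{-1}))^{-1}g((m_1\circ m_2)m_1^{-1},m_1\circ m_3)^{-1}\,\zeta_{m_1^{-1}(m_1\circ m_3)}(h(m_1,m_2))^{-1}h(m_1,m_2m_3)\,h(m_1,m_3)^{-1}=1$. $\operatorname{B}^2_N(M,I)$ consists of those $(g,h)\in \operatorname{Z}^2_N(M,I)$ for which there is $\theta:M\to I$ with $g(m_1,m_2)=\xi_{m_1m_2}(\theta(m_1m_2)^{-1})\zeta_{m_2}(\xi_{m_1}(\theta(m_1)))\xi_{m_2}(\theta(m_2))$ and $h(m_1,m_2)=\xi_{m_1\circ m_2}\big(\theta(m_1\circ m_2)^{-1}\epsilon_{m_2}(\theta(m_1))\theta(m_2)\big)$. $\operatorname{H}^2_N(M,I)=\operatorname{Z}^2_N(M,I)/\operatorname{B}^2_N(M,I)$. **The map.** $\Psi$ sends $[(\tau_1,\tau_2,\rho,\chi)]$ to the equivalence class of the extension $(H,G,\phi,R)$ where $H=A\times K$ with $(a_1,k_1)(a_2,k_2)=(a_1a_2,\mu_{a_2}(k_1)k_2\tau_1(a_1,a_2))$, $G=B\times L$ with $(b_1,l_1)(b_2,l_2)=(b_1b_2,\sigma_{b_2}(l_1)l_2\tau_2(b_1,b_2))$, $\phi_{(b,l)}(a,k)=(\beta_b(a),\rho(a,b)\nu_b(f(l,a)k))$, $R(a,k)=(T(a),\chi(a)S(\nu^{-1}_{T(a)}(k)))$. $\Pi$ sends the class of an extension of relative Rota-Baxter groups to the class of the induced extension of skew left braces. $\Lambda$ sends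 the class of an extension $1\to K_S\to E\to A_T\to1$ of skew left braces to $[(\tau,\tilde\tau)]$, where for a set-theoretic section $s:A\to E$ with $s(1)=1$, $\tau(m_1,m_2)=s(m_1m_2)^{-1}s(m_1)s(m_2)$ and $\tilde\tau(m_1,m_2)=s(m_1\circ m_2)^{-1}(s(m_1)\circ s(m_2))$. Explicitly, $\Lambda\Pi\Psi([(\tau_1,\tau_2,\rho,\chi)])=[(\tau_1,h)]$ with $h(a_1,a_2)=\tau_1(a_1,\beta_{T(a_1)}(a_2))\,\rho(a_2,T(a_1))\,\nu_{T(a_1)}(f(\chi(a_1),a_2))$. *)

theory Defs
  imports "HOL-Algebra.Bij" "HOL-Algebra.Product_Groups"
begin

section \<open>Relative Rota-Baxter groups, skew left braces and their extensions\<close>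

text \<open>
  Relative Rota-Baxter groups are quadruples \<open>(H, G, \<phi>, R)\<close>. A skew left brace
  \<open>(H, \<cdot>, \<circ>)\<close> is encoded as the pair of its two group structures on one carrier set.
  The value \<open>\<phi> g\<close> is an element of the library's \<^const>\<open>AutoGroup\<close>, hence
  extensional on the carrier; maps such as \<open>R\<close> are only relevant on carriers.
\<close>

type_synonym ('h, 'g) rrb = "'h monoid \<times> 'g monoid \<times> ('g \<Rightarrow> 'h \<Rightarrow> 'h) \<times> ('h \<Rightarrow> 'g)"
type_synonym 'h brace = "'h monoid \<times> 'h monoid"

fun rrb_group :: "('h, 'g) rrb \<Rightarrow> bool" where
  "rrb_group (H, G, \<phi>, R) \<longleftrightarrow>
     group H \<and> group G \<and> \<phi> \<in> hom G (AutoGroup H) \<and> R \<in> carrier H \<rightarrow> carrier G \<and>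
     (\<forall>h\<^sub>1\<in>carrier H. \<forall>h\<^sub>2\<in>carrier H.
        R h\<^sub>1 \<otimes>\<^bsub>G\<^esub> R h\<^sub>2 = R (h\<^sub>1 \<otimes>\<^bsub>H\<^esub> \<phi> (R h\<^sub>1) h\<^sub>2))"

fun trivial_rrb :: "('h, 'g) rrb \<Rightarrow> bool" where
  "trivial_rrb (H, G, \<phi>, R) \<longleftrightarrow> (\<forall>g\<in>carrier G. \<phi> g = \<one>\<^bsub>AutoGroup H\<^esub>)"

fun rrb_hom ::
  "('h, 'g) rrb \<Rightarrow> ('h2, 'g2) rrb \<Rightarrow> ('h \<Rightarrow> 'h2) \<times> ('g \<Rightarrow> 'g2) \<Rightarrow> bool" where
  "rrb_hom (H, G, \<phi>, R) (H', G', \<phi>', R') (\<psi>, \<eta>) \<longleftrightarrow>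
     \<psi> \<in> hom H H' \<and> \<eta> \<in> hom G G' \<and>
     (\<forall>h\<in>carrier H. \<eta> (R h) = R' (\<psi> h)) \<and>
     (\<forall>g\<in>carrier G. \<forall>h\<in>carrier H. \<psi> (\<phi> g h) = \<phi>' (\<eta> g) (\<psi> h))"

type_synonym ('k, 'l, 'h, 'g, 'a, 'b) rrb_extension =
  "('h, 'g) rrb \<times> (('k \<Rightarrow> 'h) \<times> ('l \<Rightarrow> 'g)) \<times> (('h \<Rightarrow> 'a) \<times> ('g \<Rightarrow> 'b))"

fun rrb_ext ::
  "('a, 'b) rrb \<Rightarrow> ('k, 'l) rrb \<Rightarrow> ('k, 'l, 'h, 'g, 'a, 'b) rrb_extension \<Rightarrow> bool" where
  "rrb_ext (A, B, \<beta>, T) (K, L, \<alpha>, S) ((H, G, \<phi>, R), (i\<^sub>1, i\<^sub>2), (\<pi>\<^sub>1, \<pi>\<^sub>2)) \<longleftrightarrow>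
     rrb_group (H, G, \<phi>, R) \<and>
     rrb_hom (K, L, \<alpha>, S) (H, G, \<phi>, R) (i\<^sub>1, i\<^sub>2) \<and>
     inj_on i\<^sub>1 (carrier K) \<and> inj_on i\<^sub>2 (carrier L) \<and>
     rrb_hom (H, G, \<phi>, R) (A, B, \<beta>, T) (\<pi>\<^sub>1, \<pi>\<^sub>2) \<and>
     \<pi>\<^sub>1 ` carrier H = carrier A \<and> \<pi>\<^sub>2 ` carrier G = carrier B \<and>
     i\<^sub>1 ` carrier K = kernel H A \<pi>\<^sub>1 \<and> i\<^sub>2 ` carrier L = kernel G B \<pi>\<^sub>2"

fun rrb_ext_equiv ::
  "('k, 'l) rrb \<Rightarrow> ('k, 'l, 'h, 'g, 'a, 'b) rrb_extension \<Rightarrow>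
     ('k, 'l, 'h2, 'g2, 'a, 'b) rrb_extension \<Rightarrow> bool" where
  "rrb_ext_equiv (K, L, \<alpha>, S)
       ((H, G, \<phi>, R), (i\<^sub>1, i\<^sub>2), (\<pi>\<^sub>1, \<pi>\<^sub>2)) ((H', G', \<phi>', R'), (i\<^sub>1', i\<^sub>2'), (\<pi>\<^sub>1', \<pi>\<^sub>2')) \<longleftrightarrow>
     (\<exists>\<psi> \<eta>. rrb_hom (H, G, \<phi>, R) (H', G', \<phi>', R') (\<psi>, \<eta>) \<and>
        bij_betw \<psi> (carrier H) (carrier H') \<and> bij_betw \<eta> (carrier G) (carrier G') \<and>
        (\<forall>k\<in>carrier K. \<psi> (i\<^sub>1 k) = i\<^sub>1' k) \<and> (\<forall>l\<in>carrier L. \<eta> (i\<^sub>2 l) = i\<^sub>2' l) \<and>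
        (\<forall>h\<in>carrier H. \<pi>\<^sub>1' (\<psi> h) = \<pi>\<^sub>1 h) \<and> (\<forall>g\<in>carrier G. \<pi>\<^sub>2' (\<eta> g) = \<pi>\<^sub>2 g))"

text \<open>
  Equivalence classes are formed among the extensions whose middle terms live on the same
  types as those of the given extension. For the extensions considered below these are the
  types of \<open>A \<times> K\<close> and \<open>B \<times> L\<close>, so every extension has an equivalent one among them.
\<close>

definition rrb_ext_class ::
  "('a, 'b) rrb \<Rightarrow> ('k, 'l) rrb \<Rightarrow> ('k, 'l, 'h, 'g, 'a, 'b) rrb_extension \<Rightarrow>
     ('k, 'l, 'h, 'g, 'a, 'b) rrb_extension set" where
  "rrb_ext_class \<A> \<K> \<E> = {\<E>'. rrb_ext \<A> \<K> \<E>' \<and> rrb_ext_equiv \<K> \<E> \<E>'}"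

fun skew_left_brace :: "'h brace \<Rightarrow> bool" where
  "skew_left_brace (H, Ho) \<longleftrightarrow>
     group H \<and> group Ho \<and> carrier Ho = carrier H \<and>
     (\<forall>a\<in>carrier H. \<forall>b\<in>carrier H. \<forall>c\<in>carrier H.
        a \<otimes>\<^bsub>Ho\<^esub> (b \<otimes>\<^bsub>H\<^esub> c) = (a \<otimes>\<^bsub>Ho\<^esub> b) \<otimes>\<^bsub>H\<^esub> inv\<^bsub>H\<^esub> a \<otimes>\<^bsub>H\<^esub> (a \<otimes>\<^bsub>Ho\<^esub> c))"

fun induced_brace :: "('h, 'g) rrb \<Rightarrow> 'h brace" where
  "induced_brace (H, G, \<phi>, R) =
     (H, \<lparr>carrier = carrier H, monoid.mult = (\<lambda>h\<^sub>1 h\<^sub>2. h\<^sub>1 \<otimes>\<^bsub>H\<^esub> \<phi> (R h\<^sub>1) h\<^sub>2), one = \<one>\<^bsub>H\<^esub>\<rparr>)"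

fun brace_hom :: "'h brace \<Rightarrow> 'h2 brace \<Rightarrow> ('h \<Rightarrow> 'h2) \<Rightarrow> bool" where
  "brace_hom (H, Ho) (H', Ho') \<psi> \<longleftrightarrow> \<psi> \<in> hom H H' \<and> \<psi> \<in> hom Ho Ho'"

type_synonym ('i, 'e, 'm) brace_extension = "'e brace \<times> ('i \<Rightarrow> 'e) \<times> ('e \<Rightarrow> 'm)"

fun brace_ext :: "'m brace \<Rightarrow> 'i brace \<Rightarrow> ('i, 'e, 'm) brace_extension \<Rightarrow> bool" where
  "brace_ext (M, Mo) (I, Io) ((E, Eo), i, \<pi>) \<longleftrightarrow>
     skew_left_brace (E, Eo) \<and>
     brace_hom (I, Io) (E, Eo) i \<and> inj_on i (carrier I) \<and>
     brace_hom (E, Eo) (M, Mo) \<pi> \<and> \<pi> ` carrier E = carrier M \<and>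
     i ` carrier I = kernel E M \<pi>"

fun brace_ext_equiv ::
  "'i brace \<Rightarrow> ('i, 'e, 'm) brace_extension \<Rightarrow> ('i, 'e2, 'm) brace_extension \<Rightarrow> bool" where
  "brace_ext_equiv (I, Io) ((E, Eo), i, \<pi>) ((E', Eo'), i', \<pi>') \<longleftrightarrow>
     (\<exists>\<psi>. brace_hom (E, Eo) (E', Eo') \<psi> \<and> bij_betw \<psi> (carrier E) (carrier E') \<and>
        (\<forall>k\<in>carrier I. \<psi> (i k) = i' k) \<and> (\<forall>e\<in>carrier E. \<pi>' (\<psi> e) = \<pi> e))"

definition brace_ext_class ::
  "'m brace \<Rightarrow> 'i brace \<Rightarrow> ('i, 'e, 'm) brace_extension \<Rightarrow> ('i, 'e, 'm) brace_extension set" where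
  "brace_ext_class M I \<E> = {\<E>'. brace_ext M I \<E>' \<and> brace_ext_equiv I \<E> \<E>'}"

fun induced_brace_ext ::
  "('k, 'l, 'h, 'g, 'a, 'b) rrb_extension \<Rightarrow> ('k, 'h, 'a) brace_extension" where
  "induced_brace_ext (\<H>, (i\<^sub>1, i\<^sub>2), (\<pi>\<^sub>1, \<pi>\<^sub>2)) = (induced_brace \<H>, i\<^sub>1, \<pi>\<^sub>1)"

section \<open>Modules over relative Rota-Baxter groups\<close>

definition antihom :: "('a, 'c) monoid_scheme \<Rightarrow> ('b, 'd) monoid_scheme \<Rightarrow> ('a \<Rightarrow> 'b) set" where
  "antihom G H = {h \<in> carrier G \<rightarrow> carrier H.
     \<forall>x\<in>carrier G. \<forall>y\<in>carrier G. h (x \<otimes>\<^bsub>G\<^esub> y) = h y \<otimes>\<^bsub>H\<^esub> h x}"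

text \<open>The action is \<open>(\<nu>, \<mu>, \<sigma>, f)\<close>, with \<open>f : L \<times> A \<rightarrow> K\<close> in curried form.\<close>

type_synonym ('a, 'b, 'k, 'l) rrb_action =
  "('b \<Rightarrow> 'k \<Rightarrow> 'k) \<times> ('a \<Rightarrow> 'k \<Rightarrow> 'k) \<times> ('b \<Rightarrow> 'l \<Rightarrow> 'l) \<times> ('l \<Rightarrow> 'a \<Rightarrow> 'k)"

fun rrb_module ::
  "('a, 'b) rrb \<Rightarrow> ('k, 'l) rrb \<Rightarrow> ('a, 'b, 'k, 'l) rrb_action \<Rightarrow> bool" where
  "rrb_module (A, B, \<beta>, T) (K, L, \<alpha>, S) (\<nu>, \<mu>, \<sigma>, f) \<longleftrightarrow>
     rrb_group (K, L, \<alpha>, S) \<and> trivial_rrb (K, L, \<alpha>, S) \<and> comm_group K \<and> comm_group L \<and>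
     \<nu> \<in> hom B (AutoGroup K) \<and> \<mu> \<in> antihom A (AutoGroup K) \<and>
     \<sigma> \<in> antihom B (AutoGroup L) \<and>
     f \<in> carrier L \<rightarrow> carrier A \<rightarrow> carrier K \<and>
     (\<forall>l\<^sub>1\<in>carrier L. \<forall>l\<^sub>2\<in>carrier L. \<forall>a\<in>carrier A.
        f (l\<^sub>1 \<otimes>\<^bsub>L\<^esub> l\<^sub>2) a = f l\<^sub>1 a \<otimes>\<^bsub>K\<^esub> f l\<^sub>2 a) \<and>
     (\<forall>l\<in>carrier L. \<forall>a\<^sub>1\<in>carrier A. \<forall>a\<^sub>2\<in>carrier A.
        f l (a\<^sub>1 \<otimes>\<^bsub>A\<^esub> a\<^sub>2) = \<mu> a\<^sub>2 (f l a\<^sub>1) \<otimes>\<^bsub>K\<^esub> f l a\<^sub>2) \<and>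
     (\<forall>a\<in>carrier A. \<forall>k\<in>carrier K.
        S ((inv\<^bsub>AutoGroup K\<^esub> (\<nu> (T a))) (\<mu> a k) \<otimes>\<^bsub>K\<^esub> (inv\<^bsub>AutoGroup K\<^esub> (\<nu> (T a))) (f (S k) a))
          = \<sigma> (T a) (S k)) \<and>
     (\<forall>a\<in>carrier A. \<forall>b\<in>carrier B. \<forall>k\<in>carrier K. \<nu> b (\<mu> a k) = \<mu> (\<beta> b a) (\<nu> b k)) \<and>
     (\<forall>a\<in>carrier A. \<forall>b\<in>carrier B. \<forall>l\<in>carrier L. \<nu> b (f (\<sigma> b l) a) = f l (\<beta> b a))"

section \<open>Normalised cochains\<close>

definition cochains ::
  "'x set \<Rightarrow> 'x set \<Rightarrow> ('y, 'c) monoid_scheme \<Rightarrow> ('x \<Rightarrow> 'y) monoid" where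
  "cochains D N Y = (product_group D (\<lambda>_. Y))
     \<lparr>carrier := {c \<in> carrier (product_group D (\<lambda>_. Y)). \<forall>x\<in>D \<inter> N. c x = \<one>\<^bsub>Y\<^esub>}\<rparr>"

definition cochains1 :: "'x monoid \<Rightarrow> 'y monoid \<Rightarrow> ('x \<Rightarrow> 'y) monoid" where
  "cochains1 X Y = cochains (carrier X) {\<one>\<^bsub>X\<^esub>} Y"

definition cochains2 :: "'x monoid \<Rightarrow> 'z monoid \<Rightarrow> 'y monoid \<Rightarrow> ('x \<times> 'z \<Rightarrow> 'y) monoid" where
  "cochains2 X Z Y =
     cochains (carrier X \<times> carrier Z) {(x, z). x = \<one>\<^bsub>X\<^esub> \<or> z = \<one>\<^bsub>Z\<^esub>} Y"

definition cochains3 ::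
  "'x monoid \<Rightarrow> 'z monoid \<Rightarrow> 'w monoid \<Rightarrow> 'y monoid \<Rightarrow> ('x \<times> 'z \<times> 'w \<Rightarrow> 'y) monoid" where
  "cochains3 X Z W Y =
     cochains (carrier X \<times> carrier Z \<times> carrier W)
       {(x, z, w). x = \<one>\<^bsub>X\<^esub> \<or> z = \<one>\<^bsub>Z\<^esub> \<or> w = \<one>\<^bsub>W\<^esub>} Y"

section \<open>Second cohomology of relative Rota-Baxter groups\<close>

definition bdry1 ::
  "'x monoid \<Rightarrow> 'y monoid \<Rightarrow> ('x \<Rightarrow> 'y \<Rightarrow> 'y) \<Rightarrow> ('x \<Rightarrow> 'y) \<Rightarrow> ('x \<times> 'x \<Rightarrow> 'y)" where
  "bdry1 X Y \<mu> \<theta> = (\<lambda>(a\<^sub>1, a\<^sub>2)\<in>carrier X \<times> carrier X.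
     \<theta> a\<^sub>2 \<otimes>\<^bsub>Y\<^esub> inv\<^bsub>Y\<^esub> (\<theta> (a\<^sub>1 \<otimes>\<^bsub>X\<^esub> a\<^sub>2)) \<otimes>\<^bsub>Y\<^esub> \<mu> a\<^sub>2 (\<theta> a\<^sub>1))"

definition bdry2 ::
  "'x monoid \<Rightarrow> 'y monoid \<Rightarrow> ('x \<Rightarrow> 'y \<Rightarrow> 'y) \<Rightarrow> ('x \<times> 'x \<Rightarrow> 'y) \<Rightarrow> ('x \<times> 'x \<times> 'x \<Rightarrow> 'y)" where
  "bdry2 X Y \<mu> \<tau> = (\<lambda>(a\<^sub>1, a\<^sub>2, a\<^sub>3)\<in>carrier X \<times> carrier X \<times> carrier X.
     \<tau> (a\<^sub>2, a\<^sub>3) \<otimes>\<^bsub>Y\<^esub> inv\<^bsub>Y\<^esub> (\<tau> (a\<^sub>1 \<otimes>\<^bsub>X\<^esub> a\<^sub>2, a\<^sub>3)) \<otimes>\<^bsub>Y\<^esub> \<tau> (a\<^sub>1, a\<^sub>2 \<otimes>\<^bsub>X\<^esub> a\<^sub>3)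
       \<otimes>\<^bsub>Y\<^esub> inv\<^bsub>Y\<^esub> (\<mu> a\<^sub>3 (\<tau> (a\<^sub>1, a\<^sub>2))))"

type_synonym ('a, 'b, 'k, 'l) cochain2_rrb =
  "('a \<times> 'a \<Rightarrow> 'k) \<times> ('b \<times> 'b \<Rightarrow> 'l) \<times> ('a \<times> 'b \<Rightarrow> 'k) \<times> ('a \<Rightarrow> 'l)"

type_synonym ('a, 'b, 'k, 'l) cochain3_rrb =
  "('a \<times> 'a \<times> 'a \<Rightarrow> 'k) \<times> ('b \<times> 'b \<times> 'b \<Rightarrow> 'l) \<times>
   ('a \<times> 'b \<times> 'b \<Rightarrow> 'k) \<times> ('a \<times> 'a \<times> 'b \<Rightarrow> 'k) \<times> ('a \<times> 'a \<Rightarrow> 'l)"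

fun C1_RRB :: "('a, 'b) rrb \<Rightarrow> ('k, 'l) rrb \<Rightarrow> (('a \<Rightarrow> 'k) \<times> ('b \<Rightarrow> 'l)) monoid" where
  "C1_RRB (A, B, \<beta>, T) (K, L, \<alpha>, S) = cochains1 A K \<times>\<times> cochains1 B L"

fun C2_RRB :: "('a, 'b) rrb \<Rightarrow> ('k, 'l) rrb \<Rightarrow> ('a, 'b, 'k, 'l) cochain2_rrb monoid" where
  "C2_RRB (A, B, \<beta>, T) (K, L, \<alpha>, S) =
     cochains2 A A K \<times>\<times> cochains2 B B L \<times>\<times> cochains2 A B K \<times>\<times> cochains1 A L"

fun C3_RRB :: "('a, 'b) rrb \<Rightarrow> ('k, 'l) rrb \<Rightarrow> ('a, 'b, 'k, 'l) cochain3_rrb monoid" where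
  "C3_RRB (A, B, \<beta>, T) (K, L, \<alpha>, S) =
     cochains3 A A A K \<times>\<times> cochains3 B B B L \<times>\<times>
     cochains3 A B B K \<times>\<times> cochains3 A A B K \<times>\<times> cochains2 A A L"

fun bdry1_RRB ::
  "('a, 'b) rrb \<Rightarrow> ('k, 'l) rrb \<Rightarrow> ('a, 'b, 'k, 'l) rrb_action \<Rightarrow>
     ('a \<Rightarrow> 'k) \<times> ('b \<Rightarrow> 'l) \<Rightarrow> ('a, 'b, 'k, 'l) cochain2_rrb" where
  "bdry1_RRB (A, B, \<beta>, T) (K, L, \<alpha>, S) (\<nu>, \<mu>, \<sigma>, f) (\<theta>\<^sub>1, \<theta>\<^sub>2) =
     (bdry1 A K \<mu> \<theta>\<^sub>1,
      bdry1 B L \<sigma> \<theta>\<^sub>2,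
      \<lambda>(a, b)\<in>carrier A \<times> carrier B.
        \<nu> b (f (\<theta>\<^sub>2 b) a \<otimes>\<^bsub>K\<^esub> \<theta>\<^sub>1 a) \<otimes>\<^bsub>K\<^esub> inv\<^bsub>K\<^esub> (\<theta>\<^sub>1 (\<beta> b a)),
      \<lambda>a\<in>carrier A.
        S ((inv\<^bsub>AutoGroup K\<^esub> (\<nu> (T a))) (\<theta>\<^sub>1 a)) \<otimes>\<^bsub>L\<^esub> inv\<^bsub>L\<^esub> (\<theta>\<^sub>2 (T a)))"

fun bdry2_RRB ::
  "('a, 'b) rrb \<Rightarrow> ('k, 'l) rrb \<Rightarrow> ('a, 'b, 'k, 'l) rrb_action \<Rightarrow>
     ('a, 'b, 'k, 'l) cochain2_rrb \<Rightarrow> ('a, 'b, 'k, 'l) cochain3_rrb" where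
  "bdry2_RRB (A, B, \<beta>, T) (K, L, \<alpha>, S) (\<nu>, \<mu>, \<sigma>, f) (\<tau>\<^sub>1, \<tau>\<^sub>2, \<rho>, \<chi>) =
     (let circ = (\<lambda>a\<^sub>1 a\<^sub>2. a\<^sub>1 \<otimes>\<^bsub>A\<^esub> \<beta> (T a\<^sub>1) a\<^sub>2);
          \<delta>\<chi> = (\<lambda>a\<^sub>1 a\<^sub>2. \<chi> a\<^sub>2 \<otimes>\<^bsub>L\<^esub> inv\<^bsub>L\<^esub> (\<chi> (circ a\<^sub>1 a\<^sub>2)) \<otimes>\<^bsub>L\<^esub> \<sigma> (T a\<^sub>2) (\<chi> a\<^sub>1))
      in
     (bdry2 A K \<mu> \<tau>\<^sub>1,
      bdry2 B L \<sigma> \<tau>\<^sub>2,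
      \<lambda>(a, b\<^sub>1, b\<^sub>2)\<in>carrier A \<times> carrier B \<times> carrier B.
        \<rho> (a, b\<^sub>1 \<otimes>\<^bsub>B\<^esub> b\<^sub>2) \<otimes>\<^bsub>K\<^esub> \<nu> (b\<^sub>1 \<otimes>\<^bsub>B\<^esub> b\<^sub>2) (f (\<tau>\<^sub>2 (b\<^sub>1, b\<^sub>2)) a)
          \<otimes>\<^bsub>K\<^esub> inv\<^bsub>K\<^esub> (\<rho> (\<beta> b\<^sub>2 a, b\<^sub>1)) \<otimes>\<^bsub>K\<^esub> inv\<^bsub>K\<^esub> (\<nu> b\<^sub>1 (\<rho> (a, b\<^sub>2))),
      \<lambda>(a\<^sub>1, a\<^sub>2, b)\<in>carrier A \<times> carrier A \<times> carrier B.
        \<rho> (a\<^sub>1 \<otimes>\<^bsub>A\<^esub> a\<^sub>2, b) \<otimes>\<^bsub>K\<^esub> \<nu> b (\<tau>\<^sub>1 (a\<^sub>1, a\<^sub>2))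
          \<otimes>\<^bsub>K\<^esub> inv\<^bsub>K\<^esub> (\<mu> (\<beta> b a\<^sub>2) (\<rho> (a\<^sub>1, b))) \<otimes>\<^bsub>K\<^esub> inv\<^bsub>K\<^esub> (\<rho> (a\<^sub>2, b))
          \<otimes>\<^bsub>K\<^esub> inv\<^bsub>K\<^esub> (\<tau>\<^sub>1 (\<beta> b a\<^sub>1, \<beta> b a\<^sub>2)),
      \<lambda>(a\<^sub>1, a\<^sub>2)\<in>carrier A \<times> carrier A.
        S ((inv\<^bsub>AutoGroup K\<^esub> (\<nu> (T (circ a\<^sub>1 a\<^sub>2))))
             (\<rho> (a\<^sub>2, T a\<^sub>1) \<otimes>\<^bsub>K\<^esub> \<tau>\<^sub>1 (a\<^sub>1, \<beta> (T a\<^sub>1) a\<^sub>2) \<otimes>\<^bsub>K\<^esub> \<nu> (T a\<^sub>1) (f (\<chi> a\<^sub>1) a\<^sub>2)))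
          \<otimes>\<^bsub>L\<^esub> inv\<^bsub>L\<^esub> (\<tau>\<^sub>2 (T a\<^sub>1, T a\<^sub>2)) \<otimes>\<^bsub>L\<^esub> inv\<^bsub>L\<^esub> (\<delta>\<chi> a\<^sub>1 a\<^sub>2)))"

definition Z2_RRB ::
  "('a, 'b) rrb \<Rightarrow> ('k, 'l) rrb \<Rightarrow> ('a, 'b, 'k, 'l) rrb_action \<Rightarrow>
     ('a, 'b, 'k, 'l) cochain2_rrb monoid" where
  "Z2_RRB \<A> \<K> act = (C2_RRB \<A> \<K>)
     \<lparr>carrier := kernel (C2_RRB \<A> \<K>) (C3_RRB \<A> \<K>) (bdry2_RRB \<A> \<K> act)\<rparr>"

definition B2_RRB ::
  "('a, 'b) rrb \<Rightarrow> ('k, 'l) rrb \<Rightarrow> ('a, 'b, 'k, 'l) rrb_action \<Rightarrow>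
     ('a, 'b, 'k, 'l) cochain2_rrb set" where
  "B2_RRB \<A> \<K> act = bdry1_RRB \<A> \<K> act ` carrier (C1_RRB \<A> \<K>)"

definition H2_RRB ::
  "('a, 'b) rrb \<Rightarrow> ('k, 'l) rrb \<Rightarrow> ('a, 'b, 'k, 'l) rrb_action \<Rightarrow>
     ('a, 'b, 'k, 'l) cochain2_rrb set monoid" where
  "H2_RRB \<A> \<K> act = Z2_RRB \<A> \<K> act Mod B2_RRB \<A> \<K> act"

section \<open>Second cohomology of skew left braces\<close>

type_synonym ('m, 'i) brace_action =
  "('m \<Rightarrow> 'i \<Rightarrow> 'i) \<times> ('m \<Rightarrow> 'i \<Rightarrow> 'i) \<times> ('m \<Rightarrow> 'i \<Rightarrow> 'i)"

type_synonym ('m, 'i) cochain2_N = "('m \<times> 'm \<Rightarrow> 'i) \<times> ('m \<times> 'm \<Rightarrow> 'i)"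

text \<open>The action \<open>(\<xi>, \<zeta>, \<epsilon>)\<close> of \<open>A\<^sub>T\<close> on \<open>K\<^sub>S\<close>.\<close>

fun induced_action ::
  "('a, 'b) rrb \<Rightarrow> ('k, 'l) rrb \<Rightarrow> ('a, 'b, 'k, 'l) rrb_action \<Rightarrow> ('a, 'k) brace_action" where
  "induced_action (A, B, \<beta>, T) (K, L, \<alpha>, S) (\<nu>, \<mu>, \<sigma>, f) =
     (\<lambda>a. \<nu> (T a),
      \<mu>,
      \<lambda>a k. \<mu> (\<beta> (inv\<^bsub>B\<^esub> (T a)) a) (\<nu> (inv\<^bsub>B\<^esub> (T a)) k)
        \<otimes>\<^bsub>K\<^esub> \<nu> (inv\<^bsub>B\<^esub> (T a)) (f (S k) a))"

fun Z2_N :: "'m brace \<Rightarrow> 'i brace \<Rightarrow> ('m, 'i) brace_action \<Rightarrow> ('m, 'i) cochain2_N monoid" where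
  "Z2_N (M, Mo) (I, Io) (\<xi>, \<zeta>, \<epsilon>) = (cochains2 M M I \<times>\<times> cochains2 M M I)
     \<lparr>carrier := {(g, h). (g, h) \<in> carrier (cochains2 M M I \<times>\<times> cochains2 M M I) \<and>
       (\<forall>m\<^sub>1\<in>carrier M. \<forall>m\<^sub>2\<in>carrier M. \<forall>m\<^sub>3\<in>carrier M.
          g (m\<^sub>2, m\<^sub>3) \<otimes>\<^bsub>I\<^esub> inv\<^bsub>I\<^esub> (g (m\<^sub>1 \<otimes>\<^bsub>M\<^esub> m\<^sub>2, m\<^sub>3)) \<otimes>\<^bsub>I\<^esub> g (m\<^sub>1, m\<^sub>2 \<otimes>\<^bsub>M\<^esub> m\<^sub>3)
            \<otimes>\<^bsub>I\<^esub> inv\<^bsub>I\<^esub> (\<zeta> m\<^sub>3 (g (m\<^sub>1, m\<^sub>2))) = \<one>\<^bsub>I\<^esub> \<and>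
          \<xi> m\<^sub>1 (h (m\<^sub>2, m\<^sub>3)) \<otimes>\<^bsub>I\<^esub> inv\<^bsub>I\<^esub> (h (m\<^sub>1 \<otimes>\<^bsub>Mo\<^esub> m\<^sub>2, m\<^sub>3))
            \<otimes>\<^bsub>I\<^esub> h (m\<^sub>1, m\<^sub>2 \<otimes>\<^bsub>Mo\<^esub> m\<^sub>3)
            \<otimes>\<^bsub>I\<^esub> inv\<^bsub>I\<^esub> (\<xi> (m\<^sub>1 \<otimes>\<^bsub>Mo\<^esub> m\<^sub>2 \<otimes>\<^bsub>Mo\<^esub> m\<^sub>3)
                 (\<epsilon> m\<^sub>3 ((inv\<^bsub>AutoGroup I\<^esub> (\<xi> (m\<^sub>1 \<otimes>\<^bsub>Mo\<^esub> m\<^sub>2))) (h (m\<^sub>1, m\<^sub>2))))) = \<one>\<^bsub>I\<^esub> \<and>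
          \<xi> m\<^sub>1 (g (m\<^sub>2, m\<^sub>3))
            \<otimes>\<^bsub>I\<^esub> \<zeta> (m\<^sub>1 \<otimes>\<^bsub>Mo\<^esub> m\<^sub>3) (g (m\<^sub>1, inv\<^bsub>M\<^esub> m\<^sub>1))
            \<otimes>\<^bsub>I\<^esub> inv\<^bsub>I\<^esub> (\<zeta> (m\<^sub>1 \<otimes>\<^bsub>Mo\<^esub> m\<^sub>3) (g (m\<^sub>1 \<otimes>\<^bsub>Mo\<^esub> m\<^sub>2, inv\<^bsub>M\<^esub> m\<^sub>1)))
            \<otimes>\<^bsub>I\<^esub> inv\<^bsub>I\<^esub> (g ((m\<^sub>1 \<otimes>\<^bsub>Mo\<^esub> m\<^sub>2) \<otimes>\<^bsub>M\<^esub> inv\<^bsub>M\<^esub> m\<^sub>1, m\<^sub>1 \<otimes>\<^bsub>Mo\<^esub> m\<^sub>3))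
            \<otimes>\<^bsub>I\<^esub> inv\<^bsub>I\<^esub> (\<zeta> (inv\<^bsub>M\<^esub> m\<^sub>1 \<otimes>\<^bsub>M\<^esub> (m\<^sub>1 \<otimes>\<^bsub>Mo\<^esub> m\<^sub>3)) (h (m\<^sub>1, m\<^sub>2)))
            \<otimes>\<^bsub>I\<^esub> h (m\<^sub>1, m\<^sub>2 \<otimes>\<^bsub>M\<^esub> m\<^sub>3) \<otimes>\<^bsub>I\<^esub> inv\<^bsub>I\<^esub> (h (m\<^sub>1, m\<^sub>3)) = \<one>\<^bsub>I\<^esub>)}\<rparr>"

fun B2_N :: "'m brace \<Rightarrow> 'i brace \<Rightarrow> ('m, 'i) brace_action \<Rightarrow> ('m, 'i) cochain2_N set" where
  "B2_N (M, Mo) (I, Io) (\<xi>, \<zeta>, \<epsilon>) =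
     {(g, h). (g, h) \<in> carrier (Z2_N (M, Mo) (I, Io) (\<xi>, \<zeta>, \<epsilon>)) \<and>
       (\<exists>\<theta>\<in>carrier M \<rightarrow> carrier I. \<forall>m\<^sub>1\<in>carrier M. \<forall>m\<^sub>2\<in>carrier M.
          g (m\<^sub>1, m\<^sub>2) = \<xi> (m\<^sub>1 \<otimes>\<^bsub>M\<^esub> m\<^sub>2) (inv\<^bsub>I\<^esub> (\<theta> (m\<^sub>1 \<otimes>\<^bsub>M\<^esub> m\<^sub>2)))
            \<otimes>\<^bsub>I\<^esub> \<zeta> m\<^sub>2 (\<xi> m\<^sub>1 (\<theta> m\<^sub>1)) \<otimes>\<^bsub>I\<^esub> \<xi> m\<^sub>2 (\<theta> m\<^sub>2) \<and>
          h (m\<^sub>1, m\<^sub>2) = \<xi> (m\<^sub>1 \<otimes>\<^bsub>Mo\<^esub> m\<^sub>2)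
            (inv\<^bsub>I\<^esub> (\<theta> (m\<^sub>1 \<otimes>\<^bsub>Mo\<^esub> m\<^sub>2)) \<otimes>\<^bsub>I\<^esub> \<epsilon> m\<^sub>2 (\<theta> m\<^sub>1) \<otimes>\<^bsub>I\<^esub> \<theta> m\<^sub>2))}"

definition H2_N ::
  "'m brace \<Rightarrow> 'i brace \<Rightarrow> ('m, 'i) brace_action \<Rightarrow> ('m, 'i) cochain2_N set monoid" where
  "H2_N M I act = Z2_N M I act Mod B2_N M I act"

section \<open>The maps between cohomology and extension classes\<close>

text \<open>
  Each map is given on representatives and descends to classes; as in the library's
  treatment of maps induced on quotients, the value on a class \<open>X\<close> is
  \<^term>\<open>the_elem (F ` X)\<close>, which is the common value of \<open>F\<close> on \<open>X\<close> and is
  unspecified if \<open>F\<close> is not constant on \<open>X\<close>.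
\<close>

fun cocycle_ext ::
  "('a, 'b) rrb \<Rightarrow> ('k, 'l) rrb \<Rightarrow> ('a, 'b, 'k, 'l) rrb_action \<Rightarrow>
     ('a, 'b, 'k, 'l) cochain2_rrb \<Rightarrow> ('k, 'l, 'a \<times> 'k, 'b \<times> 'l, 'a, 'b) rrb_extension" where
  "cocycle_ext (A, B, \<beta>, T) (K, L, \<alpha>, S) (\<nu>, \<mu>, \<sigma>, f) (\<tau>\<^sub>1, \<tau>\<^sub>2, \<rho>, \<chi>) =
     ((\<lparr>carrier = carrier A \<times> carrier K,
        monoid.mult = (\<lambda>(a\<^sub>1, k\<^sub>1) (a\<^sub>2, k\<^sub>2).
          (a\<^sub>1 \<otimes>\<^bsub>A\<^esub> a\<^sub>2, \<mu> a\<^sub>2 k\<^sub>1 \<otimes>\<^bsub>K\<^esub> k\<^sub>2 \<otimes>\<^bsub>K\<^esub> \<tau>\<^sub>1 (a\<^sub>1, a\<^sub>2))),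
        one = (\<one>\<^bsub>A\<^esub>, \<one>\<^bsub>K\<^esub>)\<rparr>,
       \<lparr>carrier = carrier B \<times> carrier L,
        monoid.mult = (\<lambda>(b\<^sub>1, l\<^sub>1) (b\<^sub>2, l\<^sub>2).
          (b\<^sub>1 \<otimes>\<^bsub>B\<^esub> b\<^sub>2, \<sigma> b\<^sub>2 l\<^sub>1 \<otimes>\<^bsub>L\<^esub> l\<^sub>2 \<otimes>\<^bsub>L\<^esub> \<tau>\<^sub>2 (b\<^sub>1, b\<^sub>2))),
        one = (\<one>\<^bsub>B\<^esub>, \<one>\<^bsub>L\<^esub>)\<rparr>,
       \<lambda>(b, l). \<lambda>(a, k)\<in>carrier A \<times> carrier K. (\<beta> b a, \<rho> (a, b) \<otimes>\<^bsub>K\<^esub> \<nu> b (f l a \<otimes>\<^bsub>K\<^esub> k)),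
       \<lambda>(a, k). (T a, \<chi> a \<otimes>\<^bsub>L\<^esub> S ((inv\<^bsub>AutoGroup K\<^esub> (\<nu> (T a))) k))),
      (\<lambda>k. (\<one>\<^bsub>A\<^esub>, k), \<lambda>l. (\<one>\<^bsub>B\<^esub>, l)),
      (fst, fst))"

definition Psi_map ::
  "('a, 'b) rrb \<Rightarrow> ('k, 'l) rrb \<Rightarrow> ('a, 'b, 'k, 'l) rrb_action \<Rightarrow>
     ('a, 'b, 'k, 'l) cochain2_rrb set \<Rightarrow>
     ('k, 'l, 'a \<times> 'k, 'b \<times> 'l, 'a, 'b) rrb_extension set" where
  "Psi_map \<A> \<K> act X = the_elem ((\<lambda>z. rrb_ext_class \<A> \<K> (cocycle_ext \<A> \<K> act z)) ` X)"

definition Pi_map ::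
  "('a, 'b) rrb \<Rightarrow> ('k, 'l) rrb \<Rightarrow>
     ('k, 'l, 'h, 'g, 'a, 'b) rrb_extension set \<Rightarrow> ('k, 'h, 'a) brace_extension set" where
  "Pi_map \<A> \<K> X =
     the_elem ((\<lambda>\<E>. brace_ext_class (induced_brace \<A>) (induced_brace \<K>) (induced_brace_ext \<E>)) ` X)"

fun normalised_section ::
  "'m brace \<Rightarrow> ('i, 'e, 'm) brace_extension \<Rightarrow> ('m \<Rightarrow> 'e) \<Rightarrow> bool" where
  "normalised_section (M, Mo) ((E, Eo), i, \<pi>) s \<longleftrightarrow>
     s \<in> carrier M \<rightarrow> carrier E \<and> (\<forall>m\<in>carrier M. \<pi> (s m) = m) \<and> s \<one>\<^bsub>M\<^esub> = \<one>\<^bsub>E\<^esub>"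

fun section_cocycle ::
  "'m brace \<Rightarrow> 'i brace \<Rightarrow> ('i, 'e, 'm) brace_extension \<Rightarrow> ('m \<Rightarrow> 'e) \<Rightarrow> ('m, 'i) cochain2_N" where
  "section_cocycle (M, Mo) (I, Io) ((E, Eo), i, \<pi>) s =
     (\<lambda>(m\<^sub>1, m\<^sub>2)\<in>carrier M \<times> carrier M.
        inv_into (carrier I) i (inv\<^bsub>E\<^esub> (s (m\<^sub>1 \<otimes>\<^bsub>M\<^esub> m\<^sub>2)) \<otimes>\<^bsub>E\<^esub> (s m\<^sub>1 \<otimes>\<^bsub>E\<^esub> s m\<^sub>2)),
      \<lambda>(m\<^sub>1, m\<^sub>2)\<in>carrier M \<times> carrier M.
        inv_into (carrier I) i (inv\<^bsub>E\<^esub> (s (m\<^sub>1 \<otimes>\<^bsub>Mo\<^esub> m\<^sub>2)) \<otimes>\<^bsub>E\<^esub> (s m\<^sub>1 \<otimes>\<^bsub>Eo\<^esub> s m\<^sub>2)))"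

definition Lambda_map ::
  "'m brace \<Rightarrow> 'i brace \<Rightarrow> ('m, 'i) brace_action \<Rightarrow>
     ('i, 'e, 'm) brace_extension set \<Rightarrow> ('m, 'i) cochain2_N set" where
  "Lambda_map M I act X =
     the_elem ((\<lambda>(\<E>, s). B2_N M I act #>\<^bsub>Z2_N M I act\<^esub> section_cocycle M I \<E> s) `
       (SIGMA \<E>:X. Collect (normalised_section M \<E>)))"

end

theory Submission
  imports Defs
begin

text \<open>
  Write \<open>\<Phi>(\<tau>\<^sub>1, \<tau>\<^sub>2, \<rho>, \<chi>) = (\<tau>\<^sub>1, h)\<close> with \<open>h\<close> as in the explicit formula for \<open>\<Lambda>\<Pi>\<Psi>\<close>. A section of the
  extension attached to a cocycle \<open>z\<close> has the form \<open>a \<mapsto> (a, \<theta> a)\<close>, and its cocycle is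
  \<open>\<Phi>(z)\<close> times \<open>\<Phi>(\<partial>\<^sup>1(\<theta>, 1))\<close>; so \<open>\<Lambda>\<Pi>\<Psi>\<close> is induced by \<open>\<Phi>\<close>.

  As \<open>T\<close> is bijective, subtracting the coboundary \<open>\<partial>\<^sup>1(1, \<theta>\<^sub>2)\<close> with \<open>\<theta>\<^sub>2(T a) = \<chi>(a)\<inverse>\<close> reduces
  every cocycle to one with \<open>\<chi> = 1\<close> and does not change its image under \<open>\<Phi>\<close>. For \<open>\<chi> = 1\<close> the pair
  \<open>(\<tau>\<^sub>1, h)\<close> determines \<open>\<rho>\<close> through the definition of \<open>h\<close>, and \<open>\<tau>\<^sub>2\<close> through \<open>\<gamma>\<^sub>3 = 1\<close>. The fourth module
  axiom says that \<open>S\<close> carries \<open>\<epsilon>\<^sub>a\<close> to \<open>\<sigma>\<close> at \<open>T a\<close>, so that, \<open>S\<close> being bijective, \<open>\<partial>\<^sup>2\<tau>\<^sub>2 = 1\<close> is the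
  second condition on \<open>(\<tau>\<^sub>1, h)\<close>; \<open>\<gamma>\<^sub>2 = 1\<close> is the third one, and \<open>\<gamma>\<^sub>1 = 1\<close> follows from the other
  conditions. Hence \<open>\<Phi>\<close> is onto, and an element of its kernel is one of the coboundaries
  \<open>\<partial>\<^sup>1(1, \<theta>\<^sub>2)\<close>.
\<close>

text \<open>The obstacle to a direct comparison is \<chi>: as long as it is arbitrary,
  \<open>\<gamma>\<^sub>3 = 1\<close> mixes \<open>\<tau>\<^sub>2\<close> with a boundary of \<chi>,
  which hides the second brace condition. Once \<chi> is trivial, \<open>\<tau>\<^sub>2\<close> at
  (T x, T y) is \<open>S\<close> of h(x, y) twisted by \<nu>, and identities can be carried between
  K and L by injectivity of \<open>S\<close>. The relation \<open>\<gamma>\<^sub>1 = 1\<close> comes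
  out because y \<circ> a is the product of y and \<open>\<beta> (T y) a\<close>: the second brace
  condition contains h at (x, y \<circ> a), the third one expands exactly this value, and together
  they give \<open>\<gamma>\<^sub>1 = 1\<close> at (a, T x, T y). The groups of brace cocycles and
  coboundaries are obtained as images under \<open>Phi\<close> of the groups on the other side. That
  \<open>Phi\<close> lands in the brace cocycles itself rests on its multiplicativity, which is
  therefore established first, with all pairs of cochains as target.\<close>

section \<open>Abelian groups and quotients\<close>

text \<open>Serves to deduce \<open>x = y\<close> from a known identity \<open>p = q\<close>: the
  crosswise product is a formal identity, which rewriting can decide, and the known factors cancel.
  The second version multiplies two known identities.\<close>

lemma (in comm_group) eq_by_factors:
  assumes "p = q" "x \<otimes> q = y \<otimes> p" "x \<in> carrier G" "y \<in> carrier G" "p \<in> carrier G"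
  shows "x = y"
  using assms by (metis right_cancel)

lemma (in comm_group) eq_by_factors2:
  assumes "p = q" "p' = q'" "x \<otimes> (q \<otimes> q') = y \<otimes> (p \<otimes> p')"
    "x \<in> carrier G" "y \<in> carrier G" "p \<in> carrier G" "p' \<in> carrier G"
  shows "x = y"
  using assms by (metis m_closed right_cancel)

text \<open>Formal fractions: \<open>fraction_simps\<close> together with \<open>m_ac\<close> turns an equation between
  products of elements and inverses into an inverse-free one, so that identities which hold in
  every abelian group are decided by the simplifier.\<close>

definition (in comm_group) quot :: "'a \<Rightarrow> 'a \<Rightarrow> 'a" where
  "quot x y = x \<otimes> inv y"

context comm_group
begin

lemma quot_closed [simp]: "\<lbrakk>x \<in> carrier G; y \<in> carrier G\<rbrakk> \<Longrightarrow> quot x y \<in> carrier G"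
  by (simp add: quot_def)

lemma inv_eq_quot: "x \<in> carrier G \<Longrightarrow> inv x = quot \<one> x"
  by (simp add: quot_def)

lemma mult_quot: "\<lbrakk>x \<in> carrier G; y \<in> carrier G; z \<in> carrier G\<rbrakk> \<Longrightarrow> x \<otimes> quot y z = quot (x \<otimes> y) z"
  by (simp add: quot_def m_assoc)

lemma quot_mult: "\<lbrakk>x \<in> carrier G; y \<in> carrier G; z \<in> carrier G\<rbrakk> \<Longrightarrow> quot y z \<otimes> x = quot (x \<otimes> y) z"
  by (simp add: quot_def m_ac)

lemma quot_quot_left:
  "\<lbrakk>x \<in> carrier G; y \<in> carrier G; z \<in> carrier G\<rbrakk> \<Longrightarrow> quot (quot x y) z = quot x (y \<otimes> z)"
  by (simp add: quot_def m_ac inv_mult)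

lemma quot_quot_right:
  "\<lbrakk>x \<in> carrier G; y \<in> carrier G; z \<in> carrier G\<rbrakk> \<Longrightarrow> quot x (quot y z) = quot (x \<otimes> z) y"
  by (simp add: quot_def m_ac inv_mult)

lemma quot_mult_cancel [simp]: "\<lbrakk>x \<in> carrier G; y \<in> carrier G\<rbrakk> \<Longrightarrow> quot x y \<otimes> y = x"
  by (simp add: quot_def m_assoc)

lemma eq_quot_iff:
  "\<lbrakk>x \<in> carrier G; y \<in> carrier G; z \<in> carrier G\<rbrakk> \<Longrightarrow> x = quot y z \<longleftrightarrow> x \<otimes> z = y"
  by (metis inv_solve_right' quot_def)

lemma quot_eq_iff:
  "\<lbrakk>x \<in> carrier G; y \<in> carrier G; z \<in> carrier G\<rbrakk> \<Longrightarrow> quot y z = x \<longleftrightarrow> y = x \<otimes> z"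
  by (metis eq_quot_iff)

lemmas fraction_simps = inv_eq_quot mult_quot quot_mult quot_quot_left quot_quot_right
  eq_quot_iff quot_eq_iff

end

text \<open>\<open>F\<close> is known only through its values on cosets, being a composite of maps
  on classes; \<open>h\<close> computes it on representatives. Surjectivity passes from
  \<open>h\<close> to \<open>F\<close>, and \<open>F\<close> is injective because \<open>N\<close>
  is the full preimage of \<open>N'\<close>.\<close>

lemma FactGroup_isoI:
  assumes "comm_group G" "comm_group G'" "subgroup N G" "subgroup N' G'"
    and h: "h \<in> hom G G'" "h ` carrier G = carrier G'"
    and N: "\<And>z. z \<in> carrier G \<Longrightarrow> h z \<in> N' \<longleftrightarrow> z \<in> N"
    and F: "\<And>z. z \<in> carrier G \<Longrightarrow> F (N #>\<^bsub>G\<^esub> z) = N' #>\<^bsub>G'\<^esub> h z"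
  shows "F \<in> iso (G Mod N) (G' Mod N')"
proof -
  interpret G: comm_group G by fact
  interpret G': comm_group G' by fact
  interpret N: normal N G using G.subgroup_imp_normal assms(3) by blast
  interpret N': normal N' G' using G'.subgroup_imp_normal assms(4) by blast
  interpret h: group_hom G G' h using h(1) by unfold_locales auto
  have coset_eq: "N #>\<^bsub>G\<^esub> x = N #>\<^bsub>G\<^esub> y \<longleftrightarrow> x \<otimes>\<^bsub>G\<^esub> inv\<^bsub>G\<^esub> y \<in> N"
    if "x \<in> carrier G" "y \<in> carrier G" for x y
    using that by (metis G.m_comm G.coset_mult_inv1 G.coset_mult_inv2 G.coset_join1 G.coset_join2
        G.inv_closed G.m_closed N.subset N.is_subgroup)
  have coset_eq': "N' #>\<^bsub>G'\<^esub> x = N' #>\<^bsub>G'\<^esub> y \<longleftrightarrow> x \<otimes>\<^bsub>G'\<^esub> inv\<^bsub>G'\<^esub> y \<in> N'"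
    if "x \<in> carrier G'" "y \<in> carrier G'" for x y
    using that by (metis G'.m_comm G'.coset_mult_inv1 G'.coset_mult_inv2 G'.coset_join1 G'.coset_join2
        G'.inv_closed G'.m_closed N'.subset N'.is_subgroup)
  have "F \<in> hom (G Mod N) (G' Mod N')"
    by (auto simp: hom_def carrier_FactGroup F N.rcos_sum N'.rcos_sum)
  moreover have "inj_on F (carrier (G Mod N))"
  proof (rule inj_onI)
    fix X Y assume "X \<in> carrier (G Mod N)" "Y \<in> carrier (G Mod N)" "F X = F Y"
    then obtain x y where xy: "x \<in> carrier G" "y \<in> carrier G" "X = N #>\<^bsub>G\<^esub> x" "Y = N #>\<^bsub>G\<^esub> y"
      by (auto simp: carrier_FactGroup)
    with \<open>F X = F Y\<close> have "h x \<otimes>\<^bsub>G'\<^esub> inv\<^bsub>G'\<^esub> h y \<in> N'"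
      by (simp add: F coset_eq')
    then have "h (x \<otimes>\<^bsub>G\<^esub> inv\<^bsub>G\<^esub> y) \<in> N'"
      using xy by simp
    then show "X = Y"
      using xy N[of "x \<otimes>\<^bsub>G\<^esub> inv\<^bsub>G\<^esub> y"] coset_eq by simp
  qed
  moreover have "F ` carrier (G Mod N) = carrier (G' Mod N')"
    by (auto simp: carrier_FactGroup image_image F simp flip: h(2))
  ultimately show ?thesis
    by (simp add: iso_def bij_betw_def)
qed

section \<open>Products and subgroups of abelian groups, and criteria in terms of quotients\<close>

lemma comm_group_DirProd:
  assumes "comm_group G" "comm_group H"
  shows "comm_group (G \<times>\<times> H)"
proof -
  interpret G: comm_group G by fact
  interpret H: comm_group H by fact
  interpret group "G \<times>\<times> H" by (rule DirProd_group) unfold_locales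
  show ?thesis
    by unfold_locales (auto simp: G.m_comm H.m_comm)
qed

lemma (in comm_group) comm_group_subgroup:
  assumes "subgroup H G"
  shows "comm_group (G\<lparr>carrier := H\<rparr>)"
  using assms by (intro group.group_comm_groupI subgroup_imp_group)
    (auto intro: m_comm dest: subgroup.mem_carrier)

lemma (in group) subgroup_divI:
  assumes "H \<subseteq> carrier G" "H \<noteq> {}" "\<And>x y. x \<in> H \<Longrightarrow> y \<in> H \<Longrightarrow> x \<otimes> inv y \<in> H"
  shows "subgroup H G"
proof (rule subgroupI)
  have "\<one> \<in> H"
    using assms by (metis all_not_in_conv r_inv subsetD)
  then show "inv x \<in> H" if "x \<in> H" for x
    using assms(1,3) that by (metis inv_closed l_one subsetD)
  then show "x \<otimes> y \<in> H" if "x \<in> H" "y \<in> H" for x y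
    using assms(1,3) that by (metis inv_inv subsetD)
qed (use assms in auto)

lemma (in group) div_subgroup:
  assumes "subgroup H G" "x \<in> H" "y \<in> H"
  shows "x \<otimes>\<^bsub>G\<lparr>carrier := H\<rparr>\<^esub> inv\<^bsub>G\<lparr>carrier := H\<rparr>\<^esub> y = x \<otimes> inv y"
  using assms by (simp add: m_inv_consistent)

text \<open>Testing on quotients x/y treats products and inverses in one computation. It suits
  cochain groups, where quotients are pointwise and the fraction calculus decides the resulting
  identities.\<close>

lemma hom_divI:
  assumes "group G" "group H" "h \<in> carrier G \<rightarrow> carrier H"
    and div: "\<And>x y. x \<in> carrier G \<Longrightarrow> y \<in> carrier G \<Longrightarrow> h (x \<otimes>\<^bsub>G\<^esub> inv\<^bsub>G\<^esub> y) = h x \<otimes>\<^bsub>H\<^esub> inv\<^bsub>H\<^esub> h y"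
  shows "h \<in> hom G H"
proof -
  interpret G: group G by fact
  interpret H: group H by fact
  have h [simp]: "h x \<in> carrier H" if "x \<in> carrier G" for x
    using assms(3) that by auto
  have one: "h \<one>\<^bsub>G\<^esub> = \<one>\<^bsub>H\<^esub>"
    using div[of "\<one>\<^bsub>G\<^esub>" "\<one>\<^bsub>G\<^esub>"] by simp
  have inv: "h (inv\<^bsub>G\<^esub> x) = inv\<^bsub>H\<^esub> h x" if "x \<in> carrier G" for x
    using div[of "\<one>\<^bsub>G\<^esub>" x] that by (simp add: one)
  have "h (x \<otimes>\<^bsub>G\<^esub> y) = h x \<otimes>\<^bsub>H\<^esub> h y" if "x \<in> carrier G" "y \<in> carrier G" for x y
    using div[of x "inv\<^bsub>G\<^esub> y"] that by (simp add: inv)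
  then show ?thesis
    by (simp add: hom_def)
qed

lemma carrier_update: "carrier (G\<lparr>carrier := X\<rparr>) = X"
  by simp

lemma the_elem_image_const: "X \<noteq> {} \<Longrightarrow> (\<And>x. x \<in> X \<Longrightarrow> F x = c) \<Longrightarrow> the_elem (F ` X) = c"
  by (metis the_elem_image_unique all_not_in_conv)

section \<open>Normalised cochains\<close>

lemma carrier_cochains: "carrier (cochains D N Y) = {c \<in> D \<rightarrow>\<^sub>E carrier Y. \<forall>x\<in>D \<inter> N. c x = \<one>\<^bsub>Y\<^esub>}"
  by (simp add: cochains_def)

lemma extensional_cochains1: "c \<in> carrier (cochains1 U W) \<Longrightarrow> c \<in> extensional (carrier U)"
  and extensional_cochains2: "d \<in> carrier (cochains2 U V W) \<Longrightarrow> d \<in> extensional (carrier U \<times> carrier V)"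
  by (simp_all add: cochains1_def cochains2_def carrier_cochains PiE_iff)

lemma mult_cochains: "c \<otimes>\<^bsub>cochains D N Y\<^esub> d = (\<lambda>x\<in>D. c x \<otimes>\<^bsub>Y\<^esub> d x)"
  by (simp add: cochains_def)

lemma one_cochains: "\<one>\<^bsub>cochains D N Y\<^esub> = (\<lambda>x\<in>D. \<one>\<^bsub>Y\<^esub>)"
  by (simp add: cochains_def)

lemma restrict2_eq_iff:
    "(\<lambda>(x, y)\<in>X \<times> Y. F x y) = (\<lambda>_\<in>X \<times> Y. c) \<longleftrightarrow> (\<forall>x\<in>X. \<forall>y\<in>Y. F x y = c)"
  and restrict3_eq_iff:
    "(\<lambda>(x, y, z)\<in>X \<times> Y \<times> Z. E x y z) = (\<lambda>_\<in>X \<times> Y \<times> Z. c)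
      \<longleftrightarrow> (\<forall>x\<in>X. \<forall>y\<in>Y. \<forall>z\<in>Z. E x y z = c)"
  by (auto simp: fun_eq_iff restrict_def)

lemma comm_group_cochains:
  assumes "comm_group Y"
  shows "comm_group (cochains D N Y)"
proof -
  interpret Y: comm_group Y by fact
  show ?thesis
  proof (rule comm_groupI)
    fix c assume c: "c \<in> carrier (cochains D N Y)"
    show "\<exists>d\<in>carrier (cochains D N Y). d \<otimes>\<^bsub>cochains D N Y\<^esub> c = \<one>\<^bsub>cochains D N Y\<^esub>"
      using c by (intro bexI[of _ "\<lambda>x\<in>D. inv\<^bsub>Y\<^esub> (c x)"])
        (auto simp: carrier_cochains mult_cochains one_cochains PiE_iff fun_eq_iff)
  qed (auto simp: carrier_cochains mult_cochains one_cochains PiE_iff fun_eq_iff extensional_def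
      Y.m_ac restrict_def)
qed

lemma inv_cochains:
  assumes "comm_group Y" "c \<in> carrier (cochains D N Y)"
  shows "inv\<^bsub>cochains D N Y\<^esub> c = (\<lambda>x\<in>D. inv\<^bsub>Y\<^esub> (c x))"
proof -
  interpret Y: comm_group Y by fact
  interpret C: comm_group "cochains D N Y" using assms(1) by (rule comm_group_cochains)
  show ?thesis
    using assms(2) by (intro C.inv_equality)
      (auto simp: carrier_cochains mult_cochains one_cochains PiE_iff fun_eq_iff)
qed

lemma div_cochains:
  assumes "comm_group Y" "c \<in> carrier (cochains D N Y)" "d \<in> carrier (cochains D N Y)"
  shows "c \<otimes>\<^bsub>cochains D N Y\<^esub> inv\<^bsub>cochains D N Y\<^esub> d = (\<lambda>x\<in>D. c x \<otimes>\<^bsub>Y\<^esub> inv\<^bsub>Y\<^esub> (d x))"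
  using assms by (simp add: inv_cochains mult_cochains restrict_def fun_eq_iff)

lemma cochains1D:
  assumes "t \<in> carrier (cochains1 U W)"
  shows "u \<in> carrier U \<Longrightarrow> t u \<in> carrier W"
    and "\<one>\<^bsub>U\<^esub> \<in> carrier U \<Longrightarrow> t \<one>\<^bsub>U\<^esub> = \<one>\<^bsub>W\<^esub>"
  using assms by (auto simp: cochains1_def carrier_cochains)

lemma cochains2D:
  assumes "t \<in> carrier (cochains2 U V W)"
  shows "u \<in> carrier U \<Longrightarrow> v \<in> carrier V \<Longrightarrow> t (u, v) \<in> carrier W"
    and "v \<in> carrier V \<Longrightarrow> \<one>\<^bsub>U\<^esub> \<in> carrier U \<Longrightarrow> t (\<one>\<^bsub>U\<^esub>, v) = \<one>\<^bsub>W\<^esub>"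
    and "u \<in> carrier U \<Longrightarrow> \<one>\<^bsub>V\<^esub> \<in> carrier V \<Longrightarrow> t (u, \<one>\<^bsub>V\<^esub>) = \<one>\<^bsub>W\<^esub>"
  using assms by (auto simp: cochains2_def carrier_cochains)

section \<open>Right modules and their cocycles\<close>

text \<open>Common frame for \<mu> (A acting on K) and \<sigma> (B acting on L). Both are
  anti-homomorphisms into automorphisms, that is, right actions, which explains the order of
  composition in \<open>m_comp\<close>.\<close>

locale right_module =
  fixes X :: "'x monoid" and Y :: "'y monoid" and m :: "'x \<Rightarrow> 'y \<Rightarrow> 'y"
  assumes group_X: "group X" and comm_group_Y: "comm_group Y"
    and m_closed [simp]: "x \<in> carrier X \<Longrightarrow> y \<in> carrier Y \<Longrightarrow> m x y \<in> carrier Y"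
    and m_mult: "\<lbrakk>x \<in> carrier X; y\<^sub>1 \<in> carrier Y; y\<^sub>2 \<in> carrier Y\<rbrakk> \<Longrightarrow> m x (y\<^sub>1 \<otimes>\<^bsub>Y\<^esub> y\<^sub>2) = m x y\<^sub>1 \<otimes>\<^bsub>Y\<^esub> m x y\<^sub>2"
    and m_comp: "\<lbrakk>x\<^sub>1 \<in> carrier X; x\<^sub>2 \<in> carrier X; y \<in> carrier Y\<rbrakk> \<Longrightarrow> m (x\<^sub>1 \<otimes>\<^bsub>X\<^esub> x\<^sub>2) y = m x\<^sub>2 (m x\<^sub>1 y)"
    and m_one [simp]: "y \<in> carrier Y \<Longrightarrow> m \<one>\<^bsub>X\<^esub> y = y"
begin

sublocale X: group X by (rule group_X)
sublocale Y: comm_group Y by (rule comm_group_Y)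

lemma m_Y_one [simp]: "x \<in> carrier X \<Longrightarrow> m x \<one>\<^bsub>Y\<^esub> = \<one>\<^bsub>Y\<^esub>"
  by (metis Y.l_cancel_one Y.one_closed Y.r_one m_closed m_mult)

lemma m_Y_inv: "x \<in> carrier X \<Longrightarrow> y \<in> carrier Y \<Longrightarrow> m x (inv\<^bsub>Y\<^esub> y) = inv\<^bsub>Y\<^esub> m x y"
  by (metis Y.inv_closed Y.inv_equality Y.l_inv m_Y_one m_closed m_mult)

lemma m_quot:
  "\<lbrakk>x \<in> carrier X; y\<^sub>1 \<in> carrier Y; y\<^sub>2 \<in> carrier Y\<rbrakk> \<Longrightarrow> m x (Y.quot y\<^sub>1 y\<^sub>2) = Y.quot (m x y\<^sub>1) (m x y\<^sub>2)"
  by (simp add: Y.quot_def m_mult m_Y_inv)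

text \<open>The identity is the vanishing of \<open>bdry2\<close> cleared of inverses, the form in
  which cocycle identities can be multiplied with others.\<close>

definition is_cocycle :: "('x \<times> 'x \<Rightarrow> 'y) \<Rightarrow> bool" where
  "is_cocycle t \<longleftrightarrow> t \<in> carrier (cochains2 X X Y) \<and>
     (\<forall>x\<in>carrier X. \<forall>y\<in>carrier X. \<forall>z\<in>carrier X.
        t (y, z) \<otimes>\<^bsub>Y\<^esub> t (x, y \<otimes>\<^bsub>X\<^esub> z) = t (x \<otimes>\<^bsub>X\<^esub> y, z) \<otimes>\<^bsub>Y\<^esub> m z (t (x, y)))"

lemma bdry2_eq_one_iff:
  assumes "t \<in> carrier (cochains2 X X Y)"
  shows "bdry2 X Y m t = \<one>\<^bsub>cochains3 X X X Y\<^esub> \<longleftrightarrow> is_cocycle t"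
  using assms
  by (simp add: is_cocycle_def bdry2_def cochains3_def one_cochains fun_eq_iff restrict_def
      Y.fraction_simps Y.m_ac cochains2D) blast

lemma is_cocycle_bdry1:
  assumes "t \<in> carrier (cochains1 X Y)"
  shows "is_cocycle (bdry1 X Y m t)"
proof -
  have [simp]: "t x \<in> carrier Y" if "x \<in> carrier X" for x
    using assms that by (auto simp: cochains1_def carrier_cochains)
  have [simp]: "t \<one>\<^bsub>X\<^esub> = \<one>\<^bsub>Y\<^esub>"
    using assms by (auto simp: cochains1_def carrier_cochains)
  have "bdry1 X Y m t \<in> carrier (cochains2 X X Y)"
    by (auto simp: cochains2_def carrier_cochains bdry1_def)
  moreover have "bdry1 X Y m t (y, z) \<otimes>\<^bsub>Y\<^esub> bdry1 X Y m t (x, y \<otimes>\<^bsub>X\<^esub> z)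
      = bdry1 X Y m t (x \<otimes>\<^bsub>X\<^esub> y, z) \<otimes>\<^bsub>Y\<^esub> m z (bdry1 X Y m t (x, y))"
    if "x \<in> carrier X" "y \<in> carrier X" "z \<in> carrier X" for x y z
  proof -
    show ?thesis
      using that by (simp add: bdry1_def m_mult m_comp m_quot X.m_assoc Y.fraction_simps Y.m_ac)
  qed
  ultimately show ?thesis
    by (simp add: is_cocycle_def)
qed

end

text \<open>Both middle groups of \<open>cocycle_ext\<close> have this shape, so the group axioms
  are proved once for the two of them.\<close>

definition cocycle_group ::
  "'x monoid \<Rightarrow> 'y monoid \<Rightarrow> ('x \<Rightarrow> 'y \<Rightarrow> 'y) \<Rightarrow> ('x \<times> 'x \<Rightarrow> 'y) \<Rightarrow> ('x \<times> 'y) monoid" where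
  "cocycle_group X Y m t =
     \<lparr>carrier = carrier X \<times> carrier Y,
      monoid.mult = (\<lambda>(x\<^sub>1, y\<^sub>1) (x\<^sub>2, y\<^sub>2).
        (x\<^sub>1 \<otimes>\<^bsub>X\<^esub> x\<^sub>2, m x\<^sub>2 y\<^sub>1 \<otimes>\<^bsub>Y\<^esub> y\<^sub>2 \<otimes>\<^bsub>Y\<^esub> t (x\<^sub>1, x\<^sub>2))),
      one = (\<one>\<^bsub>X\<^esub>, \<one>\<^bsub>Y\<^esub>)\<rparr>"

lemma carrier_cocycle_group [simp]: "carrier (cocycle_group X Y m t) = carrier X \<times> carrier Y"
  and mult_cocycle_group [simp]: "(x\<^sub>1, y\<^sub>1) \<otimes>\<^bsub>cocycle_group X Y m t\<^esub> (x\<^sub>2, y\<^sub>2)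
    = (x\<^sub>1 \<otimes>\<^bsub>X\<^esub> x\<^sub>2, m x\<^sub>2 y\<^sub>1 \<otimes>\<^bsub>Y\<^esub> y\<^sub>2 \<otimes>\<^bsub>Y\<^esub> t (x\<^sub>1, x\<^sub>2))"
  and one_cocycle_group [simp]: "\<one>\<^bsub>cocycle_group X Y m t\<^esub> = (\<one>\<^bsub>X\<^esub>, \<one>\<^bsub>Y\<^esub>)"
  by (simp_all add: cocycle_group_def)

context right_module
begin

text \<open>Associativity comes from the cocycle identity, and normalisation makes the pair of
  identities a left identity.\<close>

lemma group_cocycle_group:
  assumes "is_cocycle t"
  shows "group (cocycle_group X Y m t)"
proof -
  have [simp]: "t (x, y) \<in> carrier Y" if "x \<in> carrier X" "y \<in> carrier X" for x y
    using assms that by (auto simp: is_cocycle_def dest: cochains2D)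
  have [simp]: "t (\<one>\<^bsub>X\<^esub>, x) = \<one>\<^bsub>Y\<^esub>" if "x \<in> carrier X" for x
    using assms that by (auto simp: is_cocycle_def dest: cochains2D)
  show ?thesis
  proof (rule groupI)
    fix p q r
    assume "p \<in> carrier (cocycle_group X Y m t)" "q \<in> carrier (cocycle_group X Y m t)"
      "r \<in> carrier (cocycle_group X Y m t)"
    then obtain a1 k1 a2 k2 a3 k3 where eqs: "p = (a1, k1)" "q = (a2, k2)" "r = (a3, k3)"
      and c: "a1 \<in> carrier X" "a2 \<in> carrier X" "a3 \<in> carrier X" "k1 \<in> carrier Y" "k2 \<in> carrier Y" "k3 \<in> carrier Y"
      by auto
    have "t (a2, a3) \<otimes>\<^bsub>Y\<^esub> t (a1, a2 \<otimes>\<^bsub>X\<^esub> a3) = t (a1 \<otimes>\<^bsub>X\<^esub> a2, a3) \<otimes>\<^bsub>Y\<^esub> m a3 (t (a1, a2))"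
      using assms c by (simp add: is_cocycle_def)
    from this[symmetric] have "m a3 (m a2 k1 \<otimes>\<^bsub>Y\<^esub> k2 \<otimes>\<^bsub>Y\<^esub> t (a1, a2)) \<otimes>\<^bsub>Y\<^esub> k3 \<otimes>\<^bsub>Y\<^esub> t (a1 \<otimes>\<^bsub>X\<^esub> a2, a3)
      = m (a2 \<otimes>\<^bsub>X\<^esub> a3) k1 \<otimes>\<^bsub>Y\<^esub> (m a3 k2 \<otimes>\<^bsub>Y\<^esub> k3 \<otimes>\<^bsub>Y\<^esub> t (a2, a3)) \<otimes>\<^bsub>Y\<^esub> t (a1, a2 \<otimes>\<^bsub>X\<^esub> a3)"
      by (rule Y.eq_by_factors) (use c in \<open>simp_all add: m_mult m_comp Y.m_ac\<close>)
    then show "p \<otimes>\<^bsub>cocycle_group X Y m t\<^esub> q \<otimes>\<^bsub>cocycle_group X Y m t\<^esub> r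
      = p \<otimes>\<^bsub>cocycle_group X Y m t\<^esub> (q \<otimes>\<^bsub>cocycle_group X Y m t\<^esub> r)"
      using c by (simp add: eqs X.m_assoc)
  next
    fix p assume "p \<in> carrier (cocycle_group X Y m t)"
    then obtain a k where eqs: "p = (a, k)" and c: "a \<in> carrier X" "k \<in> carrier Y"
      by auto
    \<comment> \<open>A left inverse of \<open>(a, k)\<close> with second coordinate j must satisfy
      \<open>m a j\<close> times \<open>k\<close> times \<open>t (inv a, a)\<close> equal to one;
      solving for j means undoing \<open>m a\<close> by the action of the inverse of
      \<open>a\<close>.\<close>
    let ?j = "m (inv\<^bsub>X\<^esub> a) (inv\<^bsub>Y\<^esub> (k \<otimes>\<^bsub>Y\<^esub> t (inv\<^bsub>X\<^esub> a, a)))"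
    have "m a ?j = inv\<^bsub>Y\<^esub> (k \<otimes>\<^bsub>Y\<^esub> t (inv\<^bsub>X\<^esub> a, a))"
      using c by (simp flip: m_comp)
    then have "m a ?j \<otimes>\<^bsub>Y\<^esub> k \<otimes>\<^bsub>Y\<^esub> t (inv\<^bsub>X\<^esub> a, a) = \<one>\<^bsub>Y\<^esub>"
      using c by (simp add: Y.m_assoc)
    then show "\<exists>q\<in>carrier (cocycle_group X Y m t).
        q \<otimes>\<^bsub>cocycle_group X Y m t\<^esub> p = \<one>\<^bsub>cocycle_group X Y m t\<^esub>"
      using c by (intro bexI[of _ "(inv\<^bsub>X\<^esub> a, ?j)"]) (auto simp: eqs)
  qed (auto)
qed

end

section \<open>Actions by automorphisms\<close>

lemma AutoGroup_carrierD:
  assumes "u \<in> carrier (AutoGroup H)"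
  shows "u \<in> hom H H" "u \<in> extensional (carrier H)" "bij_betw u (carrier H) (carrier H)"
  using assms by (auto simp: AutoGroup_def auto_def Bij_def)

lemma one_AutoGroup: "\<one>\<^bsub>AutoGroup H\<^esub> = (\<lambda>x\<in>carrier H. x)"
  by (simp add: AutoGroup_def BijGroup_def)

lemma mult_AutoGroup:
  assumes "u \<in> carrier (AutoGroup H)" "v \<in> carrier (AutoGroup H)"
  shows "u \<otimes>\<^bsub>AutoGroup H\<^esub> v = compose (carrier H) u v"
  using assms by (simp add: AutoGroup_def BijGroup_def auto_def)

lemma hom_AutoGroupD:
  assumes "\<phi> \<in> hom G (AutoGroup H)" "group G" "group H"
  shows "\<And>g h. g \<in> carrier G \<Longrightarrow> h \<in> carrier H \<Longrightarrow> \<phi> g h \<in> carrier H"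
    and "\<And>g h\<^sub>1 h\<^sub>2. g \<in> carrier G \<Longrightarrow> h\<^sub>1 \<in> carrier H \<Longrightarrow> h\<^sub>2 \<in> carrier H \<Longrightarrow>
      \<phi> g (h\<^sub>1 \<otimes>\<^bsub>H\<^esub> h\<^sub>2) = \<phi> g h\<^sub>1 \<otimes>\<^bsub>H\<^esub> \<phi> g h\<^sub>2"
    and "\<And>g\<^sub>1 g\<^sub>2 h. g\<^sub>1 \<in> carrier G \<Longrightarrow> g\<^sub>2 \<in> carrier G \<Longrightarrow> h \<in> carrier H \<Longrightarrow>
      \<phi> (g\<^sub>1 \<otimes>\<^bsub>G\<^esub> g\<^sub>2) h = \<phi> g\<^sub>1 (\<phi> g\<^sub>2 h)"
    and "\<And>h. h \<in> carrier H \<Longrightarrow> \<phi> \<one>\<^bsub>G\<^esub> h = h"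
    and "\<And>g. g \<in> carrier G \<Longrightarrow> inv\<^bsub>AutoGroup H\<^esub> (\<phi> g) = \<phi> (inv\<^bsub>G\<^esub> g)"
proof -
  interpret group_hom G "AutoGroup H" \<phi>
    using assms group.AutoGroup by (intro group_hom.intro) (auto simp: group_hom_axioms_def)
  show "\<phi> g h \<in> carrier H" if "g \<in> carrier G" "h \<in> carrier H" for g h
    by (rule Group.hom_in_carrier[OF AutoGroup_carrierD(1)[OF hom_closed[OF that(1)]] that(2)])
  show "\<phi> g (h\<^sub>1 \<otimes>\<^bsub>H\<^esub> h\<^sub>2) = \<phi> g h\<^sub>1 \<otimes>\<^bsub>H\<^esub> \<phi> g h\<^sub>2"
    if "g \<in> carrier G" "h\<^sub>1 \<in> carrier H" "h\<^sub>2 \<in> carrier H" for g h\<^sub>1 h\<^sub>2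
    by (rule Group.hom_mult[OF AutoGroup_carrierD(1)[OF hom_closed[OF that(1)]] that(2,3)])
  show "\<phi> (g\<^sub>1 \<otimes>\<^bsub>G\<^esub> g\<^sub>2) h = \<phi> g\<^sub>1 (\<phi> g\<^sub>2 h)"
    if "g\<^sub>1 \<in> carrier G" "g\<^sub>2 \<in> carrier G" "h \<in> carrier H" for g\<^sub>1 g\<^sub>2 h
    using that by (simp add: mult_AutoGroup compose_eq)
  show "\<phi> \<one>\<^bsub>G\<^esub> h = h" if "h \<in> carrier H" for h
    using that by (simp add: one_AutoGroup)
  show "inv\<^bsub>AutoGroup H\<^esub> (\<phi> g) = \<phi> (inv\<^bsub>G\<^esub> g)" if "g \<in> carrier G" for g
    using that by simp
qed

text \<open>Each \<open>\<phi> g\<close> is bijective because \<phi> at the inverse of g inverts it.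
  Extensionality is demanded since members of \<open>AutoGroup\<close> are extensional
  functions.\<close>

lemma hom_AutoGroupI:
  assumes "group G" "group H"
    and ext: "\<And>g. g \<in> carrier G \<Longrightarrow> \<phi> g \<in> extensional (carrier H)"
    and closed: "\<And>g h. g \<in> carrier G \<Longrightarrow> h \<in> carrier H \<Longrightarrow> \<phi> g h \<in> carrier H"
    and mult: "\<And>g h\<^sub>1 h\<^sub>2. g \<in> carrier G \<Longrightarrow> h\<^sub>1 \<in> carrier H \<Longrightarrow> h\<^sub>2 \<in> carrier H \<Longrightarrow>
      \<phi> g (h\<^sub>1 \<otimes>\<^bsub>H\<^esub> h\<^sub>2) = \<phi> g h\<^sub>1 \<otimes>\<^bsub>H\<^esub> \<phi> g h\<^sub>2"
    and comp: "\<And>g\<^sub>1 g\<^sub>2 h. g\<^sub>1 \<in> carrier G \<Longrightarrow> g\<^sub>2 \<in> carrier G \<Longrightarrow> h \<in> carrier H \<Longrightarrow>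
      \<phi> (g\<^sub>1 \<otimes>\<^bsub>G\<^esub> g\<^sub>2) h = \<phi> g\<^sub>1 (\<phi> g\<^sub>2 h)"
    and one: "\<And>h. h \<in> carrier H \<Longrightarrow> \<phi> \<one>\<^bsub>G\<^esub> h = h"
  shows "\<phi> \<in> hom G (AutoGroup H)"
proof -
  interpret G: group G by fact
  have inv: "\<phi> g (\<phi> (inv\<^bsub>G\<^esub> g) h) = h" "\<phi> (inv\<^bsub>G\<^esub> g) (\<phi> g h) = h"
    if "g \<in> carrier G" "h \<in> carrier H" for g h
    using that by (simp_all add: one flip: comp)
  have "bij_betw (\<phi> g) (carrier H) (carrier H)" if "g \<in> carrier G" for g
    using that closed inv by (intro bij_betw_byWitness[of _ "\<phi> (inv\<^bsub>G\<^esub> g)"]) auto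
  then have aut: "\<phi> g \<in> carrier (AutoGroup H)" if "g \<in> carrier G" for g
    using that ext closed mult by (auto simp: AutoGroup_def auto_def Bij_def hom_def)
  show ?thesis
  proof (rule homI)
    fix x y assume xy: "x \<in> carrier G" "y \<in> carrier G"
    show "\<phi> (x \<otimes>\<^bsub>G\<^esub> y) = \<phi> x \<otimes>\<^bsub>AutoGroup H\<^esub> \<phi> y"
      using xy by (intro extensionalityI[of _ "carrier H"]) (simp_all add: mult_AutoGroup aut ext comp compose_eq)
  qed (rule aut)
qed

lemma right_module_AutoGroup:
  assumes "m \<in> antihom X (AutoGroup Y)" "group X" "comm_group Y"
  shows "right_module X Y m"
proof -
  interpret X: group X by fact
  interpret Y: comm_group Y by fact
  interpret Aut: group "AutoGroup Y" by (rule Y.AutoGroup)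
  have m: "m x \<in> carrier (AutoGroup Y)" if "x \<in> carrier X" for x
    using assms(1) that by (auto simp: antihom_def)
  \<comment> \<open>\<open>antihom\<close> speaks only of products, so the value at the identity has
    to be derived: it is idempotent in a group, hence trivial.\<close>
  have "m \<one>\<^bsub>X\<^esub> \<otimes>\<^bsub>AutoGroup Y\<^esub> m \<one>\<^bsub>X\<^esub> = m \<one>\<^bsub>X\<^esub>"
    using assms(1) by (auto simp: antihom_def) (metis X.one_closed X.r_one)
  then have one: "m \<one>\<^bsub>X\<^esub> = \<one>\<^bsub>AutoGroup Y\<^esub>"
    using m[OF X.one_closed] by simp
  show ?thesis
  proof
    fix x y assume *: "x \<in> carrier X" "y \<in> carrier Y"
    show "m x y \<in> carrier Y"
      by (rule Group.hom_in_carrier[OF AutoGroup_carrierD(1)[OF m[OF *(1)]] *(2)])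
  next
    fix x y\<^sub>1 y\<^sub>2 assume *: "x \<in> carrier X" "y\<^sub>1 \<in> carrier Y" "y\<^sub>2 \<in> carrier Y"
    show "m x (y\<^sub>1 \<otimes>\<^bsub>Y\<^esub> y\<^sub>2) = m x y\<^sub>1 \<otimes>\<^bsub>Y\<^esub> m x y\<^sub>2"
      by (rule Group.hom_mult[OF AutoGroup_carrierD(1)[OF m[OF *(1)]] *(2,3)])
  next
    fix x\<^sub>1 x\<^sub>2 y assume "x\<^sub>1 \<in> carrier X" "x\<^sub>2 \<in> carrier X" "y \<in> carrier Y"
    then show "m (x\<^sub>1 \<otimes>\<^bsub>X\<^esub> x\<^sub>2) y = m x\<^sub>2 (m x\<^sub>1 y)"
      using assms(1) m by (simp add: antihom_def mult_AutoGroup compose_eq)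
  next
    fix y assume "y \<in> carrier Y"
    then show "m \<one>\<^bsub>X\<^esub> y = y"
      by (simp add: one one_AutoGroup)
  qed
qed

section \<open>Relative Rota-Baxter groups and their extensions\<close>

text \<open>Automorphisms fix the identity, so the Rota-Baxter identity makes \<open>R\<close> at
  the identity an idempotent of the group \<open>G\<close>.\<close>

lemma rrb_group_one:
  assumes "rrb_group (H, G, \<phi>, R)"
  shows "R \<one>\<^bsub>H\<^esub> = \<one>\<^bsub>G\<^esub>"
proof -
  interpret H: group H using assms by simp
  interpret G: group G using assms by simp
  have R: "R \<one>\<^bsub>H\<^esub> \<in> carrier G"
    using assms by auto
  have "\<phi> (R \<one>\<^bsub>H\<^esub>) \<in> carrier (AutoGroup H)"
    using assms R by (auto intro: hom_in_carrier)
  then have "\<phi> (R \<one>\<^bsub>H\<^esub>) \<one>\<^bsub>H\<^esub> = \<one>\<^bsub>H\<^esub>"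
    by (metis AutoGroup_carrierD(1) H.is_group hom_one)
  moreover have "R \<one>\<^bsub>H\<^esub> \<otimes>\<^bsub>G\<^esub> R \<one>\<^bsub>H\<^esub> = R (\<one>\<^bsub>H\<^esub> \<otimes>\<^bsub>H\<^esub> \<phi> (R \<one>\<^bsub>H\<^esub>) \<one>\<^bsub>H\<^esub>)"
    using assms by simp
  ultimately show ?thesis
    using R by simp
qed

lemma rrb_group_props:
  assumes "rrb_group (H, G, \<phi>, R)"
  shows "group H" "group G"
    and "\<And>x. x \<in> carrier H \<Longrightarrow> R x \<in> carrier G"
    and "\<And>x y. x \<in> carrier H \<Longrightarrow> y \<in> carrier H \<Longrightarrow> R (x \<otimes>\<^bsub>H\<^esub> \<phi> (R x) y) = R x \<otimes>\<^bsub>G\<^esub> R y"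
    and "\<And>g h. g \<in> carrier G \<Longrightarrow> h \<in> carrier H \<Longrightarrow> \<phi> g h \<in> carrier H"
    and "\<And>g h\<^sub>1 h\<^sub>2. g \<in> carrier G \<Longrightarrow> h\<^sub>1 \<in> carrier H \<Longrightarrow> h\<^sub>2 \<in> carrier H \<Longrightarrow>
      \<phi> g (h\<^sub>1 \<otimes>\<^bsub>H\<^esub> h\<^sub>2) = \<phi> g h\<^sub>1 \<otimes>\<^bsub>H\<^esub> \<phi> g h\<^sub>2"
    and "\<And>g\<^sub>1 g\<^sub>2 h. g\<^sub>1 \<in> carrier G \<Longrightarrow> g\<^sub>2 \<in> carrier G \<Longrightarrow> h \<in> carrier H \<Longrightarrow>
      \<phi> (g\<^sub>1 \<otimes>\<^bsub>G\<^esub> g\<^sub>2) h = \<phi> g\<^sub>1 (\<phi> g\<^sub>2 h)"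
    and "\<And>h. h \<in> carrier H \<Longrightarrow> \<phi> \<one>\<^bsub>G\<^esub> h = h"
proof -
  have 1: "group H" "group G" "\<phi> \<in> hom G (AutoGroup H)" "R \<in> carrier H \<rightarrow> carrier G"
    "\<forall>h\<^sub>1\<in>carrier H. \<forall>h\<^sub>2\<in>carrier H. R h\<^sub>1 \<otimes>\<^bsub>G\<^esub> R h\<^sub>2 = R (h\<^sub>1 \<otimes>\<^bsub>H\<^esub> \<phi> (R h\<^sub>1) h\<^sub>2)"
    using assms unfolding rrb_group.simps by blast+
  show "group H" "group G" by fact+
  show "R x \<in> carrier G" if "x \<in> carrier H" for x
    using 1(4) that by auto
  show "R (x \<otimes>\<^bsub>H\<^esub> \<phi> (R x) y) = R x \<otimes>\<^bsub>G\<^esub> R y" if "x \<in> carrier H" "y \<in> carrier H" for x y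
    using 1(5) that by auto
qed (use hom_AutoGroupD(1-4)[of \<phi> G H] assms in simp_all)

text \<open>\<open>R\<close> carries the circle product to the product of \<open>G\<close>; this
  gives associativity and the inverses.\<close>

lemma group_induced_circle:
  assumes "rrb_group (H, G, \<phi>, R)"
  shows "group (snd (induced_brace (H, G, \<phi>, R)))" (is "group ?Ho")
proof -
  note [simp] = rrb_group_props(3-8)[OF assms] rrb_group_one[OF assms]
  interpret H: group H by (rule rrb_group_props[OF assms])
  interpret G: group G by (rule rrb_group_props[OF assms])
  show ?thesis
  proof (rule groupI)
    fix x assume "x \<in> carrier ?Ho"
    then have x: "x \<in> carrier H" by simp
    \<comment> \<open>Chosen so that \<open>\<phi> (R x) ?y\<close> is the inverse of
      \<open>x\<close>. Then x \<circ> ?y is the identity, hence \<open>R ?y\<close> is the inverse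
      of \<open>R x\<close>, and with this value ?y \<circ> x becomes \<phi> at the inverse of
      \<open>R x\<close> applied to a trivial product.\<close>
    let ?y = "\<phi> (inv\<^bsub>G\<^esub> R x) (inv\<^bsub>H\<^esub> x)"
    have "\<phi> (R x) ?y = inv\<^bsub>H\<^esub> x"
      using x rrb_group_props(7)[OF assms, of "R x" "inv\<^bsub>G\<^esub> R x" "inv\<^bsub>H\<^esub> x"] by simp
    then have "R x \<otimes>\<^bsub>G\<^esub> R ?y = \<one>\<^bsub>G\<^esub>"
      using x rrb_group_props(4)[OF assms, of x ?y] by simp
    then have "R ?y = inv\<^bsub>G\<^esub> R x"
      using x by (metis G.inv_equality G.inv_inv G.inv_closed rrb_group_props(3,5)[OF assms] H.inv_closed)
    then have "?y \<otimes>\<^bsub>H\<^esub> \<phi> (R ?y) x = \<one>\<^bsub>H\<^esub>"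
      using x rrb_group_props(6)[OF assms, of "inv\<^bsub>G\<^esub> R x" "inv\<^bsub>H\<^esub> x" x]
        rrb_group_props(6)[OF assms, of "inv\<^bsub>G\<^esub> R x" "\<one>\<^bsub>H\<^esub>" "\<one>\<^bsub>H\<^esub>"] by simp
    then show "\<exists>y\<in>carrier ?Ho. y \<otimes>\<^bsub>?Ho\<^esub> x = \<one>\<^bsub>?Ho\<^esub>"
      using x by (intro bexI[of _ ?y]) simp_all
  qed (simp_all add: H.m_assoc)
qed

text \<open>The brace identity amounts to inserting the inverse of a times a between the two images
  in a \<circ> (b c) = a \<open>\<phi> (R a) b\<close> \<open>\<phi> (R a) c\<close>.\<close>

lemma skew_left_brace_induced:
  assumes "rrb_group (H, G, \<phi>, R)"
  shows "skew_left_brace (induced_brace (H, G, \<phi>, R))"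
proof -
  note [simp] = rrb_group_props(3-8)[OF assms]
  interpret H: group H by (rule rrb_group_props[OF assms])
  have "inv\<^bsub>H\<^esub> a \<otimes>\<^bsub>H\<^esub> (a \<otimes>\<^bsub>H\<^esub> b) = b" if "a \<in> carrier H" "b \<in> carrier H" for a b
    using that by (simp flip: H.m_assoc)
  then show ?thesis
    using group_induced_circle[OF assms] by (simp add: H.m_assoc)
qed

lemma brace_hom_induced:
  assumes "rrb_group (H, G, \<phi>, R)" "rrb_hom (H, G, \<phi>, R) (H', G', \<phi>', R') (\<psi>, \<eta>)"
  shows "brace_hom (induced_brace (H, G, \<phi>, R)) (induced_brace (H', G', \<phi>', R')) \<psi>"
proof -
  note [simp] = rrb_group_props(3,5)[OF assms(1)]
  have "\<psi> \<in> hom H H'" "\<And>h. h \<in> carrier H \<Longrightarrow> \<eta> (R h) = R' (\<psi> h)"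
    "\<And>g h. g \<in> carrier G \<Longrightarrow> h \<in> carrier H \<Longrightarrow> \<psi> (\<phi> g h) = \<phi>' (\<eta> g) (\<psi> h)"
    using assms(2) unfolding rrb_hom.simps by blast+
  then show ?thesis
    by (auto simp: hom_def)
qed

lemma brace_ext_induced:
  assumes "rrb_ext (A, B, \<beta>, T) (K, L, \<alpha>, S) ((H, G, \<phi>, R), (i\<^sub>1, i\<^sub>2), (\<pi>\<^sub>1, \<pi>\<^sub>2))"
    and "rrb_group (K, L, \<alpha>, S)"
  shows "brace_ext (induced_brace (A, B, \<beta>, T)) (induced_brace (K, L, \<alpha>, S))
    (induced_brace_ext ((H, G, \<phi>, R), (i\<^sub>1, i\<^sub>2), (\<pi>\<^sub>1, \<pi>\<^sub>2)))"
proof -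
  have 1: "rrb_group (H, G, \<phi>, R)" "rrb_hom (K, L, \<alpha>, S) (H, G, \<phi>, R) (i\<^sub>1, i\<^sub>2)"
    "inj_on i\<^sub>1 (carrier K)" "rrb_hom (H, G, \<phi>, R) (A, B, \<beta>, T) (\<pi>\<^sub>1, \<pi>\<^sub>2)"
    "\<pi>\<^sub>1 ` carrier H = carrier A" "i\<^sub>1 ` carrier K = kernel H A \<pi>\<^sub>1"
    using assms(1) by (simp_all only: rrb_ext.simps)
  show ?thesis
    unfolding induced_brace.simps induced_brace_ext.simps brace_ext.simps
    by (intro conjI skew_left_brace_induced[OF 1(1), unfolded induced_brace.simps]
        brace_hom_induced[OF assms(2) 1(2), unfolded induced_brace.simps]
        brace_hom_induced[OF 1(1) 1(4), unfolded induced_brace.simps] 1(3,5,6))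
qed

section \<open>Equivalence of extensions and the classes it defines\<close>

lemma bij_betw_inv_into_simps:
  assumes "bij_betw u X Y"
  shows "\<And>y. y \<in> Y \<Longrightarrow> inv_into X u y \<in> X" "\<And>y. y \<in> Y \<Longrightarrow> u (inv_into X u y) = y"
    "\<And>x. x \<in> X \<Longrightarrow> inv_into X u (u x) = x"
  using assms by (auto simp: bij_betw_def inv_into_into f_inv_into_f)

lemma hom_inv_into:
  assumes "group G" "u \<in> hom G H" "bij_betw u (carrier G) (carrier H)"
  shows "inv_into (carrier G) u \<in> hom H G"
  using group.iso_set_sym[OF assms(1)] assms(2,3) by (auto simp: iso_def)

lemma rrb_hom_inv_into:
  assumes "rrb_group (H, G, \<phi>, R)" "rrb_group (H', G', \<phi>', R')"
    and "rrb_hom (H, G, \<phi>, R) (H', G', \<phi>', R') (\<psi>, \<eta>)"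
    and bij: "bij_betw \<psi> (carrier H) (carrier H')" "bij_betw \<eta> (carrier G) (carrier G')"
  shows "rrb_hom (H', G', \<phi>', R') (H, G, \<phi>, R) (inv_into (carrier H) \<psi>, inv_into (carrier G) \<eta>)"
proof -
  note p = rrb_group_props[OF assms(1)] and p' = rrb_group_props[OF assms(2)]
  note b = bij_betw_inv_into_simps[OF bij(1)] and c = bij_betw_inv_into_simps[OF bij(2)]
  have h: "\<psi> \<in> hom H H'" "\<eta> \<in> hom G G'" "\<And>h. h \<in> carrier H \<Longrightarrow> \<eta> (R h) = R' (\<psi> h)"
    "\<And>g h. g \<in> carrier G \<Longrightarrow> h \<in> carrier H \<Longrightarrow> \<psi> (\<phi> g h) = \<phi>' (\<eta> g) (\<psi> h)"
    using assms(3) unfolding rrb_hom.simps by blast+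
  have "inv_into (carrier G) \<eta> (R' x) = R (inv_into (carrier H) \<psi> x)" if "x \<in> carrier H'" for x
    using h(3)[OF b(1)[OF that]] c(3)[OF p(3)[OF b(1)[OF that]]] b(2)[OF that] by simp
  moreover have "inv_into (carrier H) \<psi> (\<phi>' g x) = \<phi> (inv_into (carrier G) \<eta> g) (inv_into (carrier H) \<psi> x)"
    if "g \<in> carrier G'" "x \<in> carrier H'" for g x
    using h(4)[OF c(1)[OF that(1)] b(1)[OF that(2)]] b(3)[OF p(5)[OF c(1)[OF that(1)] b(1)[OF that(2)]]]
      b(2)[OF that(2)] c(2)[OF that(1)] by simp
  ultimately show ?thesis
    unfolding rrb_hom.simps
    using hom_inv_into[OF p(1) h(1) bij(1)] hom_inv_into[OF p(2) h(2) bij(2)] by blast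
qed

lemma rrb_hom_comp:
  assumes "rrb_group (H, G, \<phi>, R)"
    and "rrb_hom (H, G, \<phi>, R) (H', G', \<phi>', R') (\<psi>, \<eta>)"
    and "rrb_hom (H', G', \<phi>', R') (H'', G'', \<phi>'', R'') (\<psi>', \<eta>')"
  shows "rrb_hom (H, G, \<phi>, R) (H'', G'', \<phi>'', R'') (\<psi>' \<circ> \<psi>, \<eta>' \<circ> \<eta>)"
proof -
  have h: "\<psi> \<in> hom H H'" "\<eta> \<in> hom G G'" "\<And>h. h \<in> carrier H \<Longrightarrow> \<eta> (R h) = R' (\<psi> h)"
    "\<And>g h. g \<in> carrier G \<Longrightarrow> h \<in> carrier H \<Longrightarrow> \<psi> (\<phi> g h) = \<phi>' (\<eta> g) (\<psi> h)"
    using assms(2) unfolding rrb_hom.simps by blast+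
  have h': "\<psi>' \<in> hom H' H''" "\<eta>' \<in> hom G' G''" "\<And>h. h \<in> carrier H' \<Longrightarrow> \<eta>' (R' h) = R'' (\<psi>' h)"
    "\<And>g h. g \<in> carrier G' \<Longrightarrow> h \<in> carrier H' \<Longrightarrow> \<psi>' (\<phi>' g h) = \<phi>'' (\<eta>' g) (\<psi>' h)"
    using assms(3) unfolding rrb_hom.simps by blast+
  show ?thesis
    unfolding rrb_hom.simps
    using h h' hom_in_carrier[OF h(1)] hom_in_carrier[OF h(2)] hom_compose[OF h(1) h'(1)] hom_compose[OF h(2) h'(2)]
    by simp
qed

text \<open>Rests on symmetry and transitivity of equivalence among extensions: isomorphisms of the
  middle terms are inverted and composed, and the conditions on both ends follow along.\<close>

lemma rrb_ext_class_eqI: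
  assumes E: "rrb_ext \<A> \<K> \<E>" "rrb_ext \<A> \<K> \<E>'" and equiv: "rrb_ext_equiv \<K> \<E> \<E>'"
  shows "rrb_ext_class \<A> \<K> \<E> = rrb_ext_class \<A> \<K> \<E>'"
proof -
  obtain A B \<beta> T where \<A>: "\<A> = (A, B, \<beta>, T)" by (cases \<A>)
  obtain K L \<alpha> S where \<K>: "\<K> = (K, L, \<alpha>, S)" by (cases \<K>)
  have sym: "rrb_ext_equiv \<K> X' X" if prems: "rrb_ext \<A> \<K> X" "rrb_ext \<A> \<K> X'" "rrb_ext_equiv \<K> X X'" for X X'
  proof -
    obtain H G \<phi> R i j p q where X: "X = ((H, G, \<phi>, R), (i, j), (p, q))" by (metis prod.exhaust)
    obtain H' G' \<phi>' R' i' j' p' q' where X': "X' = ((H', G', \<phi>', R'), (i', j'), (p', q'))" by (metis prod.exhaust)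
    obtain \<psi> \<eta> where h: "rrb_hom (H, G, \<phi>, R) (H', G', \<phi>', R') (\<psi>, \<eta>)"
      "bij_betw \<psi> (carrier H) (carrier H')" "bij_betw \<eta> (carrier G) (carrier G')"
      "\<forall>k\<in>carrier K. \<psi> (i k) = i' k" "\<forall>l\<in>carrier L. \<eta> (j l) = j' l"
      "\<forall>h\<in>carrier H. p' (\<psi> h) = p h" "\<forall>g\<in>carrier G. q' (\<eta> g) = q g"
      using prems(3) unfolding X X' \<K> rrb_ext_equiv.simps by blast
    note b = bij_betw_inv_into_simps[OF h(2)] and c = bij_betw_inv_into_simps[OF h(3)]
    have g: "rrb_group (H, G, \<phi>, R)" "rrb_group (H', G', \<phi>', R')" "i \<in> hom K H" "j \<in> hom L G"
      using prems(1,2) unfolding X X' \<K> \<A> rrb_ext.simps rrb_hom.simps by blast+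
    show ?thesis
      unfolding X X' \<K> rrb_ext_equiv.simps
    proof (intro exI conjI ballI)
      show "rrb_hom (H', G', \<phi>', R') (H, G, \<phi>, R) (inv_into (carrier H) \<psi>, inv_into (carrier G) \<eta>)"
        by (rule rrb_hom_inv_into[OF g(1,2) h(1-3)])
    qed (use h b c hom_in_carrier[OF g(3)] hom_in_carrier[OF g(4)] bij_betw_inv_into in \<open>metis+\<close>)
  qed
  have trans: "rrb_ext_equiv \<K> X X''"
    if prems: "rrb_ext \<A> \<K> X" "rrb_ext_equiv \<K> X X'" "rrb_ext_equiv \<K> X' X''" for X X' X''
  proof -
    obtain H G \<phi> R i j p q where X: "X = ((H, G, \<phi>, R), (i, j), (p, q))" by (metis prod.exhaust)
    obtain H' G' \<phi>' R' i' j' p' q' where X': "X' = ((H', G', \<phi>', R'), (i', j'), (p', q'))" by (metis prod.exhaust)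
    obtain H'' G'' \<phi>'' R'' i'' j'' p'' q'' where X'': "X'' = ((H'', G'', \<phi>'', R''), (i'', j''), (p'', q''))" by (metis prod.exhaust)
    obtain \<psi> \<eta> where h: "rrb_hom (H, G, \<phi>, R) (H', G', \<phi>', R') (\<psi>, \<eta>)"
      "bij_betw \<psi> (carrier H) (carrier H')" "bij_betw \<eta> (carrier G) (carrier G')"
      "\<forall>k\<in>carrier K. \<psi> (i k) = i' k" "\<forall>l\<in>carrier L. \<eta> (j l) = j' l"
      "\<forall>h\<in>carrier H. p' (\<psi> h) = p h" "\<forall>g\<in>carrier G. q' (\<eta> g) = q g"
      using prems(2) unfolding X X' \<K> rrb_ext_equiv.simps by blast
    obtain \<psi>' \<eta>' where h': "rrb_hom (H', G', \<phi>', R') (H'', G'', \<phi>'', R'') (\<psi>', \<eta>')"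
      "bij_betw \<psi>' (carrier H') (carrier H'')" "bij_betw \<eta>' (carrier G') (carrier G'')"
      "\<forall>k\<in>carrier K. \<psi>' (i' k) = i'' k" "\<forall>l\<in>carrier L. \<eta>' (j' l) = j'' l"
      "\<forall>h\<in>carrier H'. p'' (\<psi>' h) = p' h" "\<forall>g\<in>carrier G'. q'' (\<eta>' g) = q' g"
      using prems(3) unfolding X'' X' \<K> rrb_ext_equiv.simps by blast
    have g: "rrb_group (H, G, \<phi>, R)"
      using prems(1) unfolding X \<K> \<A> rrb_ext.simps by blast
    show ?thesis
      unfolding X X'' \<K> rrb_ext_equiv.simps
    proof (intro exI conjI ballI)
      show "rrb_hom (H, G, \<phi>, R) (H'', G'', \<phi>'', R'') (\<psi>' \<circ> \<psi>, \<eta>' \<circ> \<eta>)"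
        by (rule rrb_hom_comp[OF g h(1) h'(1)])
      show "bij_betw (\<psi>' \<circ> \<psi>) (carrier H) (carrier H'')" "bij_betw (\<eta>' \<circ> \<eta>) (carrier G) (carrier G'')"
        using h h' by (auto intro: bij_betw_trans)
    qed (use h h' bij_betwE[OF h(2)] bij_betwE[OF h(3)] in auto)
  qed
  show ?thesis
    unfolding rrb_ext_class_def using sym[OF E equiv] trans E equiv by blast
qed

lemma brace_ext_class_eqI:
  assumes E: "brace_ext M I \<E>" "brace_ext M I \<E>'" and equiv: "brace_ext_equiv I \<E> \<E>'"
  shows "brace_ext_class M I \<E> = brace_ext_class M I \<E>'"
proof -
  obtain Mm Mo where M: "M = (Mm, Mo)" by (cases M)
  obtain Im Io where I: "I = (Im, Io)" by (cases I)
  have sym: "brace_ext_equiv I X' X" if prems: "brace_ext M I X" "brace_ext M I X'" "brace_ext_equiv I X X'" for X X'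
  proof -
    obtain H Ho i p where X: "X = ((H, Ho), i, p)" by (metis prod.exhaust)
    obtain H' Ho' i' p' where X': "X' = ((H', Ho'), i', p')" by (metis prod.exhaust)
    obtain \<psi> where h: "\<psi> \<in> hom H H'" "\<psi> \<in> hom Ho Ho'" "bij_betw \<psi> (carrier H) (carrier H')"
      "\<forall>k\<in>carrier Im. \<psi> (i k) = i' k" "\<forall>h\<in>carrier H. p' (\<psi> h) = p h"
      using prems(3) unfolding X X' I brace_ext_equiv.simps brace_hom.simps by blast
    note b = bij_betw_inv_into_simps[OF h(3)]
    have g: "group H" "group Ho" "carrier Ho = carrier H" "carrier Ho' = carrier H'" "i \<in> hom Im H"
      using prems(1,2) unfolding X X' I M
      by (simp_all only: brace_ext.simps brace_hom.simps skew_left_brace.simps)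
    show ?thesis
      unfolding X X' I brace_ext_equiv.simps brace_hom.simps
    proof (intro exI conjI ballI)
      show "inv_into (carrier H) \<psi> \<in> hom H' H"
        by (rule hom_inv_into[OF g(1) h(1) h(3)])
      show "inv_into (carrier H) \<psi> \<in> hom Ho' Ho"
        using hom_inv_into[OF g(2) h(2)] h(3) by (simp add: g)
    qed (use h b hom_in_carrier[OF g(5)] bij_betw_inv_into in \<open>metis+\<close>)
  qed
  have trans: "brace_ext_equiv I X X''"
    if prems: "brace_ext_equiv I X X'" "brace_ext_equiv I X' X''" for X X' X''
  proof -
    obtain H Ho i p where X: "X = ((H, Ho), i, p)" by (metis prod.exhaust)
    obtain H' Ho' i' p' where X': "X' = ((H', Ho'), i', p')" by (metis prod.exhaust)
    obtain H'' Ho'' i'' p'' where X'': "X'' = ((H'', Ho''), i'', p'')" by (metis prod.exhaust)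
    obtain \<psi> where h: "\<psi> \<in> hom H H'" "\<psi> \<in> hom Ho Ho'" "bij_betw \<psi> (carrier H) (carrier H')"
      "\<forall>k\<in>carrier Im. \<psi> (i k) = i' k" "\<forall>h\<in>carrier H. p' (\<psi> h) = p h"
      using prems(1) unfolding X X' I brace_ext_equiv.simps brace_hom.simps by blast
    obtain \<psi>' where h': "\<psi>' \<in> hom H' H''" "\<psi>' \<in> hom Ho' Ho''" "bij_betw \<psi>' (carrier H') (carrier H'')"
      "\<forall>k\<in>carrier Im. \<psi>' (i' k) = i'' k" "\<forall>h\<in>carrier H'. p'' (\<psi>' h) = p' h"
      using prems(2) unfolding X'' X' I brace_ext_equiv.simps brace_hom.simps by blast
    show ?thesis
      unfolding X X'' I brace_ext_equiv.simps brace_hom.simps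
    proof (intro exI conjI ballI)
      show "\<psi>' \<circ> \<psi> \<in> hom H H''" "\<psi>' \<circ> \<psi> \<in> hom Ho Ho''" "bij_betw (\<psi>' \<circ> \<psi>) (carrier H) (carrier H'')"
        using h h' by (auto intro: bij_betw_trans hom_compose)
    qed (use h h' bij_betwE[OF h(3)] in auto)
  qed
  show ?thesis
    unfolding brace_ext_class_def using sym[OF E equiv] trans E equiv by blast
qed

lemma brace_ext_equiv_induced:
  assumes "rrb_ext \<A> \<K> \<E>" "rrb_ext_equiv \<K> \<E> \<E>'"
  shows "brace_ext_equiv (induced_brace \<K>) (induced_brace_ext \<E>) (induced_brace_ext \<E>')"
proof -
  obtain A B \<beta> T where \<A>: "\<A> = (A, B, \<beta>, T)" by (cases \<A>)
  obtain K L \<alpha> S where \<K>: "\<K> = (K, L, \<alpha>, S)" by (cases \<K>)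
  obtain H G \<phi> R i j p q where X: "\<E> = ((H, G, \<phi>, R), (i, j), (p, q))" by (metis prod.exhaust)
  obtain H' G' \<phi>' R' i' j' p' q' where X': "\<E>' = ((H', G', \<phi>', R'), (i', j'), (p', q'))" by (metis prod.exhaust)
  obtain \<psi> \<eta> where h: "rrb_hom (H, G, \<phi>, R) (H', G', \<phi>', R') (\<psi>, \<eta>)"
    "bij_betw \<psi> (carrier H) (carrier H')"
    "\<forall>k\<in>carrier K. \<psi> (i k) = i' k" "\<forall>h\<in>carrier H. p' (\<psi> h) = p h"
    using assms(2) unfolding X X' \<K> rrb_ext_equiv.simps by blast
  have "rrb_group (H, G, \<phi>, R)"
    using assms(1) unfolding X \<K> \<A> rrb_ext.simps by blast
  from brace_hom_induced[OF this h(1)] show ?thesis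
    unfolding X X' \<K> induced_brace_ext.simps induced_brace.simps brace_ext_equiv.simps
    using h(2-4) by blast
qed

lemma brace_ext_equiv_refl: "brace_ext_equiv I \<E> \<E>"
proof -
  obtain Im Io where I: "I = (Im, Io)" by (cases I)
  obtain H Ho i p where \<E>: "\<E> = ((H, Ho), i, p)" by (metis prod.exhaust)
  show ?thesis
    unfolding I \<E> brace_ext_equiv.simps brace_hom.simps
    by (intro exI[of _ "\<lambda>x. x"]) (auto simp: hom_def bij_betw_def)
qed

lemma rrb_ext_equiv_refl: "rrb_ext_equiv \<K> \<E> \<E>"
proof -
  obtain K L \<alpha> S where \<K>: "\<K> = (K, L, \<alpha>, S)" by (cases \<K>)
  obtain H G \<phi> R i j p q where \<E>: "\<E> = ((H, G, \<phi>, R), (i, j), (p, q))" by (metis prod.exhaust)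
  show ?thesis
    unfolding \<K> \<E> rrb_ext_equiv.simps rrb_hom.simps
    by (intro exI[of _ "\<lambda>x. x"]) (auto simp: hom_def bij_betw_def)
qed

text \<open>An equivalence of extensions restricts, in its first component, to an equivalence of the
  induced brace extensions, so all members of the class have the same image; reflexivity makes the
  class nonempty.\<close>

lemma Pi_map_class:
  assumes \<E>: "rrb_ext \<A> \<K> \<E>" and "rrb_group \<K>"
  shows "Pi_map \<A> \<K> (rrb_ext_class \<A> \<K> \<E>) =
    brace_ext_class (induced_brace \<A>) (induced_brace \<K>) (induced_brace_ext \<E>)"
  unfolding Pi_map_def
proof (rule the_elem_image_const)
  show "rrb_ext_class \<A> \<K> \<E> \<noteq> {}"
    using \<E> rrb_ext_equiv_refl[of \<K> \<E>] unfolding rrb_ext_class_def by blast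
next
  have ind: "brace_ext (induced_brace \<A>) (induced_brace \<K>) (induced_brace_ext X)" if "rrb_ext \<A> \<K> X" for X
  proof -
    obtain A B \<beta> T where \<A>: "\<A> = (A, B, \<beta>, T)" by (cases \<A>)
    obtain K L \<alpha> S where \<K>: "\<K> = (K, L, \<alpha>, S)" by (cases \<K>)
    obtain H G \<phi> R i j p q where X: "X = ((H, G, \<phi>, R), (i, j), (p, q))" by (metis prod.exhaust)
    show ?thesis
      using that assms(2) unfolding \<A> \<K> X by (rule brace_ext_induced)
  qed
  fix X assume "X \<in> rrb_ext_class \<A> \<K> \<E>"
  then have X: "rrb_ext \<A> \<K> X" "rrb_ext_equiv \<K> \<E> X"
    unfolding rrb_ext_class_def by blast+
  show "brace_ext_class (induced_brace \<A>) (induced_brace \<K>) (induced_brace_ext X)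
      = brace_ext_class (induced_brace \<A>) (induced_brace \<K>) (induced_brace_ext \<E>)"
    by (rule brace_ext_class_eqI[OF ind[OF \<E>] ind[OF X(1)] brace_ext_equiv_induced[OF \<E> X(2)], symmetric])
qed

section \<open>Modules with bijective operators\<close>

locale bij_rrb_module =
  fixes A :: "'a monoid" and B :: "'b monoid" and \<beta> :: "'b \<Rightarrow> 'a \<Rightarrow> 'a" and T :: "'a \<Rightarrow> 'b"
    and K :: "'k monoid" and L :: "'l monoid" and \<alpha> :: "'l \<Rightarrow> 'k \<Rightarrow> 'k" and S :: "'k \<Rightarrow> 'l"
    and \<nu> :: "'b \<Rightarrow> 'k \<Rightarrow> 'k" and \<mu> :: "'a \<Rightarrow> 'k \<Rightarrow> 'k"
    and \<sigma> :: "'b \<Rightarrow> 'l \<Rightarrow> 'l" and f :: "'l \<Rightarrow> 'a \<Rightarrow> 'k"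
  assumes rrb: "rrb_group (A, B, \<beta>, T)"
    and module: "rrb_module (A, B, \<beta>, T) (K, L, \<alpha>, S) (\<nu>, \<mu>, \<sigma>, f)"
    and bij_T: "bij_betw T (carrier A) (carrier B)"
    and bij_S: "bij_betw S (carrier K) (carrier L)"
begin

sublocale A: group A using rrb by simp
sublocale B: group B using rrb by simp
sublocale K: comm_group K using module unfolding rrb_module.simps by blast
sublocale L: comm_group L using module unfolding rrb_module.simps by blast
sublocale mu: right_module A K \<mu>
  using module A.is_group unfolding rrb_module.simps by (blast intro: right_module_AutoGroup)
sublocale sig: right_module B L \<sigma>
  using module B.is_group unfolding rrb_module.simps by (blast intro: right_module_AutoGroup)

abbreviation mult_K (infixl "\<cdot>" 70) where "x \<cdot> y \<equiv> x \<otimes>\<^bsub>K\<^esub> y"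
abbreviation mult_L (infixl "\<bullet>" 70) where "x \<bullet> y \<equiv> x \<otimes>\<^bsub>L\<^esub> y"

section \<open>The module axioms as rewrite rules\<close>

lemma beta:
  shows beta_closed [simp]: "b \<in> carrier B \<Longrightarrow> a \<in> carrier A \<Longrightarrow> \<beta> b a \<in> carrier A"
    and beta_mult: "b \<in> carrier B \<Longrightarrow> a\<^sub>1 \<in> carrier A \<Longrightarrow> a\<^sub>2 \<in> carrier A \<Longrightarrow>
      \<beta> b (a\<^sub>1 \<otimes>\<^bsub>A\<^esub> a\<^sub>2) = \<beta> b a\<^sub>1 \<otimes>\<^bsub>A\<^esub> \<beta> b a\<^sub>2"
    and beta_comp: "b\<^sub>1 \<in> carrier B \<Longrightarrow> b\<^sub>2 \<in> carrier B \<Longrightarrow> a \<in> carrier A \<Longrightarrow>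
      \<beta> (b\<^sub>1 \<otimes>\<^bsub>B\<^esub> b\<^sub>2) a = \<beta> b\<^sub>1 (\<beta> b\<^sub>2 a)"
    and beta_one [simp]: "a \<in> carrier A \<Longrightarrow> \<beta> \<one>\<^bsub>B\<^esub> a = a"
  using hom_AutoGroupD[of \<beta> B A] rrb by auto

lemma beta_inv [simp]:
  assumes "b \<in> carrier B" "a \<in> carrier A"
  shows "\<beta> (inv\<^bsub>B\<^esub> b) (\<beta> b a) = a" "\<beta> b (\<beta> (inv\<^bsub>B\<^esub> b) a) = a"
  using assms by (simp_all flip: beta_comp)

lemma beta_A_one [simp]: "b \<in> carrier B \<Longrightarrow> \<beta> b \<one>\<^bsub>A\<^esub> = \<one>\<^bsub>A\<^esub>"
  by (metis A.one_closed A.r_cancel_one' A.r_one beta_closed beta_mult)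

lemma nu:
  shows nu_closed [simp]: "b \<in> carrier B \<Longrightarrow> k \<in> carrier K \<Longrightarrow> \<nu> b k \<in> carrier K"
    and nu_mult: "b \<in> carrier B \<Longrightarrow> k\<^sub>1 \<in> carrier K \<Longrightarrow> k\<^sub>2 \<in> carrier K \<Longrightarrow>
      \<nu> b (k\<^sub>1 \<cdot> k\<^sub>2) = \<nu> b k\<^sub>1 \<cdot> \<nu> b k\<^sub>2"
    and nu_comp: "b\<^sub>1 \<in> carrier B \<Longrightarrow> b\<^sub>2 \<in> carrier B \<Longrightarrow> k \<in> carrier K \<Longrightarrow>
      \<nu> (b\<^sub>1 \<otimes>\<^bsub>B\<^esub> b\<^sub>2) k = \<nu> b\<^sub>1 (\<nu> b\<^sub>2 k)"
    and nu_one [simp]: "k \<in> carrier K \<Longrightarrow> \<nu> \<one>\<^bsub>B\<^esub> k = k"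
    and inv_nu [simp]: "b \<in> carrier B \<Longrightarrow> inv\<^bsub>AutoGroup K\<^esub> (\<nu> b) = \<nu> (inv\<^bsub>B\<^esub> b)"
proof -
  have "\<nu> \<in> hom B (AutoGroup K)"
    using module unfolding rrb_module.simps by blast
  note * = hom_AutoGroupD[OF this B.is_group K.is_group]
  show "b \<in> carrier B \<Longrightarrow> k \<in> carrier K \<Longrightarrow> \<nu> b k \<in> carrier K"
    "b \<in> carrier B \<Longrightarrow> k\<^sub>1 \<in> carrier K \<Longrightarrow> k\<^sub>2 \<in> carrier K \<Longrightarrow> \<nu> b (k\<^sub>1 \<cdot> k\<^sub>2) = \<nu> b k\<^sub>1 \<cdot> \<nu> b k\<^sub>2"
    "b\<^sub>1 \<in> carrier B \<Longrightarrow> b\<^sub>2 \<in> carrier B \<Longrightarrow> k \<in> carrier K \<Longrightarrow> \<nu> (b\<^sub>1 \<otimes>\<^bsub>B\<^esub> b\<^sub>2) k = \<nu> b\<^sub>1 (\<nu> b\<^sub>2 k)"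
    "k \<in> carrier K \<Longrightarrow> \<nu> \<one>\<^bsub>B\<^esub> k = k"
    "b \<in> carrier B \<Longrightarrow> inv\<^bsub>AutoGroup K\<^esub> (\<nu> b) = \<nu> (inv\<^bsub>B\<^esub> b)"
    by (fact *)+
qed

lemma nu_inv [simp]:
  assumes "b \<in> carrier B" "k \<in> carrier K"
  shows "\<nu> (inv\<^bsub>B\<^esub> b) (\<nu> b k) = k" "\<nu> b (\<nu> (inv\<^bsub>B\<^esub> b) k) = k"
  using assms by (simp_all flip: nu_comp)

lemma nu_K_one [simp]: "b \<in> carrier B \<Longrightarrow> \<nu> b \<one>\<^bsub>K\<^esub> = \<one>\<^bsub>K\<^esub>"
  by (metis K.one_closed K.r_cancel_one' K.r_one nu_closed nu_mult)

lemma nu_quot: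
  assumes "b \<in> carrier B" "k\<^sub>1 \<in> carrier K" "k\<^sub>2 \<in> carrier K"
  shows "\<nu> b (K.quot k\<^sub>1 k\<^sub>2) = K.quot (\<nu> b k\<^sub>1) (\<nu> b k\<^sub>2)"
proof -
  have "\<nu> b (K.quot k\<^sub>1 k\<^sub>2 \<cdot> k\<^sub>2) = \<nu> b (K.quot k\<^sub>1 k\<^sub>2) \<cdot> \<nu> b k\<^sub>2"
    using assms by (intro nu_mult) auto
  then show ?thesis
    using assms by (simp add: K.eq_quot_iff)
qed

lemma T_closed [simp]: "a \<in> carrier A \<Longrightarrow> T a \<in> carrier B"
  using bij_T by (auto simp: bij_betw_def)

lemma T_circ [simp]:
  "a\<^sub>1 \<in> carrier A \<Longrightarrow> a\<^sub>2 \<in> carrier A \<Longrightarrow> T (a\<^sub>1 \<otimes>\<^bsub>A\<^esub> \<beta> (T a\<^sub>1) a\<^sub>2) = T a\<^sub>1 \<otimes>\<^bsub>B\<^esub> T a\<^sub>2"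
  using rrb by simp

lemma T_one [simp]: "T \<one>\<^bsub>A\<^esub> = \<one>\<^bsub>B\<^esub>"
  using rrb by (rule rrb_group_one)

lemma T_surj: "b \<in> carrier B \<Longrightarrow> \<exists>a\<in>carrier A. b = T a"
  using bij_T by (auto simp: bij_betw_def)

lemma S_closed [simp]: "k \<in> carrier K \<Longrightarrow> S k \<in> carrier L"
  using bij_S by (auto simp: bij_betw_def)

text \<open>Triviality of \<alpha> turns the Rota-Baxter identity of \<open>S\<close> into
  multiplicativity.\<close>

lemma S_mult: "k\<^sub>1 \<in> carrier K \<Longrightarrow> k\<^sub>2 \<in> carrier K \<Longrightarrow> S (k\<^sub>1 \<cdot> k\<^sub>2) = S k\<^sub>1 \<bullet> S k\<^sub>2"
proof -
  assume k: "k\<^sub>1 \<in> carrier K" "k\<^sub>2 \<in> carrier K"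
  have "S k\<^sub>1 \<bullet> S k\<^sub>2 = S (k\<^sub>1 \<cdot> \<alpha> (S k\<^sub>1) k\<^sub>2)" "\<alpha> (S k\<^sub>1) = \<one>\<^bsub>AutoGroup K\<^esub>"
    using module k unfolding rrb_module.simps rrb_group.simps trivial_rrb.simps by (blast, simp)
  then show ?thesis
    using k by (simp add: one_AutoGroup)
qed

lemma S_one [simp]: "S \<one>\<^bsub>K\<^esub> = \<one>\<^bsub>L\<^esub>"
  using module unfolding rrb_module.simps by (blast intro: rrb_group_one)

lemma S_quot:
  assumes "k\<^sub>1 \<in> carrier K" "k\<^sub>2 \<in> carrier K"
  shows "S (K.quot k\<^sub>1 k\<^sub>2) = L.quot (S k\<^sub>1) (S k\<^sub>2)"
proof -
  have "S (K.quot k\<^sub>1 k\<^sub>2 \<cdot> k\<^sub>2) = S (K.quot k\<^sub>1 k\<^sub>2) \<bullet> S k\<^sub>2"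
    using assms by (intro S_mult) auto
  then show ?thesis
    using assms by (simp add: L.eq_quot_iff)
qed

lemma S_inject [simp]: "k\<^sub>1 \<in> carrier K \<Longrightarrow> k\<^sub>2 \<in> carrier K \<Longrightarrow> S k\<^sub>1 = S k\<^sub>2 \<longleftrightarrow> k\<^sub>1 = k\<^sub>2"
  using bij_S by (auto simp: bij_betw_def inj_on_def)

lemma f_closed [simp]: "l \<in> carrier L \<Longrightarrow> a \<in> carrier A \<Longrightarrow> f l a \<in> carrier K"
  using module unfolding rrb_module.simps by blast

lemma f_mult_left:
  "l\<^sub>1 \<in> carrier L \<Longrightarrow> l\<^sub>2 \<in> carrier L \<Longrightarrow> a \<in> carrier A \<Longrightarrow> f (l\<^sub>1 \<bullet> l\<^sub>2) a = f l\<^sub>1 a \<cdot> f l\<^sub>2 a"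
  using module unfolding rrb_module.simps by blast

lemma f_mult_right:
  "l \<in> carrier L \<Longrightarrow> a\<^sub>1 \<in> carrier A \<Longrightarrow> a\<^sub>2 \<in> carrier A \<Longrightarrow>
    f l (a\<^sub>1 \<otimes>\<^bsub>A\<^esub> a\<^sub>2) = \<mu> a\<^sub>2 (f l a\<^sub>1) \<cdot> f l a\<^sub>2"
  using module unfolding rrb_module.simps by blast

lemma f_one_left [simp]: "a \<in> carrier A \<Longrightarrow> f \<one>\<^bsub>L\<^esub> a = \<one>\<^bsub>K\<^esub>"
  by (metis K.r_cancel_one' L.one_closed L.r_one f_closed f_mult_left)

lemma f_one_right [simp]: "l \<in> carrier L \<Longrightarrow> f l \<one>\<^bsub>A\<^esub> = \<one>\<^bsub>K\<^esub>"
  by (metis A.one_closed A.r_one K.r_cancel_one' f_closed f_mult_right mu.m_one)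

lemma f_quot:
  assumes "l\<^sub>1 \<in> carrier L" "l\<^sub>2 \<in> carrier L" "a \<in> carrier A"
  shows "f (L.quot l\<^sub>1 l\<^sub>2) a = K.quot (f l\<^sub>1 a) (f l\<^sub>2 a)"
proof -
  have "f (L.quot l\<^sub>1 l\<^sub>2 \<bullet> l\<^sub>2) a = f (L.quot l\<^sub>1 l\<^sub>2) a \<cdot> f l\<^sub>2 a"
    using assms by (intro f_mult_left) auto
  then show ?thesis
    using assms by (simp add: K.eq_quot_iff)
qed

text \<open>Module axiom (4), split by multiplicativity of \<open>S\<close>. As \<open>T\<close> and
  \<open>S\<close> are onto, it determines \<sigma> from \<mu>, \<nu>, \<open>f\<close> and the two
  operators.\<close>

lemma sigma_T_S:
  "a \<in> carrier A \<Longrightarrow> k \<in> carrier K \<Longrightarrow>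
    \<sigma> (T a) (S k) = S (\<nu> (inv\<^bsub>B\<^esub> T a) (\<mu> a k)) \<bullet> S (\<nu> (inv\<^bsub>B\<^esub> T a) (f (S k) a))"
proof -
  assume "a \<in> carrier A" "k \<in> carrier K"
  moreover from this have "S ((inv\<^bsub>AutoGroup K\<^esub> \<nu> (T a)) (\<mu> a k) \<cdot> (inv\<^bsub>AutoGroup K\<^esub> \<nu> (T a)) (f (S k) a))
      = \<sigma> (T a) (S k)"
    using module unfolding rrb_module.simps by blast
  ultimately show ?thesis
    by (simp add: S_mult)
qed

lemma nu_mu: "a \<in> carrier A \<Longrightarrow> b \<in> carrier B \<Longrightarrow> k \<in> carrier K \<Longrightarrow> \<nu> b (\<mu> a k) = \<mu> (\<beta> b a) (\<nu> b k)"
  using module unfolding rrb_module.simps by blast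

lemma nu_f_sigma: "a \<in> carrier A \<Longrightarrow> b \<in> carrier B \<Longrightarrow> l \<in> carrier L \<Longrightarrow> \<nu> b (f (\<sigma> b l) a) = f l (\<beta> b a)"
  using module unfolding rrb_module.simps by blast

text \<open>These rules push all actions inward to the values of cochains; \<open>nu_mu\<close> and
  \<open>nu_f_sigma\<close> are module axioms (5) and (6). What remains is an identity in an abelian
  group, which \<open>fractions\<close> decides.\<close>

lemmas expand = nu_mult nu_comp nu_quot beta_mult beta_comp S_mult S_quot f_mult_left f_mult_right f_quot
  nu_mu nu_f_sigma mu.m_mult mu.m_comp mu.m_quot sig.m_mult sig.m_comp sig.m_quot B.inv_mult_group

lemmas fractions = K.fraction_simps L.fraction_simps K.m_ac L.m_ac A.m_assoc B.m_assoc

text \<open>The kernel of \<open>bdry2_RRB\<close>, with every component cleared of inverses so that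
  the clauses can be multiplied by each other. The last three clauses are, in order,
  \<open>\<gamma>\<^sub>1\<close>, \<open>\<gamma>\<^sub>2\<close> and
  \<open>\<gamma>\<^sub>3\<close>.\<close>

definition rrb_cocycle ::
  "('a \<times> 'a \<Rightarrow> 'k) \<Rightarrow> ('b \<times> 'b \<Rightarrow> 'l) \<Rightarrow> ('a \<times> 'b \<Rightarrow> 'k) \<Rightarrow> ('a \<Rightarrow> 'l) \<Rightarrow> bool" where
  "rrb_cocycle \<tau>\<^sub>1 \<tau>\<^sub>2 \<rho> \<chi> \<longleftrightarrow>
     mu.is_cocycle \<tau>\<^sub>1 \<and> sig.is_cocycle \<tau>\<^sub>2 \<and>
     \<rho> \<in> carrier (cochains2 A B K) \<and> \<chi> \<in> carrier (cochains1 A L) \<and>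
     (\<forall>a\<in>carrier A. \<forall>b\<^sub>1\<in>carrier B. \<forall>b\<^sub>2\<in>carrier B.
        \<rho> (a, b\<^sub>1 \<otimes>\<^bsub>B\<^esub> b\<^sub>2) \<cdot> \<nu> (b\<^sub>1 \<otimes>\<^bsub>B\<^esub> b\<^sub>2) (f (\<tau>\<^sub>2 (b\<^sub>1, b\<^sub>2)) a)
          = \<rho> (\<beta> b\<^sub>2 a, b\<^sub>1) \<cdot> \<nu> b\<^sub>1 (\<rho> (a, b\<^sub>2))) \<and>
     (\<forall>a\<^sub>1\<in>carrier A. \<forall>a\<^sub>2\<in>carrier A. \<forall>b\<in>carrier B.
        \<rho> (a\<^sub>1 \<otimes>\<^bsub>A\<^esub> a\<^sub>2, b) \<cdot> \<nu> b (\<tau>\<^sub>1 (a\<^sub>1, a\<^sub>2))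
          = \<mu> (\<beta> b a\<^sub>2) (\<rho> (a\<^sub>1, b)) \<cdot> \<rho> (a\<^sub>2, b) \<cdot> \<tau>\<^sub>1 (\<beta> b a\<^sub>1, \<beta> b a\<^sub>2)) \<and>
     (\<forall>a\<^sub>1\<in>carrier A. \<forall>a\<^sub>2\<in>carrier A.
        S (\<nu> (inv\<^bsub>B\<^esub> (T a\<^sub>1 \<otimes>\<^bsub>B\<^esub> T a\<^sub>2))
             (\<rho> (a\<^sub>2, T a\<^sub>1) \<cdot> \<tau>\<^sub>1 (a\<^sub>1, \<beta> (T a\<^sub>1) a\<^sub>2) \<cdot> \<nu> (T a\<^sub>1) (f (\<chi> a\<^sub>1) a\<^sub>2)))
            \<bullet> \<chi> (a\<^sub>1 \<otimes>\<^bsub>A\<^esub> \<beta> (T a\<^sub>1) a\<^sub>2)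
          = \<tau>\<^sub>2 (T a\<^sub>1, T a\<^sub>2) \<bullet> \<chi> a\<^sub>2 \<bullet> \<sigma> (T a\<^sub>2) (\<chi> a\<^sub>1))"

text \<open>The last clause is the third condition of \<^const>\<open>Z2_N\<close>, simplified by means of the cocycle
  identity for \<open>g\<close>.\<close>

definition brace_cocycle :: "('a \<times> 'a \<Rightarrow> 'k) \<Rightarrow> ('a \<times> 'a \<Rightarrow> 'k) \<Rightarrow> bool" where
  "brace_cocycle g h \<longleftrightarrow>
     mu.is_cocycle g \<and> h \<in> carrier (cochains2 A A K) \<and>
     (\<forall>x\<in>carrier A. \<forall>y\<in>carrier A. \<forall>a\<in>carrier A.
        \<nu> (T x) (h (y, a)) \<cdot> h (x, y \<otimes>\<^bsub>A\<^esub> \<beta> (T y) a)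
          = h (x \<otimes>\<^bsub>A\<^esub> \<beta> (T x) y, a) \<cdot> \<mu> (\<beta> (T x) (\<beta> (T y) a)) (h (x, y)) \<cdot>
            \<nu> (T x) (\<nu> (T y) (f (S (\<nu> (inv\<^bsub>B\<^esub> T y) (\<nu> (inv\<^bsub>B\<^esub> T x) (h (x, y))))) a))) \<and>
     (\<forall>x\<in>carrier A. \<forall>a\<in>carrier A. \<forall>a'\<in>carrier A.
        h (x, a \<otimes>\<^bsub>A\<^esub> a') \<cdot> \<nu> (T x) (g (a, a')) \<cdot> g (x, \<beta> (T x) a')
          = g (x \<otimes>\<^bsub>A\<^esub> \<beta> (T x) a, \<beta> (T x) a') \<cdot> \<mu> (\<beta> (T x) a') (h (x, a)) \<cdot> h (x, a'))"

lemma Z2_RRB_iff: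
  "(\<tau>\<^sub>1, \<tau>\<^sub>2, \<rho>, \<chi>) \<in> carrier (Z2_RRB (A, B, \<beta>, T) (K, L, \<alpha>, S) (\<nu>, \<mu>, \<sigma>, f))
    \<longleftrightarrow> rrb_cocycle \<tau>\<^sub>1 \<tau>\<^sub>2 \<rho> \<chi>" (is "?l \<longleftrightarrow> ?r")
\<comment> \<open>For tuples that are not normalised cochains both sides fail; for the others all
  values lie in the carriers, as the fraction rules require.\<close>
proof (cases "\<tau>\<^sub>1 \<in> carrier (cochains2 A A K) \<and> \<tau>\<^sub>2 \<in> carrier (cochains2 B B L) \<and>
    \<rho> \<in> carrier (cochains2 A B K) \<and> \<chi> \<in> carrier (cochains1 A L)")
  case True
  then have [simp]:
    "\<And>x y. x \<in> carrier A \<Longrightarrow> y \<in> carrier A \<Longrightarrow> \<tau>\<^sub>1 (x, y) \<in> carrier K"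
    "\<And>x y. x \<in> carrier B \<Longrightarrow> y \<in> carrier B \<Longrightarrow> \<tau>\<^sub>2 (x, y) \<in> carrier L"
    "\<And>x y. x \<in> carrier A \<Longrightarrow> y \<in> carrier B \<Longrightarrow> \<rho> (x, y) \<in> carrier K"
    "\<And>x. x \<in> carrier A \<Longrightarrow> \<chi> x \<in> carrier L"
    by (auto simp: cochains1D cochains2D)
  show ?thesis
    using True
    apply (simp add: Z2_RRB_def kernel_def mu.bdry2_eq_one_iff sig.bdry2_eq_one_iff rrb_cocycle_def
        cochains3_def[of A B B K] cochains3_def[of A A B K] cochains2_def[of A A L] one_cochains
        restrict2_eq_iff restrict3_eq_iff)
    apply (intro conj_cong ball_cong refl)
      apply (simp_all add: fractions)
    done
next
  case False
  then show ?thesis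
    by (auto simp: Z2_RRB_def kernel_def rrb_cocycle_def mu.is_cocycle_def sig.is_cocycle_def)
qed

lemma T_circ_circ:
  assumes "x \<in> carrier A" "y \<in> carrier A" "z \<in> carrier A"
  shows "T (x \<otimes>\<^bsub>A\<^esub> \<beta> (T x) y \<otimes>\<^bsub>A\<^esub> \<beta> (T x) (\<beta> (T y) z)) = T x \<otimes>\<^bsub>B\<^esub> T y \<otimes>\<^bsub>B\<^esub> T z"
  using T_circ[of "x \<otimes>\<^bsub>A\<^esub> \<beta> (T x) y" z] assms by (simp add: beta_comp)

text \<open>In the second condition the outer \<xi> at the triple circle product absorbs the
  inverses of \<open>T\<close> that occur in \<epsilon>, leaving one \<mu> term and one
  \<open>f\<close> term.\<close>

lemma Z2_N_iff:
  "(g, h) \<in> carrier (Z2_N (induced_brace (A, B, \<beta>, T)) (induced_brace (K, L, \<alpha>, S))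
      (induced_action (A, B, \<beta>, T) (K, L, \<alpha>, S) (\<nu>, \<mu>, \<sigma>, f)))
    \<longleftrightarrow> brace_cocycle g h"
proof (cases "mu.is_cocycle g \<and> h \<in> carrier (cochains2 A A K)")
  case True
  then have g: "g \<in> carrier (cochains2 A A K)"
    and coc: "\<And>x y z. x \<in> carrier A \<Longrightarrow> y \<in> carrier A \<Longrightarrow> z \<in> carrier A \<Longrightarrow>
      g (y, z) \<cdot> g (x, y \<otimes>\<^bsub>A\<^esub> z) = g (x \<otimes>\<^bsub>A\<^esub> y, z) \<cdot> \<mu> z (g (x, y))"
    by (auto simp: mu.is_cocycle_def)
  have h: "h \<in> carrier (cochains2 A A K)"
    using True by simp
  from g h have [simp]:
    "\<And>x y. x \<in> carrier A \<Longrightarrow> y \<in> carrier A \<Longrightarrow> g (x, y) \<in> carrier K"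
    "\<And>x. x \<in> carrier A \<Longrightarrow> g (\<one>\<^bsub>A\<^esub>, x) = \<one>\<^bsub>K\<^esub>"
    "\<And>x y. x \<in> carrier A \<Longrightarrow> y \<in> carrier A \<Longrightarrow> h (x, y) \<in> carrier K"
    by (auto simp: cochains2D)
  have brace: "\<nu> (T x) (g (a, a')) \<cdot> \<mu> (x \<otimes>\<^bsub>A\<^esub> v) (g (x, inv\<^bsub>A\<^esub> x)) \<cdot> h (x, a \<otimes>\<^bsub>A\<^esub> a')
        = \<mu> (x \<otimes>\<^bsub>A\<^esub> v) (g (x \<otimes>\<^bsub>A\<^esub> u, inv\<^bsub>A\<^esub> x)) \<cdot> g (x \<otimes>\<^bsub>A\<^esub> u \<otimes>\<^bsub>A\<^esub> inv\<^bsub>A\<^esub> x, x \<otimes>\<^bsub>A\<^esub> v)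
          \<cdot> \<mu> v (h (x, a)) \<cdot> h (x, a')
      \<longleftrightarrow> h (x, a \<otimes>\<^bsub>A\<^esub> a') \<cdot> \<nu> (T x) (g (a, a')) \<cdot> g (x, v)
        = g (x \<otimes>\<^bsub>A\<^esub> u, v) \<cdot> \<mu> v (h (x, a)) \<cdot> h (x, a')" (is "?l1 = ?r1 \<longleftrightarrow> ?l2 = ?r2")
    if "x \<in> carrier A" "u \<in> carrier A" "v \<in> carrier A" "a \<in> carrier A" "a' \<in> carrier A" for x u v a a'
  proof -
    \<comment> \<open>The cocycle identity at (x, inv x, x v) and at (x u, inv x, x v) produces the
      same factor \<open>?w\<close> on both sides of the third condition; cancelling it removes
      every argument that involves the inverse of x.\<close>
    let ?w = "g (inv\<^bsub>A\<^esub> x, x \<otimes>\<^bsub>A\<^esub> v)"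
    have [simp]: "inv\<^bsub>A\<^esub> x \<otimes>\<^bsub>A\<^esub> (x \<otimes>\<^bsub>A\<^esub> v) = v"
      using that by (simp flip: A.m_assoc)
    have 1: "\<mu> (x \<otimes>\<^bsub>A\<^esub> v) (g (x, inv\<^bsub>A\<^esub> x)) = ?w \<cdot> g (x, v)"
      using coc[of x "inv\<^bsub>A\<^esub> x" "x \<otimes>\<^bsub>A\<^esub> v"] that by simp
    have 2: "g (x \<otimes>\<^bsub>A\<^esub> u \<otimes>\<^bsub>A\<^esub> inv\<^bsub>A\<^esub> x, x \<otimes>\<^bsub>A\<^esub> v) \<cdot> \<mu> (x \<otimes>\<^bsub>A\<^esub> v) (g (x \<otimes>\<^bsub>A\<^esub> u, inv\<^bsub>A\<^esub> x)) = ?w \<cdot> g (x \<otimes>\<^bsub>A\<^esub> u, v)"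
      using coc[of "x \<otimes>\<^bsub>A\<^esub> u" "inv\<^bsub>A\<^esub> x" "x \<otimes>\<^bsub>A\<^esub> v"] that by simp
    have "?l1 = ?w \<cdot> ?l2"
      using that by (simp add: 1 K.m_ac)
    moreover have "?r1 = (g (x \<otimes>\<^bsub>A\<^esub> u \<otimes>\<^bsub>A\<^esub> inv\<^bsub>A\<^esub> x, x \<otimes>\<^bsub>A\<^esub> v) \<cdot> \<mu> (x \<otimes>\<^bsub>A\<^esub> v) (g (x \<otimes>\<^bsub>A\<^esub> u, inv\<^bsub>A\<^esub> x)))
        \<cdot> \<mu> v (h (x, a)) \<cdot> h (x, a')"
      using that by (simp add: K.m_ac)
    then have "?r1 = ?w \<cdot> ?r2"
      unfolding 2 using that by (simp add: K.m_ac)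
    ultimately show ?thesis
      using that by simp
  qed
  \<comment> \<open>With \<open>g\<close> a cocycle the first condition of \<open>Z2_N\<close> is
    already true; this splits the conjunction so that only the other two are matched.\<close>
  have conj3: "P \<and> Q \<and> R \<longleftrightarrow> Q' \<and> R'" if "P" "Q \<longleftrightarrow> Q'" "R \<longleftrightarrow> R'" for P Q R Q' R'
    using that by simp
  have inv_left [simp]: "inv\<^bsub>A\<^esub> x \<otimes>\<^bsub>A\<^esub> (x \<otimes>\<^bsub>A\<^esub> v) = v" if "x \<in> carrier A" "v \<in> carrier A" for x v
    using that by (simp flip: A.m_assoc)
  have "(g, h) \<in> carrier (Z2_N (induced_brace (A, B, \<beta>, T)) (induced_brace (K, L, \<alpha>, S))
      (induced_action (A, B, \<beta>, T) (K, L, \<alpha>, S) (\<nu>, \<mu>, \<sigma>, f))) \<longleftrightarrow>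
    (\<forall>x\<in>carrier A. \<forall>y\<in>carrier A. \<forall>z\<in>carrier A.
        \<nu> (T x) (h (y, z)) \<cdot> h (x, y \<otimes>\<^bsub>A\<^esub> \<beta> (T y) z)
          = h (x \<otimes>\<^bsub>A\<^esub> \<beta> (T x) y, z) \<cdot> \<mu> (\<beta> (T x) (\<beta> (T y) z)) (h (x, y)) \<cdot>
            \<nu> (T x) (\<nu> (T y) (f (S (\<nu> (inv\<^bsub>B\<^esub> T y) (\<nu> (inv\<^bsub>B\<^esub> T x) (h (x, y))))) z)) \<and>
        h (x, y \<otimes>\<^bsub>A\<^esub> z) \<cdot> \<nu> (T x) (g (y, z)) \<cdot> g (x, \<beta> (T x) z)
          = g (x \<otimes>\<^bsub>A\<^esub> \<beta> (T x) y, \<beta> (T x) z) \<cdot> \<mu> (\<beta> (T x) z) (h (x, y)) \<cdot> h (x, z))"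
    apply (simp only: induced_brace.simps induced_action.simps Z2_N.simps partial_object.simps monoid.simps
        mem_Collect_eq case_prod_conv carrier_DirProd mem_Sigma_iff g h simp_thms carrier_update)
    apply (intro ball_cong refl)
    apply (subst brace[symmetric])
         apply simp_all[5]
    apply (rule conj3)
      apply (simp add: coc K.fraction_simps K.m_ac)
     apply (simp add: expand T_circ_circ K.fraction_simps K.m_ac)
    apply (simp add: K.fraction_simps K.m_ac)
    done
  then show ?thesis
    using True by (auto simp: brace_cocycle_def)
next
  case False
  then show ?thesis
    by (auto simp: brace_cocycle_def mu.is_cocycle_def K.fraction_simps K.m_ac cochains2D)
qed

section \<open>Translating cocycles between the two theories\<close>

abbreviation T_inv :: "'b \<Rightarrow> 'a" where
  "T_inv \<equiv> inv_into (carrier A) T"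

lemma T_inv [simp]:
  shows "b \<in> carrier B \<Longrightarrow> T_inv b \<in> carrier A" "b \<in> carrier B \<Longrightarrow> T (T_inv b) = b"
    "a \<in> carrier A \<Longrightarrow> T_inv (T a) = a"
  using bij_T by (auto simp: bij_betw_def inv_into_into f_inv_into_f)

lemma T_inv_one [simp]: "T_inv \<one>\<^bsub>B\<^esub> = \<one>\<^bsub>A\<^esub>"
  using T_inv(3)[OF A.one_closed] by simp

text \<open>The Rota-Baxter identity makes \<open>T\<close> an isomorphism from A with the circle
  product onto B; this is its inverse.\<close>

lemma T_inv_mult:
  "a\<^sub>1 \<in> carrier A \<Longrightarrow> a\<^sub>2 \<in> carrier A \<Longrightarrow> T_inv (T a\<^sub>1 \<otimes>\<^bsub>B\<^esub> T a\<^sub>2) = a\<^sub>1 \<otimes>\<^bsub>A\<^esub> \<beta> (T a\<^sub>1) a\<^sub>2"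
  by (metis T_inv(3) T_circ A.m_closed beta_closed T_closed)

lemma rrb_cocycleD:
  assumes "rrb_cocycle \<tau>\<^sub>1 \<tau>\<^sub>2 \<rho> \<chi>"
  shows "\<And>x y. x \<in> carrier A \<Longrightarrow> y \<in> carrier A \<Longrightarrow> \<tau>\<^sub>1 (x, y) \<in> carrier K"
    and "\<And>x y. x \<in> carrier B \<Longrightarrow> y \<in> carrier B \<Longrightarrow> \<tau>\<^sub>2 (x, y) \<in> carrier L"
    and "\<And>x y. x \<in> carrier A \<Longrightarrow> y \<in> carrier B \<Longrightarrow> \<rho> (x, y) \<in> carrier K"
    and "\<And>x. x \<in> carrier A \<Longrightarrow> \<chi> x \<in> carrier L"
    and "\<And>x. x \<in> carrier A \<Longrightarrow> \<tau>\<^sub>1 (x, \<one>\<^bsub>A\<^esub>) = \<one>\<^bsub>K\<^esub>"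
    and "\<And>x. x \<in> carrier A \<Longrightarrow> \<tau>\<^sub>1 (\<one>\<^bsub>A\<^esub>, x) = \<one>\<^bsub>K\<^esub>"
    and "\<And>x. x \<in> carrier B \<Longrightarrow> \<tau>\<^sub>2 (x, \<one>\<^bsub>B\<^esub>) = \<one>\<^bsub>L\<^esub>"
    and "\<And>x. x \<in> carrier B \<Longrightarrow> \<tau>\<^sub>2 (\<one>\<^bsub>B\<^esub>, x) = \<one>\<^bsub>L\<^esub>"
    and "\<And>x. x \<in> carrier A \<Longrightarrow> \<rho> (x, \<one>\<^bsub>B\<^esub>) = \<one>\<^bsub>K\<^esub>"
    and "\<And>x. x \<in> carrier B \<Longrightarrow> \<rho> (\<one>\<^bsub>A\<^esub>, x) = \<one>\<^bsub>K\<^esub>"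
    and "\<chi> \<one>\<^bsub>A\<^esub> = \<one>\<^bsub>L\<^esub>"
proof -
  have "\<tau>\<^sub>1 \<in> carrier (cochains2 A A K)" "\<tau>\<^sub>2 \<in> carrier (cochains2 B B L)"
    "\<rho> \<in> carrier (cochains2 A B K)" "\<chi> \<in> carrier (cochains1 A L)"
    using assms unfolding rrb_cocycle_def mu.is_cocycle_def sig.is_cocycle_def by blast+
  note * = this(1-3)[THEN cochains2D(1)] this(1-3)[THEN cochains2D(2)] this(1-3)[THEN cochains2D(3)]
    this(4)[THEN cochains1D(1)] this(4)[THEN cochains1D(2)]
  show "\<And>x y. x \<in> carrier A \<Longrightarrow> y \<in> carrier A \<Longrightarrow> \<tau>\<^sub>1 (x, y) \<in> carrier K"
    "\<And>x y. x \<in> carrier B \<Longrightarrow> y \<in> carrier B \<Longrightarrow> \<tau>\<^sub>2 (x, y) \<in> carrier L"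
    "\<And>x y. x \<in> carrier A \<Longrightarrow> y \<in> carrier B \<Longrightarrow> \<rho> (x, y) \<in> carrier K"
    "\<And>x. x \<in> carrier A \<Longrightarrow> \<chi> x \<in> carrier L"
    "\<And>x. x \<in> carrier A \<Longrightarrow> \<tau>\<^sub>1 (x, \<one>\<^bsub>A\<^esub>) = \<one>\<^bsub>K\<^esub>"
    "\<And>x. x \<in> carrier A \<Longrightarrow> \<tau>\<^sub>1 (\<one>\<^bsub>A\<^esub>, x) = \<one>\<^bsub>K\<^esub>"
    "\<And>x. x \<in> carrier B \<Longrightarrow> \<tau>\<^sub>2 (x, \<one>\<^bsub>B\<^esub>) = \<one>\<^bsub>L\<^esub>"
    "\<And>x. x \<in> carrier B \<Longrightarrow> \<tau>\<^sub>2 (\<one>\<^bsub>B\<^esub>, x) = \<one>\<^bsub>L\<^esub>"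
    "\<And>x. x \<in> carrier A \<Longrightarrow> \<rho> (x, \<one>\<^bsub>B\<^esub>) = \<one>\<^bsub>K\<^esub>"
    "\<And>x. x \<in> carrier B \<Longrightarrow> \<rho> (\<one>\<^bsub>A\<^esub>, x) = \<one>\<^bsub>K\<^esub>"
    "\<chi> \<one>\<^bsub>A\<^esub> = \<one>\<^bsub>L\<^esub>"
    by (simp_all add: *)
qed

lemma rrb_cocycle_eqs:
  assumes "rrb_cocycle \<tau>\<^sub>1 \<tau>\<^sub>2 \<rho> \<chi>"
  shows "\<And>x y z. x \<in> carrier A \<Longrightarrow> y \<in> carrier A \<Longrightarrow> z \<in> carrier A \<Longrightarrow>
        \<tau>\<^sub>1 (y, z) \<cdot> \<tau>\<^sub>1 (x, y \<otimes>\<^bsub>A\<^esub> z) = \<tau>\<^sub>1 (x \<otimes>\<^bsub>A\<^esub> y, z) \<cdot> \<mu> z (\<tau>\<^sub>1 (x, y))"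
    and "\<And>x y z. x \<in> carrier B \<Longrightarrow> y \<in> carrier B \<Longrightarrow> z \<in> carrier B \<Longrightarrow>
        \<tau>\<^sub>2 (y, z) \<bullet> \<tau>\<^sub>2 (x, y \<otimes>\<^bsub>B\<^esub> z) = \<tau>\<^sub>2 (x \<otimes>\<^bsub>B\<^esub> y, z) \<bullet> \<sigma> z (\<tau>\<^sub>2 (x, y))"
    and "\<And>a b\<^sub>1 b\<^sub>2. a \<in> carrier A \<Longrightarrow> b\<^sub>1 \<in> carrier B \<Longrightarrow> b\<^sub>2 \<in> carrier B \<Longrightarrow>
        \<rho> (a, b\<^sub>1 \<otimes>\<^bsub>B\<^esub> b\<^sub>2) \<cdot> \<nu> (b\<^sub>1 \<otimes>\<^bsub>B\<^esub> b\<^sub>2) (f (\<tau>\<^sub>2 (b\<^sub>1, b\<^sub>2)) a)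
          = \<rho> (\<beta> b\<^sub>2 a, b\<^sub>1) \<cdot> \<nu> b\<^sub>1 (\<rho> (a, b\<^sub>2))"
    and "\<And>a\<^sub>1 a\<^sub>2 b. a\<^sub>1 \<in> carrier A \<Longrightarrow> a\<^sub>2 \<in> carrier A \<Longrightarrow> b \<in> carrier B \<Longrightarrow>
        \<rho> (a\<^sub>1 \<otimes>\<^bsub>A\<^esub> a\<^sub>2, b) \<cdot> \<nu> b (\<tau>\<^sub>1 (a\<^sub>1, a\<^sub>2))
          = \<mu> (\<beta> b a\<^sub>2) (\<rho> (a\<^sub>1, b)) \<cdot> \<rho> (a\<^sub>2, b) \<cdot> \<tau>\<^sub>1 (\<beta> b a\<^sub>1, \<beta> b a\<^sub>2)"
    and "\<And>a\<^sub>1 a\<^sub>2. a\<^sub>1 \<in> carrier A \<Longrightarrow> a\<^sub>2 \<in> carrier A \<Longrightarrow>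
        S (\<nu> (inv\<^bsub>B\<^esub> (T a\<^sub>1 \<otimes>\<^bsub>B\<^esub> T a\<^sub>2))
             (\<rho> (a\<^sub>2, T a\<^sub>1) \<cdot> \<tau>\<^sub>1 (a\<^sub>1, \<beta> (T a\<^sub>1) a\<^sub>2) \<cdot> \<nu> (T a\<^sub>1) (f (\<chi> a\<^sub>1) a\<^sub>2)))
            \<bullet> \<chi> (a\<^sub>1 \<otimes>\<^bsub>A\<^esub> \<beta> (T a\<^sub>1) a\<^sub>2)
          = \<tau>\<^sub>2 (T a\<^sub>1, T a\<^sub>2) \<bullet> \<chi> a\<^sub>2 \<bullet> \<sigma> (T a\<^sub>2) (\<chi> a\<^sub>1)"
  using assms unfolding rrb_cocycle_def mu.is_cocycle_def sig.is_cocycle_def by blast+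

lemma brace_cocycle_eqs:
  assumes "brace_cocycle g h"
  shows "\<And>x y. x \<in> carrier A \<Longrightarrow> y \<in> carrier A \<Longrightarrow> g (x, y) \<in> carrier K"
    and "\<And>x y. x \<in> carrier A \<Longrightarrow> y \<in> carrier A \<Longrightarrow> h (x, y) \<in> carrier K"
    and "\<And>x. x \<in> carrier A \<Longrightarrow> g (x, \<one>\<^bsub>A\<^esub>) = \<one>\<^bsub>K\<^esub>"
    and "\<And>x. x \<in> carrier A \<Longrightarrow> g (\<one>\<^bsub>A\<^esub>, x) = \<one>\<^bsub>K\<^esub>"
    and "\<And>x. x \<in> carrier A \<Longrightarrow> h (x, \<one>\<^bsub>A\<^esub>) = \<one>\<^bsub>K\<^esub>"
    and "\<And>x. x \<in> carrier A \<Longrightarrow> h (\<one>\<^bsub>A\<^esub>, x) = \<one>\<^bsub>K\<^esub>"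
    and "\<And>x y z. x \<in> carrier A \<Longrightarrow> y \<in> carrier A \<Longrightarrow> z \<in> carrier A \<Longrightarrow>
        g (y, z) \<cdot> g (x, y \<otimes>\<^bsub>A\<^esub> z) = g (x \<otimes>\<^bsub>A\<^esub> y, z) \<cdot> \<mu> z (g (x, y))"
    and "\<And>x y a. x \<in> carrier A \<Longrightarrow> y \<in> carrier A \<Longrightarrow> a \<in> carrier A \<Longrightarrow>
        \<nu> (T x) (h (y, a)) \<cdot> h (x, y \<otimes>\<^bsub>A\<^esub> \<beta> (T y) a)
          = h (x \<otimes>\<^bsub>A\<^esub> \<beta> (T x) y, a) \<cdot> \<mu> (\<beta> (T x) (\<beta> (T y) a)) (h (x, y)) \<cdot>
            \<nu> (T x) (\<nu> (T y) (f (S (\<nu> (inv\<^bsub>B\<^esub> T y) (\<nu> (inv\<^bsub>B\<^esub> T x) (h (x, y))))) a))"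
    and "\<And>x a a'. x \<in> carrier A \<Longrightarrow> a \<in> carrier A \<Longrightarrow> a' \<in> carrier A \<Longrightarrow>
        h (x, a \<otimes>\<^bsub>A\<^esub> a') \<cdot> \<nu> (T x) (g (a, a')) \<cdot> g (x, \<beta> (T x) a')
          = g (x \<otimes>\<^bsub>A\<^esub> \<beta> (T x) a, \<beta> (T x) a') \<cdot> \<mu> (\<beta> (T x) a') (h (x, a)) \<cdot> h (x, a')"
proof -
  have "g \<in> carrier (cochains2 A A K)" "h \<in> carrier (cochains2 A A K)"
    using assms unfolding brace_cocycle_def mu.is_cocycle_def by blast+
  note * = this[THEN cochains2D(1)] this[THEN cochains2D(2)] this[THEN cochains2D(3)]
  show "\<And>x y. x \<in> carrier A \<Longrightarrow> y \<in> carrier A \<Longrightarrow> g (x, y) \<in> carrier K"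
    "\<And>x y. x \<in> carrier A \<Longrightarrow> y \<in> carrier A \<Longrightarrow> h (x, y) \<in> carrier K"
    "\<And>x. x \<in> carrier A \<Longrightarrow> g (x, \<one>\<^bsub>A\<^esub>) = \<one>\<^bsub>K\<^esub>"
    "\<And>x. x \<in> carrier A \<Longrightarrow> g (\<one>\<^bsub>A\<^esub>, x) = \<one>\<^bsub>K\<^esub>"
    "\<And>x. x \<in> carrier A \<Longrightarrow> h (x, \<one>\<^bsub>A\<^esub>) = \<one>\<^bsub>K\<^esub>"
    "\<And>x. x \<in> carrier A \<Longrightarrow> h (\<one>\<^bsub>A\<^esub>, x) = \<one>\<^bsub>K\<^esub>"
    by (simp_all add: *)
qed (use assms in \<open>unfold brace_cocycle_def mu.is_cocycle_def, blast+\<close>)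

text \<open>The complex property: a boundary of a boundary is trivial. After expansion each clause
  is formal; in the last one \<open>sigma_T_S\<close> is what matches the \<sigma> term with the
  terms in \<open>\<theta>\<^sub>1\<close>.\<close>

lemma rrb_cocycle_bdry1:
  assumes "\<theta>\<^sub>1 \<in> carrier (cochains1 A K)" "\<theta>\<^sub>2 \<in> carrier (cochains1 B L)"
  shows "rrb_cocycle (bdry1 A K \<mu> \<theta>\<^sub>1) (bdry1 B L \<sigma> \<theta>\<^sub>2)
    (\<lambda>(a, b)\<in>carrier A \<times> carrier B. \<nu> b (f (\<theta>\<^sub>2 b) a \<cdot> \<theta>\<^sub>1 a) \<cdot> inv\<^bsub>K\<^esub> (\<theta>\<^sub>1 (\<beta> b a)))
    (\<lambda>a\<in>carrier A. S ((inv\<^bsub>AutoGroup K\<^esub> (\<nu> (T a))) (\<theta>\<^sub>1 a)) \<bullet> inv\<^bsub>L\<^esub> (\<theta>\<^sub>2 (T a)))"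
proof -
  note [simp] = cochains1D[OF assms(1)] cochains1D[OF assms(2)]
  show ?thesis
    unfolding rrb_cocycle_def
    by (intro conjI ballI mu.is_cocycle_bdry1[OF assms(1)] sig.is_cocycle_bdry1[OF assms(2)])
      (auto simp: cochains1_def cochains2_def carrier_cochains bdry1_def expand sigma_T_S fractions)
qed

text \<open>The component h of the explicit formula for \<Lambda>\<Pi>\<Psi>. In the extension built
  from the cocycle it is the K-coordinate of the circle product of
  \<open>(a\<^sub>1, \<one>)\<close> and \<open>(a\<^sub>2, \<one>)\<close>.\<close>

definition brace_part ::
  "('a \<times> 'a \<Rightarrow> 'k) \<Rightarrow> ('a \<times> 'b \<Rightarrow> 'k) \<Rightarrow> ('a \<Rightarrow> 'l) \<Rightarrow> ('a \<times> 'a \<Rightarrow> 'k)" where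
  "brace_part \<tau>\<^sub>1 \<rho> \<chi> = (\<lambda>(a\<^sub>1, a\<^sub>2)\<in>carrier A \<times> carrier A.
     \<tau>\<^sub>1 (a\<^sub>1, \<beta> (T a\<^sub>1) a\<^sub>2) \<cdot> \<rho> (a\<^sub>2, T a\<^sub>1) \<cdot> \<nu> (T a\<^sub>1) (f (\<chi> a\<^sub>1) a\<^sub>2))"

text \<open>The contributions of \<open>\<theta>\<^sub>2\<close> through the third and the fourth
  component are inverse to each other, and so are the two occurrences of
  \<open>\<theta>\<^sub>1\<close> at \<open>\<beta> (T a\<^sub>1) a\<^sub>2\<close>. Hence the
  result depends on \<open>\<theta>\<^sub>1\<close> alone.\<close>

lemma brace_part_bdry1:
  assumes "\<theta>\<^sub>1 \<in> carrier (cochains1 A K)" "\<theta>\<^sub>2 \<in> carrier (cochains1 B L)"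
    and "a\<^sub>1 \<in> carrier A" "a\<^sub>2 \<in> carrier A"
  shows "brace_part (bdry1 A K \<mu> \<theta>\<^sub>1)
      (\<lambda>(a, b)\<in>carrier A \<times> carrier B. \<nu> b (f (\<theta>\<^sub>2 b) a \<cdot> \<theta>\<^sub>1 a) \<cdot> inv\<^bsub>K\<^esub> (\<theta>\<^sub>1 (\<beta> b a)))
      (\<lambda>a\<in>carrier A. S ((inv\<^bsub>AutoGroup K\<^esub> (\<nu> (T a))) (\<theta>\<^sub>1 a)) \<bullet> inv\<^bsub>L\<^esub> (\<theta>\<^sub>2 (T a))) (a\<^sub>1, a\<^sub>2)
    = \<mu> (\<beta> (T a\<^sub>1) a\<^sub>2) (\<theta>\<^sub>1 a\<^sub>1) \<cdot> \<nu> (T a\<^sub>1) (\<theta>\<^sub>1 a\<^sub>2)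
      \<cdot> \<nu> (T a\<^sub>1) (f (S (\<nu> (inv\<^bsub>B\<^esub> (T a\<^sub>1)) (\<theta>\<^sub>1 a\<^sub>1))) a\<^sub>2)
      \<cdot> inv\<^bsub>K\<^esub> (\<theta>\<^sub>1 (a\<^sub>1 \<otimes>\<^bsub>A\<^esub> \<beta> (T a\<^sub>1) a\<^sub>2))"
proof -
  note [simp] = cochains1D[OF assms(1)] cochains1D[OF assms(2)]
  show ?thesis
    using assms(3,4) by (simp add: brace_part_def bdry1_def expand fractions)
qed

lemma brace_part_closed:
  assumes "rrb_cocycle \<tau>\<^sub>1 \<tau>\<^sub>2 \<rho> \<chi>"
  shows "brace_part \<tau>\<^sub>1 \<rho> \<chi> \<in> carrier (cochains2 A A K)"
  by (auto simp: brace_part_def cochains2_def carrier_cochains rrb_cocycleD[OF assms])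

text \<open>Gives surjectivity. An argument b in B stands for \<open>T_inv b\<close> in A, which
  turns a map on pairs from A into maps on A \<times> B and B \<times> B; \<rho> and \<tau> are the
  solutions of the definition of h and of \<open>\<gamma>\<^sub>3 = 1\<close> for trivial
  \<chi>.\<close>

lemma rrb_cocycle_of_brace_cocycle:
  assumes "brace_cocycle g h"
  defines "\<rho> \<equiv> \<lambda>(a, b)\<in>carrier A \<times> carrier B. h (T_inv b, a) \<cdot> inv\<^bsub>K\<^esub> g (T_inv b, \<beta> b a)"
    and "\<tau> \<equiv> \<lambda>(b\<^sub>1, b\<^sub>2)\<in>carrier B \<times> carrier B. S (\<nu> (inv\<^bsub>B\<^esub> (b\<^sub>1 \<otimes>\<^bsub>B\<^esub> b\<^sub>2)) (h (T_inv b\<^sub>1, T_inv b\<^sub>2)))"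
    and "\<chi> \<equiv> \<lambda>a\<in>carrier A. \<one>\<^bsub>L\<^esub>"
  shows "rrb_cocycle g \<tau> \<rho> \<chi>" and "brace_part g \<rho> \<chi> = h"
proof -
  note [simp] = brace_cocycle_eqs(1-6)[OF assms(1)]
  note coc = brace_cocycle_eqs(7-9)[OF assms(1)]
  have "mu.is_cocycle g"
    using assms(1) by (simp add: brace_cocycle_def)
  moreover have "\<tau> \<in> carrier (cochains2 B B L)"
    by (auto simp: \<tau>_def cochains2_def carrier_cochains)
  moreover have "\<rho> \<in> carrier (cochains2 A B K)"
    by (auto simp: \<rho>_def cochains2_def carrier_cochains)
  moreover have "\<chi> \<in> carrier (cochains1 A L)"
    by (auto simp: \<chi>_def cochains1_def carrier_cochains)
  moreover have "\<tau> (y, z) \<bullet> \<tau> (x, y \<otimes>\<^bsub>B\<^esub> z) = \<tau> (x \<otimes>\<^bsub>B\<^esub> y, z) \<bullet> \<sigma> z (\<tau> (x, y))"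
    if prems: "x \<in> carrier B" "y \<in> carrier B" "z \<in> carrier B" for x y z
  proof -
    obtain a b c where abc: "a \<in> carrier A" "b \<in> carrier A" "c \<in> carrier A" "x = T a" "y = T b" "z = T c"
      using prems[THEN T_surj] by blast
    \<comment> \<open>Carries the second brace condition to L. Under \<open>S\<close> and the
      inverse of \<nu> at xyz its last two terms combine, by \<open>sigma_T_S\<close>, to
      \<open>\<sigma> z (\<tau> (x, y))\<close>.\<close>
    have "S (\<nu> (inv\<^bsub>B\<^esub> (x \<otimes>\<^bsub>B\<^esub> y \<otimes>\<^bsub>B\<^esub> z)) (\<nu> (T a) (h (b, c)) \<cdot> h (a, b \<otimes>\<^bsub>A\<^esub> \<beta> (T b) c)))
      = S (\<nu> (inv\<^bsub>B\<^esub> (x \<otimes>\<^bsub>B\<^esub> y \<otimes>\<^bsub>B\<^esub> z)) (h (a \<otimes>\<^bsub>A\<^esub> \<beta> (T a) b, c) \<cdot> \<mu> (\<beta> (T a) (\<beta> (T b) c)) (h (a, b)) \<cdot>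
            \<nu> (T a) (\<nu> (T b) (f (S (\<nu> (inv\<^bsub>B\<^esub> T b) (\<nu> (inv\<^bsub>B\<^esub> T a) (h (a, b))))) c))))"
      by (simp only: coc(2)[OF abc(1-3)])
    then show ?thesis
      using abc by (simp add: \<tau>_def T_inv_mult expand sigma_T_S B.m_assoc L.m_ac)
  qed
  moreover have "\<rho> (a, b\<^sub>1 \<otimes>\<^bsub>B\<^esub> b\<^sub>2) \<cdot> \<nu> (b\<^sub>1 \<otimes>\<^bsub>B\<^esub> b\<^sub>2) (f (\<tau> (b\<^sub>1, b\<^sub>2)) a) = \<rho> (\<beta> b\<^sub>2 a, b\<^sub>1) \<cdot> \<nu> b\<^sub>1 (\<rho> (a, b\<^sub>2))"
    if prems: "a \<in> carrier A" "b\<^sub>1 \<in> carrier B" "b\<^sub>2 \<in> carrier B" for a b\<^sub>1 b\<^sub>2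
  proof -
    obtain x y where xy: "x \<in> carrier A" "y \<in> carrier A" "b\<^sub>1 = T x" "b\<^sub>2 = T y"
      using prems(2,3)[THEN T_surj] by blast
    \<comment> \<open>The second condition at (x, y, a) is multiplied by the third at (x, y,
      \<open>\<beta> (T y) a\<close>). The common value of h cancels, and the \<open>g\<close>
      factors are those in the definition of \<rho>.\<close>
    show ?thesis
      by (rule K.eq_by_factors2[OF coc(2)[of x y a, symmetric] coc(3)[of x y "\<beta> (T y) a"]])
        (use prems(1) xy in \<open>simp_all add: \<tau>_def \<rho>_def T_inv_mult expand K.fraction_simps K.m_ac\<close>)
  qed
  moreover have "\<rho> (a\<^sub>1 \<otimes>\<^bsub>A\<^esub> a\<^sub>2, b) \<cdot> \<nu> b (g (a\<^sub>1, a\<^sub>2))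
      = \<mu> (\<beta> b a\<^sub>2) (\<rho> (a\<^sub>1, b)) \<cdot> \<rho> (a\<^sub>2, b) \<cdot> g (\<beta> b a\<^sub>1, \<beta> b a\<^sub>2)"
    if prems: "a\<^sub>1 \<in> carrier A" "a\<^sub>2 \<in> carrier A" "b \<in> carrier B" for a\<^sub>1 a\<^sub>2 b
  proof -
    obtain x where x: "x \<in> carrier A" "b = T x"
      using prems(3)[THEN T_surj] by blast
    \<comment> \<open>The third condition speaks of h, that is, of \<rho> times a value of
      \<open>g\<close>; the cocycle identity of \<open>g\<close> disposes of the extra
      factors.\<close>
    show ?thesis
      by (rule K.eq_by_factors2[OF coc(3)[of x a\<^sub>1 a\<^sub>2] coc(1)[of x "\<beta> (T x) a\<^sub>1" "\<beta> (T x) a\<^sub>2", symmetric]])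
        (use prems(1,2) x in \<open>simp_all add: \<rho>_def expand K.fraction_simps K.m_ac\<close>)
  qed
  moreover have "S (\<nu> (inv\<^bsub>B\<^esub> (T a\<^sub>1 \<otimes>\<^bsub>B\<^esub> T a\<^sub>2))
        (\<rho> (a\<^sub>2, T a\<^sub>1) \<cdot> g (a\<^sub>1, \<beta> (T a\<^sub>1) a\<^sub>2) \<cdot> \<nu> (T a\<^sub>1) (f (\<chi> a\<^sub>1) a\<^sub>2)))
          \<bullet> \<chi> (a\<^sub>1 \<otimes>\<^bsub>A\<^esub> \<beta> (T a\<^sub>1) a\<^sub>2)
        = \<tau> (T a\<^sub>1, T a\<^sub>2) \<bullet> \<chi> a\<^sub>2 \<bullet> \<sigma> (T a\<^sub>2) (\<chi> a\<^sub>1)"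
    if "a\<^sub>1 \<in> carrier A" "a\<^sub>2 \<in> carrier A" for a\<^sub>1 a\<^sub>2
    using that by (simp add: \<tau>_def \<rho>_def \<chi>_def K.m_assoc)
  ultimately show "rrb_cocycle g \<tau> \<rho> \<chi>"
    by (simp add: rrb_cocycle_def sig.is_cocycle_def)
  have "h \<in> extensional (carrier A \<times> carrier A)"
    using assms(1) by (auto simp: brace_cocycle_def intro: extensional_cochains2)
  then show "brace_part g \<rho> \<chi> = h"
    by (intro extensionalityI[of _ "carrier A \<times> carrier A"])
      (auto simp: brace_part_def \<rho>_def \<chi>_def K.fraction_simps K.m_ac)
qed

text \<open>Trivial \<chi> reduces \<open>\<gamma>\<^sub>3 = 1\<close> to a formula for
  \<open>\<tau>\<^sub>2\<close> in terms of h, so the cocycle identity of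
  \<open>\<tau>\<^sub>2\<close> becomes a statement about h.\<close>

lemma brace_cocycle_of_rrb_cocycle:
  assumes "rrb_cocycle \<tau>\<^sub>1 \<tau>\<^sub>2 \<rho> \<chi>" and \<chi>: "\<And>a. a \<in> carrier A \<Longrightarrow> \<chi> a = \<one>\<^bsub>L\<^esub>"
  shows "brace_cocycle \<tau>\<^sub>1 (brace_part \<tau>\<^sub>1 \<rho> \<chi>)"
proof -
  define h where "h = brace_part \<tau>\<^sub>1 \<rho> \<chi>"
  note [simp] = rrb_cocycleD[OF assms(1)] \<chi>
  note coc = rrb_cocycle_eqs[OF assms(1)]
  have h: "h (x, y) = \<tau>\<^sub>1 (x, \<beta> (T x) y) \<cdot> \<rho> (y, T x)" if "x \<in> carrier A" "y \<in> carrier A" for x y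
    using that by (simp add: h_def brace_part_def)
  have [simp]: "h (x, y) \<in> carrier K" if "x \<in> carrier A" "y \<in> carrier A" for x y
    using that by (simp add: h)
  have \<tau>\<^sub>2: "\<tau>\<^sub>2 (T x, T y) = S (\<nu> (inv\<^bsub>B\<^esub> T y) (\<nu> (inv\<^bsub>B\<^esub> T x) (h (x, y))))"
    if "x \<in> carrier A" "y \<in> carrier A" for x y
    using coc(5)[OF that] that by (simp add: h expand K.m_ac)
  have "\<nu> (T x) (h (y, a)) \<cdot> h (x, y \<otimes>\<^bsub>A\<^esub> \<beta> (T y) a)
      = h (x \<otimes>\<^bsub>A\<^esub> \<beta> (T x) y, a) \<cdot> \<mu> (\<beta> (T x) (\<beta> (T y) a)) (h (x, y)) \<cdot>
        \<nu> (T x) (\<nu> (T y) (f (S (\<nu> (inv\<^bsub>B\<^esub> T y) (\<nu> (inv\<^bsub>B\<^esub> T x) (h (x, y))))) a))" (is "?l = ?r")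
    if "x \<in> carrier A" "y \<in> carrier A" "a \<in> carrier A" for x y a
  proof -
    \<comment> \<open>After \<open>S\<close> and the three inverse \<nu> both sides are the two
      sides of the cocycle identity of \<open>\<tau>\<^sub>2\<close> at (T x, T y, T a).\<close>
    have "S (\<nu> (inv\<^bsub>B\<^esub> T a) (\<nu> (inv\<^bsub>B\<^esub> T y) (\<nu> (inv\<^bsub>B\<^esub> T x) ?l)))
        = S (\<nu> (inv\<^bsub>B\<^esub> T a) (\<nu> (inv\<^bsub>B\<^esub> T y) (\<nu> (inv\<^bsub>B\<^esub> T x) ?r)))"
      using coc(2)[of "T x" "T y" "T a"] \<tau>\<^sub>2[of x "y \<otimes>\<^bsub>A\<^esub> \<beta> (T y) a"] \<tau>\<^sub>2[of "x \<otimes>\<^bsub>A\<^esub> \<beta> (T x) y" a] that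
      by (simp add: \<tau>\<^sub>2 expand sigma_T_S B.m_assoc L.m_ac)
    \<comment> \<open>\<open>S\<close> is cancelled by injectivity, then the three automorphisms are
      undone from the inside out.\<close>
    then have "\<nu> (T x) (\<nu> (T y) (\<nu> (T a) (\<nu> (inv\<^bsub>B\<^esub> T a) (\<nu> (inv\<^bsub>B\<^esub> T y) (\<nu> (inv\<^bsub>B\<^esub> T x) ?l)))))
        = \<nu> (T x) (\<nu> (T y) (\<nu> (T a) (\<nu> (inv\<^bsub>B\<^esub> T a) (\<nu> (inv\<^bsub>B\<^esub> T y) (\<nu> (inv\<^bsub>B\<^esub> T x) ?r)))))"
      using that by (subst (asm) S_inject) simp_all
    then show ?thesis
      using that by simp
  qed
  moreover have "h (x, a \<otimes>\<^bsub>A\<^esub> a') \<cdot> \<nu> (T x) (\<tau>\<^sub>1 (a, a')) \<cdot> \<tau>\<^sub>1 (x, \<beta> (T x) a')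
      = \<tau>\<^sub>1 (x \<otimes>\<^bsub>A\<^esub> \<beta> (T x) a, \<beta> (T x) a') \<cdot> \<mu> (\<beta> (T x) a') (h (x, a)) \<cdot> h (x, a')"
    if "x \<in> carrier A" "a \<in> carrier A" "a' \<in> carrier A" for x a a'
    \<comment> \<open>The clause \<open>\<gamma>\<^sub>2 = 1\<close> at b = T x, corrected by the
      cocycle identity because h differs from \<rho> by values of
      \<open>\<tau>\<^sub>1\<close>.\<close>
    by (rule K.eq_by_factors2[OF coc(4)[of a a' "T x"] coc(1)[of x "\<beta> (T x) a" "\<beta> (T x) a'"]])
      (use that in \<open>simp_all add: h expand K.m_ac\<close>)
  ultimately show ?thesis
    using assms(1) brace_part_closed[OF assms(1)]
    by (simp add: brace_cocycle_def rrb_cocycle_def flip: h_def)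
qed

text \<open>Trivial \<open>\<tau>\<^sub>1\<close> and h leave \<chi> as the only freedom: h = 1
  expresses \<rho> through \<chi>, and it makes the \<open>S\<close> term of
  \<open>\<gamma>\<^sub>3\<close> trivial, so that this clause writes \<open>\<tau>\<^sub>2\<close>
  as a boundary.\<close>

lemma bdry1_of_trivial_brace_part:
  assumes "rrb_cocycle \<tau>\<^sub>1 \<tau>\<^sub>2 \<rho> \<chi>"
    and \<tau>\<^sub>1: "\<And>x y. x \<in> carrier A \<Longrightarrow> y \<in> carrier A \<Longrightarrow> \<tau>\<^sub>1 (x, y) = \<one>\<^bsub>K\<^esub>"
    and h: "\<And>x y. x \<in> carrier A \<Longrightarrow> y \<in> carrier A \<Longrightarrow> brace_part \<tau>\<^sub>1 \<rho> \<chi> (x, y) = \<one>\<^bsub>K\<^esub>"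
  shows "(\<tau>\<^sub>1, \<tau>\<^sub>2, \<rho>, \<chi>) = bdry1_RRB (A, B, \<beta>, T) (K, L, \<alpha>, S) (\<nu>, \<mu>, \<sigma>, f)
    (\<lambda>a\<in>carrier A. \<one>\<^bsub>K\<^esub>, \<lambda>b\<in>carrier B. inv\<^bsub>L\<^esub> \<chi> (T_inv b))"
proof -
  note [simp] = rrb_cocycleD[OF assms(1)]
  have ext: "\<tau>\<^sub>1 \<in> extensional (carrier A \<times> carrier A)" "\<tau>\<^sub>2 \<in> extensional (carrier B \<times> carrier B)"
    "\<rho> \<in> extensional (carrier A \<times> carrier B)" "\<chi> \<in> extensional (carrier A)"
    using assms(1) by (auto simp: rrb_cocycle_def mu.is_cocycle_def sig.is_cocycle_def
        intro: extensional_cochains1 extensional_cochains2)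
  have "\<tau>\<^sub>1 = bdry1 A K \<mu> (\<lambda>a\<in>carrier A. \<one>\<^bsub>K\<^esub>)"
    by (rule extensionalityI[OF ext(1)]) (auto simp: bdry1_def \<tau>\<^sub>1)
  moreover have "\<tau>\<^sub>2 (x, y) = bdry1 B L \<sigma> (\<lambda>b\<in>carrier B. inv\<^bsub>L\<^esub> \<chi> (T_inv b)) (x, y)"
    if prems: "x \<in> carrier B" "y \<in> carrier B" for x y
  proof -
    obtain a b where ab: "a \<in> carrier A" "b \<in> carrier A" "x = T a" "y = T b"
      using prems[THEN T_surj] by blast
    have "\<rho> (b, T a) \<cdot> \<tau>\<^sub>1 (a, \<beta> (T a) b) \<cdot> \<nu> (T a) (f (\<chi> a) b) = \<one>\<^bsub>K\<^esub>"
      using h[of a b] ab by (simp add: brace_part_def K.m_ac)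
    with rrb_cocycle_eqs(5)[OF assms(1), of a b] ab
    have "\<chi> (a \<otimes>\<^bsub>A\<^esub> \<beta> (T a) b) = \<tau>\<^sub>2 (T a, T b) \<bullet> \<chi> b \<bullet> \<sigma> (T b) (\<chi> a)"
      by simp
    then show ?thesis
      using ab by (simp add: bdry1_def T_inv_mult sig.m_quot L.fraction_simps L.m_ac)
  qed
  then have "\<tau>\<^sub>2 = bdry1 B L \<sigma> (\<lambda>b\<in>carrier B. inv\<^bsub>L\<^esub> \<chi> (T_inv b))"
    by (intro extensionalityI[OF ext(2)]) (auto simp: bdry1_def)
  moreover have "\<rho> (a, b) = \<nu> b (f (inv\<^bsub>L\<^esub> \<chi> (T_inv b)) a)"
    if prems: "a \<in> carrier A" "b \<in> carrier B" for a b
  proof -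
    obtain x where x: "x \<in> carrier A" "b = T x"
      using prems(2)[THEN T_surj] by blast
    show ?thesis
      using h[of x a] x prems by (simp add: brace_part_def \<tau>\<^sub>1 expand fractions)
  qed
  then have "\<rho> = (\<lambda>(a, b)\<in>carrier A \<times> carrier B.
      \<nu> b (f ((\<lambda>b\<in>carrier B. inv\<^bsub>L\<^esub> \<chi> (T_inv b)) b) a \<cdot> (\<lambda>a\<in>carrier A. \<one>\<^bsub>K\<^esub>) a)
        \<cdot> inv\<^bsub>K\<^esub> ((\<lambda>a\<in>carrier A. \<one>\<^bsub>K\<^esub>) (\<beta> b a)))"
    by (intro extensionalityI[OF ext(3)]) auto
  moreover have "\<chi> = (\<lambda>a\<in>carrier A. S ((inv\<^bsub>AutoGroup K\<^esub> (\<nu> (T a))) ((\<lambda>a\<in>carrier A. \<one>\<^bsub>K\<^esub>) a))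
      \<bullet> inv\<^bsub>L\<^esub> ((\<lambda>b\<in>carrier B. inv\<^bsub>L\<^esub> \<chi> (T_inv b)) (T a)))"
    by (intro extensionalityI[OF ext(4)]) auto
  ultimately show ?thesis
    by simp
qed

section \<open>Comparison of cocycles and coboundaries\<close>

lemmas comm_group_cochains_simps =
  comm_group_cochains[OF K.comm_group_axioms] comm_group_cochains[OF L.comm_group_axioms]

abbreviation "ZR \<equiv> Z2_RRB (A, B, \<beta>, T) (K, L, \<alpha>, S) (\<nu>, \<mu>, \<sigma>, f)"
abbreviation "BR \<equiv> B2_RRB (A, B, \<beta>, T) (K, L, \<alpha>, S) (\<nu>, \<mu>, \<sigma>, f)"
abbreviation "C1 \<equiv> C1_RRB (A, B, \<beta>, T) (K, L, \<alpha>, S)"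
abbreviation "C2 \<equiv> C2_RRB (A, B, \<beta>, T) (K, L, \<alpha>, S)"
abbreviation "d1 \<equiv> bdry1_RRB (A, B, \<beta>, T) (K, L, \<alpha>, S) (\<nu>, \<mu>, \<sigma>, f)"
abbreviation "ZN \<equiv> Z2_N (induced_brace (A, B, \<beta>, T)) (induced_brace (K, L, \<alpha>, S))
  (induced_action (A, B, \<beta>, T) (K, L, \<alpha>, S) (\<nu>, \<mu>, \<sigma>, f))"
abbreviation "BN \<equiv> B2_N (induced_brace (A, B, \<beta>, T)) (induced_brace (K, L, \<alpha>, S))
  (induced_action (A, B, \<beta>, T) (K, L, \<alpha>, S) (\<nu>, \<mu>, \<sigma>, f))"

section \<open>Groups of cochains and quotients of cocycles\<close>

lemma comm_group_C1: "comm_group C1"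
  by (simp add: cochains1_def comm_group_DirProd comm_group_cochains_simps)

lemma comm_group_C2: "comm_group C2"
  by (simp add: cochains1_def cochains2_def comm_group_DirProd comm_group_cochains_simps)

lemma rrb_cocycle_in_C2: "rrb_cocycle \<tau>\<^sub>1 \<tau>\<^sub>2 \<rho> \<chi> \<Longrightarrow> (\<tau>\<^sub>1, \<tau>\<^sub>2, \<rho>, \<chi>) \<in> carrier C2"
  by (simp add: rrb_cocycle_def mu.is_cocycle_def sig.is_cocycle_def)

lemma div_C2:
  assumes "(\<tau>\<^sub>1, \<tau>\<^sub>2, \<rho>, \<chi>) \<in> carrier C2" "(\<tau>\<^sub>1', \<tau>\<^sub>2', \<rho>', \<chi>') \<in> carrier C2"
  shows "(\<tau>\<^sub>1, \<tau>\<^sub>2, \<rho>, \<chi>) \<otimes>\<^bsub>C2\<^esub> inv\<^bsub>C2\<^esub> (\<tau>\<^sub>1', \<tau>\<^sub>2', \<rho>', \<chi>')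
    = (\<lambda>x\<in>carrier A \<times> carrier A. \<tau>\<^sub>1 x \<cdot> inv\<^bsub>K\<^esub> \<tau>\<^sub>1' x, \<lambda>x\<in>carrier B \<times> carrier B. \<tau>\<^sub>2 x \<bullet> inv\<^bsub>L\<^esub> \<tau>\<^sub>2' x,
       \<lambda>x\<in>carrier A \<times> carrier B. \<rho> x \<cdot> inv\<^bsub>K\<^esub> \<rho>' x, \<lambda>x\<in>carrier A. \<chi> x \<bullet> inv\<^bsub>L\<^esub> \<chi>' x)"
  using assms
  by (simp add: cochains1_def cochains2_def inv_DirProd DirProd_group comm_group.axioms(2)
      comm_group_cochains_simps div_cochains K.comm_group_axioms L.comm_group_axioms)

text \<open>All operations in the clauses are homomorphisms of abelian groups. Each clause for the
  quotient is thus the clause for the first cocycle multiplied by the reversed clause for the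
  second.\<close>

lemma rrb_cocycle_div:
  assumes "rrb_cocycle \<tau>\<^sub>1 \<tau>\<^sub>2 \<rho> \<chi>" "rrb_cocycle \<tau>\<^sub>1' \<tau>\<^sub>2' \<rho>' \<chi>'"
  shows "rrb_cocycle (\<lambda>x\<in>carrier A \<times> carrier A. \<tau>\<^sub>1 x \<cdot> inv\<^bsub>K\<^esub> \<tau>\<^sub>1' x)
    (\<lambda>x\<in>carrier B \<times> carrier B. \<tau>\<^sub>2 x \<bullet> inv\<^bsub>L\<^esub> \<tau>\<^sub>2' x)
    (\<lambda>x\<in>carrier A \<times> carrier B. \<rho> x \<cdot> inv\<^bsub>K\<^esub> \<rho>' x) (\<lambda>x\<in>carrier A. \<chi> x \<bullet> inv\<^bsub>L\<^esub> \<chi>' x)"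
    (is "rrb_cocycle ?\<tau>\<^sub>1 ?\<tau>\<^sub>2 ?\<rho> ?\<chi>")
proof -
  note [simp] = rrb_cocycleD[OF assms(1)] rrb_cocycleD[OF assms(2)]
  note e = rrb_cocycle_eqs[OF assms(1)] and e' = rrb_cocycle_eqs[OF assms(2)]
  have "?\<tau>\<^sub>1 \<in> carrier (cochains2 A A K)" "?\<tau>\<^sub>2 \<in> carrier (cochains2 B B L)"
    "?\<rho> \<in> carrier (cochains2 A B K)" "?\<chi> \<in> carrier (cochains1 A L)"
    by (auto simp: cochains1_def cochains2_def carrier_cochains)
  moreover have "?\<tau>\<^sub>1 (y, z) \<cdot> ?\<tau>\<^sub>1 (x, y \<otimes>\<^bsub>A\<^esub> z) = ?\<tau>\<^sub>1 (x \<otimes>\<^bsub>A\<^esub> y, z) \<cdot> \<mu> z (?\<tau>\<^sub>1 (x, y))"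
    if "x \<in> carrier A" "y \<in> carrier A" "z \<in> carrier A" for x y z
    by (rule K.eq_by_factors2[OF e(1)[OF that] e'(1)[OF that, symmetric]])
      (use that in \<open>simp_all add: mu.m_quot K.fraction_simps K.m_ac\<close>)
  moreover have "?\<tau>\<^sub>2 (y, z) \<bullet> ?\<tau>\<^sub>2 (x, y \<otimes>\<^bsub>B\<^esub> z) = ?\<tau>\<^sub>2 (x \<otimes>\<^bsub>B\<^esub> y, z) \<bullet> \<sigma> z (?\<tau>\<^sub>2 (x, y))"
    if "x \<in> carrier B" "y \<in> carrier B" "z \<in> carrier B" for x y z
    by (rule L.eq_by_factors2[OF e(2)[OF that] e'(2)[OF that, symmetric]])
      (use that in \<open>simp_all add: sig.m_quot L.fraction_simps L.m_ac\<close>)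
  moreover have "?\<rho> (a, b\<^sub>1 \<otimes>\<^bsub>B\<^esub> b\<^sub>2) \<cdot> \<nu> (b\<^sub>1 \<otimes>\<^bsub>B\<^esub> b\<^sub>2) (f (?\<tau>\<^sub>2 (b\<^sub>1, b\<^sub>2)) a) = ?\<rho> (\<beta> b\<^sub>2 a, b\<^sub>1) \<cdot> \<nu> b\<^sub>1 (?\<rho> (a, b\<^sub>2))"
    if "a \<in> carrier A" "b\<^sub>1 \<in> carrier B" "b\<^sub>2 \<in> carrier B" for a b\<^sub>1 b\<^sub>2
    by (rule K.eq_by_factors2[OF e(3)[OF that] e'(3)[OF that, symmetric]])
      (use that in \<open>simp_all add: nu_quot f_quot K.fraction_simps L.inv_eq_quot L.mult_quot K.m_ac\<close>)
  moreover have "?\<rho> (a\<^sub>1 \<otimes>\<^bsub>A\<^esub> a\<^sub>2, b) \<cdot> \<nu> b (?\<tau>\<^sub>1 (a\<^sub>1, a\<^sub>2))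
      = \<mu> (\<beta> b a\<^sub>2) (?\<rho> (a\<^sub>1, b)) \<cdot> ?\<rho> (a\<^sub>2, b) \<cdot> ?\<tau>\<^sub>1 (\<beta> b a\<^sub>1, \<beta> b a\<^sub>2)"
    if "a\<^sub>1 \<in> carrier A" "a\<^sub>2 \<in> carrier A" "b \<in> carrier B" for a\<^sub>1 a\<^sub>2 b
    by (rule K.eq_by_factors2[OF e(4)[OF that] e'(4)[OF that, symmetric]])
      (use that in \<open>simp_all add: nu_quot mu.m_quot K.fraction_simps K.m_ac\<close>)
  moreover have "S (\<nu> (inv\<^bsub>B\<^esub> (T a\<^sub>1 \<otimes>\<^bsub>B\<^esub> T a\<^sub>2))
        (?\<rho> (a\<^sub>2, T a\<^sub>1) \<cdot> ?\<tau>\<^sub>1 (a\<^sub>1, \<beta> (T a\<^sub>1) a\<^sub>2) \<cdot> \<nu> (T a\<^sub>1) (f (?\<chi> a\<^sub>1) a\<^sub>2)))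
          \<bullet> ?\<chi> (a\<^sub>1 \<otimes>\<^bsub>A\<^esub> \<beta> (T a\<^sub>1) a\<^sub>2)
        = ?\<tau>\<^sub>2 (T a\<^sub>1, T a\<^sub>2) \<bullet> ?\<chi> a\<^sub>2 \<bullet> \<sigma> (T a\<^sub>2) (?\<chi> a\<^sub>1)"
    if "a\<^sub>1 \<in> carrier A" "a\<^sub>2 \<in> carrier A" for a\<^sub>1 a\<^sub>2
    by (rule L.eq_by_factors2[OF e(5)[OF that] e'(5)[OF that, symmetric]])
      (use that in \<open>simp_all add: nu_quot sig.m_quot f_quot nu_mult S_mult S_quot fractions\<close>)
  ultimately show ?thesis
    by (simp add: rrb_cocycle_def mu.is_cocycle_def sig.is_cocycle_def)
qed

lemma brace_part_div:
  assumes "rrb_cocycle \<tau>\<^sub>1 \<tau>\<^sub>2 \<rho> \<chi>" "rrb_cocycle \<tau>\<^sub>1' \<tau>\<^sub>2' \<rho>' \<chi>'"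
  shows "brace_part (\<lambda>x\<in>carrier A \<times> carrier A. \<tau>\<^sub>1 x \<cdot> inv\<^bsub>K\<^esub> \<tau>\<^sub>1' x)
      (\<lambda>x\<in>carrier A \<times> carrier B. \<rho> x \<cdot> inv\<^bsub>K\<^esub> \<rho>' x) (\<lambda>x\<in>carrier A. \<chi> x \<bullet> inv\<^bsub>L\<^esub> \<chi>' x)
    = (\<lambda>x\<in>carrier A \<times> carrier A. brace_part \<tau>\<^sub>1 \<rho> \<chi> x \<cdot> inv\<^bsub>K\<^esub> brace_part \<tau>\<^sub>1' \<rho>' \<chi>' x)"
proof -
  note [simp] = rrb_cocycleD[OF assms(1)] rrb_cocycleD[OF assms(2)]
  show ?thesis
    by (auto simp: brace_part_def restrict_def fun_eq_iff)
      (simp_all add: nu_quot f_quot nu_mult K.fraction_simps L.inv_eq_quot L.mult_quot K.m_ac)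
qed

section \<open>The comparison homomorphism on cocycles\<close>

abbreviation "CN \<equiv> cochains2 A A K \<times>\<times> cochains2 A A K"

definition Phi :: "('a, 'b, 'k, 'l) cochain2_rrb \<Rightarrow> ('a, 'k) cochain2_N" where
  "Phi = (\<lambda>(\<tau>\<^sub>1, \<tau>\<^sub>2, \<rho>, \<chi>). (\<tau>\<^sub>1, brace_part \<tau>\<^sub>1 \<rho> \<chi>))"

lemma Phi_simp [simp]: "Phi (\<tau>\<^sub>1, \<tau>\<^sub>2, \<rho>, \<chi>) = (\<tau>\<^sub>1, brace_part \<tau>\<^sub>1 \<rho> \<chi>)"
  by (simp add: Phi_def)

lemma comm_group_CN: "comm_group CN"
  by (simp add: cochains2_def comm_group_DirProd comm_group_cochains_simps)

lemma div_CN: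
  assumes "(g, h) \<in> carrier CN" "(g', h') \<in> carrier CN"
  shows "(g, h) \<otimes>\<^bsub>CN\<^esub> inv\<^bsub>CN\<^esub> (g', h')
    = (\<lambda>x\<in>carrier A \<times> carrier A. g x \<cdot> inv\<^bsub>K\<^esub> g' x, \<lambda>x\<in>carrier A \<times> carrier A. h x \<cdot> inv\<^bsub>K\<^esub> h' x)"
  using assms
  by (simp add: cochains2_def inv_DirProd DirProd_group comm_group.axioms(2)
      comm_group_cochains_simps div_cochains K.comm_group_axioms)

lemma d1_in_ZR: "z \<in> carrier C1 \<Longrightarrow> d1 z \<in> carrier ZR"
  by (cases z) (simp add: Z2_RRB_iff rrb_cocycle_bdry1 del: inv_nu)

lemma ZR_eq: "ZR = C2\<lparr>carrier := carrier ZR\<rparr>"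
  by (simp add: Z2_RRB_def)

lemma ZR_cases:
  assumes "z \<in> carrier ZR"
  obtains \<tau>\<^sub>1 \<tau>\<^sub>2 \<rho> \<chi> where "z = (\<tau>\<^sub>1, \<tau>\<^sub>2, \<rho>, \<chi>)" "rrb_cocycle \<tau>\<^sub>1 \<tau>\<^sub>2 \<rho> \<chi>"
  using assms by (cases z) (auto simp: Z2_RRB_iff)

lemma subgroup_ZR: "subgroup (carrier ZR) C2"
proof -
  interpret C1: comm_group C1 by (rule comm_group_C1)
  interpret C2: comm_group C2 by (rule comm_group_C2)
  show ?thesis
  proof (rule C2.subgroup_divI)
    show "carrier ZR \<subseteq> carrier C2"
      by (metis ZR_cases rrb_cocycle_in_C2 subsetI)
    show "carrier ZR \<noteq> {}"
      using d1_in_ZR[OF C1.one_closed] by blast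
    show "x \<otimes>\<^bsub>C2\<^esub> inv\<^bsub>C2\<^esub> y \<in> carrier ZR" if "x \<in> carrier ZR" "y \<in> carrier ZR" for x y
      using that by (elim ZR_cases)
        (simp only: div_C2 rrb_cocycle_in_C2 Z2_RRB_iff rrb_cocycle_div)
  qed
qed

lemma comm_group_ZR: "comm_group ZR"
  by (subst ZR_eq) (rule comm_group.comm_group_subgroup[OF comm_group_C2 subgroup_ZR])

lemma div_ZR:
  assumes "rrb_cocycle \<tau>\<^sub>1 \<tau>\<^sub>2 \<rho> \<chi>" "rrb_cocycle \<tau>\<^sub>1' \<tau>\<^sub>2' \<rho>' \<chi>'"
  shows "(\<tau>\<^sub>1, \<tau>\<^sub>2, \<rho>, \<chi>) \<otimes>\<^bsub>ZR\<^esub> inv\<^bsub>ZR\<^esub> (\<tau>\<^sub>1', \<tau>\<^sub>2', \<rho>', \<chi>')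
    = (\<lambda>x\<in>carrier A \<times> carrier A. \<tau>\<^sub>1 x \<cdot> inv\<^bsub>K\<^esub> \<tau>\<^sub>1' x, \<lambda>x\<in>carrier B \<times> carrier B. \<tau>\<^sub>2 x \<bullet> inv\<^bsub>L\<^esub> \<tau>\<^sub>2' x,
       \<lambda>x\<in>carrier A \<times> carrier B. \<rho> x \<cdot> inv\<^bsub>K\<^esub> \<rho>' x, \<lambda>x\<in>carrier A. \<chi> x \<bullet> inv\<^bsub>L\<^esub> \<chi>' x)"
proof -
  have x: "(\<tau>\<^sub>1, \<tau>\<^sub>2, \<rho>, \<chi>) \<in> carrier ZR" and y: "(\<tau>\<^sub>1', \<tau>\<^sub>2', \<rho>', \<chi>') \<in> carrier ZR"
    using assms by (simp_all only: Z2_RRB_iff)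
  show ?thesis
    unfolding group.div_subgroup[OF comm_group.axioms(2)[OF comm_group_C2] subgroup_ZR x y, folded ZR_eq]
    by (rule div_C2[OF assms[THEN rrb_cocycle_in_C2]])
qed

lemma Phi_in_CN: "z \<in> carrier ZR \<Longrightarrow> Phi z \<in> carrier CN"
  by (elim ZR_cases, frule rrb_cocycle_in_C2) (simp add: brace_part_closed)

lemma Phi_hom_CN: "Phi \<in> hom ZR CN"
proof (rule hom_divI)
  show "Phi (x \<otimes>\<^bsub>ZR\<^esub> inv\<^bsub>ZR\<^esub> y) = Phi x \<otimes>\<^bsub>CN\<^esub> inv\<^bsub>CN\<^esub> Phi y"
    if xy: "x \<in> carrier ZR" "y \<in> carrier ZR" for x y
  proof -
    obtain a b c d where x: "x = (a, b, c, d)" "rrb_cocycle a b c d"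
      using xy(1) by (rule ZR_cases)
    obtain a' b' c' d' where y: "y = (a', b', c', d')" "rrb_cocycle a' b' c' d'"
      using xy(2) by (rule ZR_cases)
    have "(a, brace_part a c d) \<in> carrier CN" "(a', brace_part a' c' d') \<in> carrier CN"
      using xy[THEN Phi_in_CN] by (simp_all only: x y Phi_simp)
    then show ?thesis
      by (simp only: x(1) y(1) div_ZR[OF x(2) y(2)] brace_part_div[OF x(2) y(2)] Phi_simp div_CN)
  qed
qed (use comm_group_ZR comm_group_CN Phi_in_CN in \<open>auto simp: comm_group_def\<close>)

lemma trivial_cochain_in_C1:
  assumes "\<theta> \<in> carrier (cochains1 A K)"
  shows "(\<theta>, \<lambda>b\<in>carrier B. \<one>\<^bsub>L\<^esub>) \<in> carrier C1"
  using assms by (auto simp: cochains1_def carrier_cochains)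

text \<open>This cochain is used twice: to remove \<chi> from a cocycle, and to exhibit elements of
  the kernel of \<open>Phi\<close> as coboundaries. It is normalised since \<open>T_inv\<close>
  preserves the identity.\<close>

lemma T_inv_cochain_in_C1:
  assumes "\<chi> \<in> carrier (cochains1 A L)"
  shows "(\<lambda>a\<in>carrier A. \<one>\<^bsub>K\<^esub>, \<lambda>b\<in>carrier B. inv\<^bsub>L\<^esub> \<chi> (T_inv b)) \<in> carrier C1"
  using cochains1D[OF assms] by (auto simp: cochains1_def carrier_cochains)

lemma Phi_d1:
  assumes "(\<theta>\<^sub>1, \<theta>\<^sub>2) \<in> carrier C1"
  shows "Phi (d1 (\<theta>\<^sub>1, \<theta>\<^sub>2)) = (bdry1 A K \<mu> \<theta>\<^sub>1,
    \<lambda>(a\<^sub>1, a\<^sub>2)\<in>carrier A \<times> carrier A. \<mu> (\<beta> (T a\<^sub>1) a\<^sub>2) (\<theta>\<^sub>1 a\<^sub>1) \<cdot> \<nu> (T a\<^sub>1) (\<theta>\<^sub>1 a\<^sub>2)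
      \<cdot> \<nu> (T a\<^sub>1) (f (S (\<nu> (inv\<^bsub>B\<^esub> (T a\<^sub>1)) (\<theta>\<^sub>1 a\<^sub>1))) a\<^sub>2)
      \<cdot> inv\<^bsub>K\<^esub> (\<theta>\<^sub>1 (a\<^sub>1 \<otimes>\<^bsub>A\<^esub> \<beta> (T a\<^sub>1) a\<^sub>2)))"
proof -
  have *: "\<theta>\<^sub>1 \<in> carrier (cochains1 A K)" "\<theta>\<^sub>2 \<in> carrier (cochains1 B L)"
    using assms by auto
  have "brace_part \<tau> \<rho> \<chi> \<in> extensional (carrier A \<times> carrier A)" for \<tau> \<rho> \<chi>
    by (simp add: brace_part_def)
  then show ?thesis
    using brace_part_bdry1[OF *] by (auto intro!: extensionalityI[of _ "carrier A \<times> carrier A"] simp del: inv_nu)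
qed

text \<open>The brace conditions are known only for trivial \<chi>. The correcting coboundary lies
  in the kernel of the homomorphism \<open>Phi\<close>, so the general case has the same image as
  the special one.\<close>

lemma Phi_in_ZN:
  assumes "z \<in> carrier ZR"
  shows "Phi z \<in> carrier ZN"
proof -
  interpret ZR: comm_group ZR by (rule comm_group_ZR)
  obtain \<tau>\<^sub>1 \<tau>\<^sub>2 \<rho> \<chi> where z: "z = (\<tau>\<^sub>1, \<tau>\<^sub>2, \<rho>, \<chi>)" "rrb_cocycle \<tau>\<^sub>1 \<tau>\<^sub>2 \<rho> \<chi>"
    using assms by (rule ZR_cases)
  let ?\<theta> = "(\<lambda>a\<in>carrier A. \<one>\<^bsub>K\<^esub>, \<lambda>b\<in>carrier B. inv\<^bsub>L\<^esub> \<chi> (T_inv b))"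
  have \<chi>: "\<chi> \<in> carrier (cochains1 A L)"
    using z(2) by (simp add: rrb_cocycle_def)
  note [simp] = cochains1D(1)[OF \<chi>]
  note \<theta> = T_inv_cochain_in_C1[OF \<chi>]
  have w: "d1 ?\<theta> \<in> carrier ZR"
    by (rule d1_in_ZR[OF \<theta>])
  then obtain w\<^sub>1 w\<^sub>2 w\<^sub>3 w\<^sub>4 where w': "d1 ?\<theta> = (w\<^sub>1, w\<^sub>2, w\<^sub>3, w\<^sub>4)" "rrb_cocycle w\<^sub>1 w\<^sub>2 w\<^sub>3 w\<^sub>4"
    by (rule ZR_cases)
  have w4: "w\<^sub>4 a = \<chi> a" if "a \<in> carrier A" for a
    using w'(1) that by auto
  \<comment> \<open>By \<open>Phi_d1\<close> the image depends only on the first cochain, which is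
    trivial here.\<close>
  have one: "Phi (d1 ?\<theta>) = \<one>\<^bsub>CN\<^esub>"
    unfolding Phi_d1[OF \<theta>] by (auto simp: cochains2_def one_cochains bdry1_def fun_eq_iff restrict_def)
  obtain y\<^sub>1 y\<^sub>2 y\<^sub>3 y\<^sub>4 where y: "z \<otimes>\<^bsub>ZR\<^esub> inv\<^bsub>ZR\<^esub> d1 ?\<theta> = (y\<^sub>1, y\<^sub>2, y\<^sub>3, y\<^sub>4)" "rrb_cocycle y\<^sub>1 y\<^sub>2 y\<^sub>3 y\<^sub>4"
    using assms w by (meson ZR.inv_closed ZR.m_closed ZR_cases)
  have "y\<^sub>4 a = \<one>\<^bsub>L\<^esub>" if "a \<in> carrier A" for a
  proof -
    have "y\<^sub>4 = (\<lambda>x\<in>carrier A. \<chi> x \<bullet> inv\<^bsub>L\<^esub> w\<^sub>4 x)"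
      using y(1) unfolding z(1) w'(1) div_ZR[OF z(2) w'(2)] by simp
    then show ?thesis
      using that by (simp add: w4)
  qed
  then have "brace_cocycle y\<^sub>1 (brace_part y\<^sub>1 y\<^sub>3 y\<^sub>4)"
    by (rule brace_cocycle_of_rrb_cocycle[OF y(2)])
  then have "Phi (z \<otimes>\<^bsub>ZR\<^esub> inv\<^bsub>ZR\<^esub> d1 ?\<theta>) \<in> carrier ZN"
    unfolding y(1) by (simp only: Phi_simp Z2_N_iff)
  moreover have "Phi (z \<otimes>\<^bsub>ZR\<^esub> inv\<^bsub>ZR\<^esub> d1 ?\<theta>) = Phi z"
  proof -
    interpret CN: comm_group CN by (rule comm_group_CN)
    interpret group_hom ZR CN Phi
      using Phi_hom_CN by unfold_locales
    show ?thesis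
      using assms w by (simp add: one CN.r_one[OF hom_closed] del: bdry1_RRB.simps one_DirProd carrier_DirProd)
  qed
  ultimately show ?thesis
    by simp
qed

lemma Phi_image: "Phi ` carrier ZR = carrier ZN"
proof (intro equalityI subsetI)
  fix x assume x: "x \<in> carrier ZN"
  obtain g h where gh: "x = (g, h)" by (cases x)
  then have "brace_cocycle g h"
    using x by (simp only: Z2_N_iff)
  note * = rrb_cocycle_of_brace_cocycle[OF this]
  show "x \<in> Phi ` carrier ZR"
    unfolding gh by (rule image_eqI[OF _ iffD2[OF Z2_RRB_iff *(1)]]) (simp only: Phi_simp *(2))
qed (use Phi_in_ZN in blast)

lemma ZN_eq: "ZN = CN\<lparr>carrier := carrier ZN\<rparr>"
  by simp

lemma mult_ZN: "(\<otimes>\<^bsub>ZN\<^esub>) = (\<otimes>\<^bsub>CN\<^esub>)"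
  by simp

text \<open>An image of a homomorphism into \<open>CN\<close>; this replaces a pointwise check of
  closure for the three brace conditions.\<close>

lemma subgroup_ZN: "subgroup (carrier ZN) CN"
proof -
  interpret ZR: comm_group ZR by (rule comm_group_ZR)
  interpret CN: comm_group CN by (rule comm_group_CN)
  interpret group_hom ZR CN Phi
    using Phi_hom_CN by unfold_locales
  show ?thesis
    unfolding Phi_image[symmetric] by (rule img_is_subgroup)
qed

lemma comm_group_ZN: "comm_group ZN"
  by (subst ZN_eq) (rule comm_group.comm_group_subgroup[OF comm_group_CN subgroup_ZN])

lemma Phi_hom: "Phi \<in> hom ZR ZN"
proof (rule homI)
  show "Phi (x \<otimes>\<^bsub>ZR\<^esub> y) = Phi x \<otimes>\<^bsub>ZN\<^esub> Phi y" if "x \<in> carrier ZR" "y \<in> carrier ZR" for x y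
    unfolding mult_ZN by (rule hom_mult[OF Phi_hom_CN that])
qed (rule Phi_in_ZN)

section \<open>Coboundaries on both sides\<close>

lemma subgroup_BR: "subgroup BR ZR"
proof -
  interpret C1: comm_group C1 by (rule comm_group_C1)
  interpret ZR: comm_group ZR by (rule comm_group_ZR)
  have "d1 \<in> hom C1 ZR"
  proof (rule hom_divI)
    show "d1 (x \<otimes>\<^bsub>C1\<^esub> inv\<^bsub>C1\<^esub> y) = d1 x \<otimes>\<^bsub>ZR\<^esub> inv\<^bsub>ZR\<^esub> d1 y" if "x \<in> carrier C1" "y \<in> carrier C1" for x y
    proof -
      obtain p q where x: "x = (p, q)" by (cases x)
      obtain p' q' where y: "y = (p', q')" by (cases y)
      have pq: "p \<in> carrier (cochains1 A K)" "q \<in> carrier (cochains1 B L)"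
        "p' \<in> carrier (cochains1 A K)" "q' \<in> carrier (cochains1 B L)"
        using that by (auto simp: x y)
      note [simp] = pq[THEN cochains1D(1)]
      have div: "x \<otimes>\<^bsub>C1\<^esub> inv\<^bsub>C1\<^esub> y
          = (\<lambda>a\<in>carrier A. p a \<cdot> inv\<^bsub>K\<^esub> p' a, \<lambda>b\<in>carrier B. q b \<bullet> inv\<^bsub>L\<^esub> q' b)"
        using pq by (simp add: x y cochains1_def inv_DirProd comm_group.axioms(2)
          comm_group_cochains_simps div_cochains K.comm_group_axioms L.comm_group_axioms)
      show ?thesis
        unfolding div unfolding x y
        by (simp only: bdry1_RRB.simps div_ZR rrb_cocycle_bdry1 pq)
          (auto simp: bdry1_def fun_eq_iff restrict_def expand fractions)
    qed
  qed (use d1_in_ZR C1.is_group ZR.is_group in auto)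
  then interpret group_hom C1 ZR d1
    by unfold_locales
  show ?thesis
    unfolding B2_RRB_def by (rule img_is_subgroup)
qed

lemma BN_iff:
  "(g, h) \<in> BN \<longleftrightarrow> (g, h) \<in> carrier ZN \<and>
     (\<exists>\<theta>\<in>carrier A \<rightarrow> carrier K. \<forall>x\<in>carrier A. \<forall>y\<in>carrier A.
        g (x, y) = \<nu> (T (x \<otimes>\<^bsub>A\<^esub> y)) (inv\<^bsub>K\<^esub> (\<theta> (x \<otimes>\<^bsub>A\<^esub> y))) \<cdot> \<mu> y (\<nu> (T x) (\<theta> x)) \<cdot> \<nu> (T y) (\<theta> y) \<and>
        h (x, y) = \<nu> (T (x \<otimes>\<^bsub>A\<^esub> \<beta> (T x) y)) (inv\<^bsub>K\<^esub> (\<theta> (x \<otimes>\<^bsub>A\<^esub> \<beta> (T x) y)) \<cdot>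
          (\<mu> (\<beta> (inv\<^bsub>B\<^esub> T y) y) (\<nu> (inv\<^bsub>B\<^esub> T y) (\<theta> x)) \<cdot> \<nu> (inv\<^bsub>B\<^esub> T y) (f (S (\<theta> x)) y)) \<cdot> \<theta> y))"
  by (simp only: induced_brace.simps induced_action.simps B2_N.simps mem_Collect_eq case_prod_conv monoid.simps)

text \<open>The cochain of \<open>B2_N\<close> enters its formulas twisted by \<xi>. The
  substitution \<open>\<theta>\<^sub>1 a = \<nu> (T a) (\<theta> a)\<close> identifies them with the
  values of \<open>Phi\<close> on boundaries.\<close>

lemma Phi_d1_eq:
  assumes \<theta>: "\<theta> \<in> carrier A \<rightarrow> carrier K" "\<theta> \<one>\<^bsub>A\<^esub> = \<one>\<^bsub>K\<^esub>"
    and "x \<in> carrier A" "y \<in> carrier A"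
  shows "fst (Phi (d1 (\<lambda>a\<in>carrier A. \<nu> (T a) (\<theta> a), \<lambda>b\<in>carrier B. \<one>\<^bsub>L\<^esub>))) (x, y)
      = \<nu> (T (x \<otimes>\<^bsub>A\<^esub> y)) (inv\<^bsub>K\<^esub> (\<theta> (x \<otimes>\<^bsub>A\<^esub> y))) \<cdot> \<mu> y (\<nu> (T x) (\<theta> x)) \<cdot> \<nu> (T y) (\<theta> y)" (is ?g)
    and "snd (Phi (d1 (\<lambda>a\<in>carrier A. \<nu> (T a) (\<theta> a), \<lambda>b\<in>carrier B. \<one>\<^bsub>L\<^esub>))) (x, y)
      = \<nu> (T (x \<otimes>\<^bsub>A\<^esub> \<beta> (T x) y)) (inv\<^bsub>K\<^esub> (\<theta> (x \<otimes>\<^bsub>A\<^esub> \<beta> (T x) y)) \<cdot>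
          (\<mu> (\<beta> (inv\<^bsub>B\<^esub> T y) y) (\<nu> (inv\<^bsub>B\<^esub> T y) (\<theta> x)) \<cdot> \<nu> (inv\<^bsub>B\<^esub> T y) (f (S (\<theta> x)) y)) \<cdot> \<theta> y)" (is ?h)
proof -
  have [simp]: "\<theta> a \<in> carrier K" if "a \<in> carrier A" for a
    using \<theta>(1) that by auto
  have "(\<lambda>a\<in>carrier A. \<nu> (T a) (\<theta> a)) \<in> carrier (cochains1 A K)"
    using \<theta>(2) by (auto simp: cochains1_def carrier_cochains)
  note * = Phi_d1[OF trivial_cochain_in_C1[OF this]]
  show ?g
    unfolding * fst_conv using assms(3,4) by (simp add: bdry1_def nu_quot K.fraction_simps K.m_ac)
  show ?h
    unfolding * snd_conv using assms(3,4) by (simp add: expand K.fraction_simps K.m_ac)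
qed

lemma BN_eq_image: "BN = Phi ` BR"
proof (intro equalityI subsetI)
  fix z assume z: "z \<in> BN"
  obtain g h where gh: "z = (g, h)" by (cases z)
  obtain \<theta> where \<theta>: "\<theta> \<in> carrier A \<rightarrow> carrier K" and
    g: "\<And>x y. x \<in> carrier A \<Longrightarrow> y \<in> carrier A \<Longrightarrow>
      g (x, y) = \<nu> (T (x \<otimes>\<^bsub>A\<^esub> y)) (inv\<^bsub>K\<^esub> (\<theta> (x \<otimes>\<^bsub>A\<^esub> y))) \<cdot> \<mu> y (\<nu> (T x) (\<theta> x)) \<cdot> \<nu> (T y) (\<theta> y)" and
    h: "\<And>x y. x \<in> carrier A \<Longrightarrow> y \<in> carrier A \<Longrightarrow>
      h (x, y) = \<nu> (T (x \<otimes>\<^bsub>A\<^esub> \<beta> (T x) y)) (inv\<^bsub>K\<^esub> (\<theta> (x \<otimes>\<^bsub>A\<^esub> \<beta> (T x) y)) \<cdot>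
          (\<mu> (\<beta> (inv\<^bsub>B\<^esub> T y) y) (\<nu> (inv\<^bsub>B\<^esub> T y) (\<theta> x)) \<cdot> \<nu> (inv\<^bsub>B\<^esub> T y) (f (S (\<theta> x)) y)) \<cdot> \<theta> y)"
    using z unfolding gh BN_iff by blast
  have coc: "brace_cocycle g h"
    using z unfolding gh BN_iff Z2_N_iff by blast
  have \<theta>1: "\<theta> \<one>\<^bsub>A\<^esub> \<in> carrier K"
    using \<theta> by auto
  \<comment> \<open>\<open>B2_N\<close> admits arbitrary maps, but at the identity its formula reads
    g(1, 1) = \<theta>(1), and \<open>g\<close> is normalised.\<close>
  have one: "\<theta> \<one>\<^bsub>A\<^esub> = \<one>\<^bsub>K\<^esub>"
    using g[of "\<one>\<^bsub>A\<^esub>" "\<one>\<^bsub>A\<^esub>"] brace_cocycle_eqs(3)[OF coc A.one_closed] \<theta>1 by simp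
  let ?\<theta> = "(\<lambda>a\<in>carrier A. \<nu> (T a) (\<theta> a), \<lambda>b\<in>carrier B. \<one>\<^bsub>L\<^esub>)"
  have "?\<theta> \<in> carrier C1"
    using \<theta> one by (intro trivial_cochain_in_C1) (auto simp: cochains1_def carrier_cochains intro!: nu_closed)
  moreover from this have "Phi (d1 ?\<theta>) \<in> carrier CN"
    by (intro Phi_in_CN d1_in_ZR)
  then have "fst (Phi (d1 ?\<theta>)) \<in> extensional (carrier A \<times> carrier A)"
    "snd (Phi (d1 ?\<theta>)) \<in> extensional (carrier A \<times> carrier A)"
    by (auto simp only: carrier_DirProd mem_Times_iff intro: extensional_cochains2)
  moreover have "g \<in> extensional (carrier A \<times> carrier A)" "h \<in> extensional (carrier A \<times> carrier A)"
    using coc by (auto simp: brace_cocycle_def mu.is_cocycle_def intro: extensional_cochains2)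
  ultimately have "g = fst (Phi (d1 ?\<theta>))" "h = snd (Phi (d1 ?\<theta>))"
    using Phi_d1_eq[OF \<theta> one] g h
    by (auto intro!: extensionalityI[of _ "carrier A \<times> carrier A"] simp del: bdry1_RRB.simps)
  then show "z \<in> Phi ` BR"
    unfolding gh B2_RRB_def using \<open>?\<theta> \<in> carrier C1\<close> by (auto simp del: bdry1_RRB.simps)
next
  fix z assume "z \<in> Phi ` BR"
  then obtain p q where pq: "(p, q) \<in> carrier C1" "z = Phi (d1 (p, q))"
    unfolding B2_RRB_def by auto
  \<comment> \<open>The inverse of the twist by \<nu> at \<open>T a\<close>.\<close>
  let ?\<theta> = "\<lambda>a. \<nu> (inv\<^bsub>B\<^esub> T a) (p a)"
  have p: "p \<in> carrier (cochains1 A K)"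
    using pq(1) by simp
  note [simp] = cochains1D[OF p]
  have \<theta>: "?\<theta> \<in> carrier A \<rightarrow> carrier K" "?\<theta> \<one>\<^bsub>A\<^esub> = \<one>\<^bsub>K\<^esub>"
    by auto
  have "(\<lambda>a\<in>carrier A. \<nu> (T a) (?\<theta> a)) = p"
    by (rule extensionalityI[of _ "carrier A"]) (use p in \<open>auto intro: extensional_cochains1\<close>)
  \<comment> \<open>The second cochain \<open>q\<close> may be replaced by the trivial one, as
    \<open>Phi_d1\<close> does not see it.\<close>
  then have z: "z = Phi (d1 (\<lambda>a\<in>carrier A. \<nu> (T a) (?\<theta> a), \<lambda>b\<in>carrier B. \<one>\<^bsub>L\<^esub>))"
    using pq Phi_d1[OF pq(1)] Phi_d1[OF trivial_cochain_in_C1[OF p]] by (simp only:)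
  obtain g h where gh: "z = (g, h)" by (cases z)
  have ZN: "z \<in> carrier ZN"
    unfolding pq(2) by (intro Phi_in_ZN d1_in_ZR pq)
  show "z \<in> BN"
    unfolding gh BN_iff
  proof (intro conjI bexI[of _ ?\<theta>] ballI)
    show "(g, h) \<in> carrier ZN"
      using ZN unfolding gh .
  next
    fix x y assume "x \<in> carrier A" "y \<in> carrier A"
    from Phi_d1_eq[OF \<theta> this, folded z, unfolded gh fst_conv snd_conv]
    show "g (x, y) = \<nu> (T (x \<otimes>\<^bsub>A\<^esub> y)) (inv\<^bsub>K\<^esub> (?\<theta> (x \<otimes>\<^bsub>A\<^esub> y))) \<cdot> \<mu> y (\<nu> (T x) (?\<theta> x)) \<cdot> \<nu> (T y) (?\<theta> y)"
      "h (x, y) = \<nu> (T (x \<otimes>\<^bsub>A\<^esub> \<beta> (T x) y)) (inv\<^bsub>K\<^esub> (?\<theta> (x \<otimes>\<^bsub>A\<^esub> \<beta> (T x) y)) \<cdot>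
          (\<mu> (\<beta> (inv\<^bsub>B\<^esub> T y) y) (\<nu> (inv\<^bsub>B\<^esub> T y) (?\<theta> x)) \<cdot> \<nu> (inv\<^bsub>B\<^esub> T y) (f (S (?\<theta> x)) y)) \<cdot> ?\<theta> y)"
      by (simp_all only:)
  qed (fact \<theta>(1))
qed

lemma subgroup_BN: "subgroup BN ZN"
proof -
  interpret ZR: comm_group ZR by (rule comm_group_ZR)
  interpret ZN: comm_group ZN by (rule comm_group_ZN)
  interpret group_hom ZR ZN Phi
    using Phi_hom by unfold_locales
  show ?thesis
    unfolding BN_eq_image by (rule subgroup_img_is_subgroup[OF subgroup_BR])
qed

text \<open>Coboundaries of braces are images of coboundaries, so modulo \<open>BR\<close> the
  cocycle \<open>z\<close> may be moved into the kernel of \<open>Phi\<close>, and that kernel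
  consists of coboundaries.\<close>

lemma Phi_in_BN_iff:
  assumes z: "z \<in> carrier ZR"
  shows "Phi z \<in> BN \<longleftrightarrow> z \<in> BR"
proof
  interpret ZR: comm_group ZR by (rule comm_group_ZR)
  interpret CN: comm_group CN by (rule comm_group_CN)
  interpret group_hom ZR CN Phi
    using Phi_hom_CN by unfold_locales
  interpret BR: subgroup BR ZR by (rule subgroup_BR)
  assume "Phi z \<in> BN"
  then obtain w where w: "w \<in> BR" "Phi z = Phi w"
    unfolding BN_eq_image by auto
  let ?y = "z \<otimes>\<^bsub>ZR\<^esub> inv\<^bsub>ZR\<^esub> w"
  have y: "?y \<in> carrier ZR"
    using z w(1) by auto
  then obtain a b c d where abcd: "?y = (a, b, c, d)" "rrb_cocycle a b c d"
    by (rule ZR_cases)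
  have "Phi ?y = \<one>\<^bsub>CN\<^esub>"
    using z w(1) hom_closed[of w] by (simp add: w(2) del: one_DirProd carrier_DirProd)
  then have "a = (\<lambda>x\<in>carrier A \<times> carrier A. \<one>\<^bsub>K\<^esub>)" "brace_part a c d = (\<lambda>x\<in>carrier A \<times> carrier A. \<one>\<^bsub>K\<^esub>)"
    unfolding abcd(1) Phi_simp one_DirProd cochains2_def one_cochains by (blast dest: Pair_inject)+
  then have "?y = d1 (\<lambda>a\<in>carrier A. \<one>\<^bsub>K\<^esub>, \<lambda>b\<in>carrier B. inv\<^bsub>L\<^esub> d (T_inv b))"
    unfolding abcd(1) by (intro bdry1_of_trivial_brace_part[OF abcd(2)]) simp_all
  moreover have "d \<in> carrier (cochains1 A L)"
    using rrb_cocycle_in_C2[OF abcd(2)] by simp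
  ultimately have "?y \<in> BR"
    unfolding B2_RRB_def by (auto intro!: T_inv_cochain_in_C1 simp del: C1_RRB.simps bdry1_RRB.simps)
  then have "?y \<otimes>\<^bsub>ZR\<^esub> w \<in> BR"
    using w(1) by (rule BR.m_closed)
  then show "z \<in> BR"
    using z w(1) by (simp add: ZR.m_assoc)
qed (unfold BN_eq_image, rule imageI)

section \<open>From cocycles to extensions and back\<close>

abbreviation "RA \<equiv> (A, B, \<beta>, T)"
abbreviation "RK \<equiv> (K, L, \<alpha>, S)"
abbreviation "ext \<equiv> cocycle_ext (A, B, \<beta>, T) (K, L, \<alpha>, S) (\<nu>, \<mu>, \<sigma>, f)"

abbreviation ext_action :: "('a \<times> 'b \<Rightarrow> 'k) \<Rightarrow> 'b \<times> 'l \<Rightarrow> 'a \<times> 'k \<Rightarrow> 'a \<times> 'k" where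
  "ext_action \<rho> \<equiv> \<lambda>(b, l). \<lambda>(a, k)\<in>carrier A \<times> carrier K. (\<beta> b a, \<rho> (a, b) \<cdot> \<nu> b (f l a \<cdot> k))"

abbreviation ext_operator :: "('a \<Rightarrow> 'l) \<Rightarrow> 'a \<times> 'k \<Rightarrow> 'b \<times> 'l" where
  "ext_operator \<chi> \<equiv> \<lambda>(a, k). (T a, \<chi> a \<bullet> S ((inv\<^bsub>AutoGroup K\<^esub> (\<nu> (T a))) k))"

lemma ext_eq:
  "ext (\<tau>\<^sub>1, \<tau>\<^sub>2, \<rho>, \<chi>) =
    ((cocycle_group A K \<mu> \<tau>\<^sub>1, cocycle_group B L \<sigma> \<tau>\<^sub>2, ext_action \<rho>, ext_operator \<chi>),
     (\<lambda>k. (\<one>\<^bsub>A\<^esub>, k), \<lambda>l. (\<one>\<^bsub>B\<^esub>, l)), (fst, fst))"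
  by (simp only: cocycle_ext.simps cocycle_group_def)

lemma alpha_trivial: "l \<in> carrier L \<Longrightarrow> k \<in> carrier K \<Longrightarrow> \<alpha> l k = k"
  using module unfolding rrb_module.simps trivial_rrb.simps by (simp add: one_AutoGroup)

text \<open>Each clause pays for one axiom: \<open>\<gamma>\<^sub>2 = 1\<close> makes the action
  multiplicative on the first group, \<open>\<gamma>\<^sub>1 = 1\<close> makes it multiplicative in
  the acting element, and \<open>\<gamma>\<^sub>3 = 1\<close> is the Rota-Baxter identity of the
  operator.\<close>

lemma rrb_group_ext:
  assumes z: "rrb_cocycle \<tau>\<^sub>1 \<tau>\<^sub>2 \<rho> \<chi>"
  shows "rrb_group (cocycle_group A K \<mu> \<tau>\<^sub>1, cocycle_group B L \<sigma> \<tau>\<^sub>2, ext_action \<rho>, ext_operator \<chi>)"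
proof -
  note [simp] = rrb_cocycleD[OF z]
  have H: "group (cocycle_group A K \<mu> \<tau>\<^sub>1)" and G: "group (cocycle_group B L \<sigma> \<tau>\<^sub>2)"
    using z by (simp_all add: rrb_cocycle_def mu.group_cocycle_group sig.group_cocycle_group)
  have "ext_action \<rho> \<in> hom (cocycle_group B L \<sigma> \<tau>\<^sub>2) (AutoGroup (cocycle_group A K \<mu> \<tau>\<^sub>1))"
  proof (rule hom_AutoGroupI[OF G H])
    fix g h\<^sub>1 h\<^sub>2
    assume gh: "g \<in> carrier (cocycle_group B L \<sigma> \<tau>\<^sub>2)" "h\<^sub>1 \<in> carrier (cocycle_group A K \<mu> \<tau>\<^sub>1)"
      "h\<^sub>2 \<in> carrier (cocycle_group A K \<mu> \<tau>\<^sub>1)"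
    obtain b l where g: "g = (b, l)" by (cases g)
    obtain a\<^sub>1 k\<^sub>1 where h\<^sub>1: "h\<^sub>1 = (a\<^sub>1, k\<^sub>1)" by (cases h\<^sub>1)
    obtain a\<^sub>2 k\<^sub>2 where h\<^sub>2: "h\<^sub>2 = (a\<^sub>2, k\<^sub>2)" by (cases h\<^sub>2)
    note [simp] = gh[unfolded g h\<^sub>1 h\<^sub>2, simplified]
    have "\<rho> (a\<^sub>1 \<otimes>\<^bsub>A\<^esub> a\<^sub>2, b) \<cdot> \<nu> b (f l (a\<^sub>1 \<otimes>\<^bsub>A\<^esub> a\<^sub>2) \<cdot> (\<mu> a\<^sub>2 k\<^sub>1 \<cdot> k\<^sub>2 \<cdot> \<tau>\<^sub>1 (a\<^sub>1, a\<^sub>2)))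
      = \<mu> (\<beta> b a\<^sub>2) (\<rho> (a\<^sub>1, b) \<cdot> \<nu> b (f l a\<^sub>1 \<cdot> k\<^sub>1)) \<cdot> (\<rho> (a\<^sub>2, b) \<cdot> \<nu> b (f l a\<^sub>2 \<cdot> k\<^sub>2))
        \<cdot> \<tau>\<^sub>1 (\<beta> b a\<^sub>1, \<beta> b a\<^sub>2)"
      by (rule K.eq_by_factors[OF rrb_cocycle_eqs(4)[OF z, of a\<^sub>1 a\<^sub>2 b]])
        (simp_all add: nu_mult nu_mu mu.m_mult f_mult_right K.m_ac)
    then show "ext_action \<rho> g (h\<^sub>1 \<otimes>\<^bsub>cocycle_group A K \<mu> \<tau>\<^sub>1\<^esub> h\<^sub>2)
        = ext_action \<rho> g h\<^sub>1 \<otimes>\<^bsub>cocycle_group A K \<mu> \<tau>\<^sub>1\<^esub> ext_action \<rho> g h\<^sub>2"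
      by (simp add: g h\<^sub>1 h\<^sub>2 beta_mult)
  next
    fix g\<^sub>1 g\<^sub>2 h
    assume gh: "g\<^sub>1 \<in> carrier (cocycle_group B L \<sigma> \<tau>\<^sub>2)" "g\<^sub>2 \<in> carrier (cocycle_group B L \<sigma> \<tau>\<^sub>2)"
      "h \<in> carrier (cocycle_group A K \<mu> \<tau>\<^sub>1)"
    obtain b\<^sub>1 l\<^sub>1 where g\<^sub>1: "g\<^sub>1 = (b\<^sub>1, l\<^sub>1)" by (cases g\<^sub>1)
    obtain b\<^sub>2 l\<^sub>2 where g\<^sub>2: "g\<^sub>2 = (b\<^sub>2, l\<^sub>2)" by (cases g\<^sub>2)
    obtain a k where h: "h = (a, k)" by (cases h)
    note [simp] = gh[unfolded g\<^sub>1 g\<^sub>2 h, simplified]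
    have "\<rho> (a, b\<^sub>1 \<otimes>\<^bsub>B\<^esub> b\<^sub>2) \<cdot> \<nu> (b\<^sub>1 \<otimes>\<^bsub>B\<^esub> b\<^sub>2) (f (\<sigma> b\<^sub>2 l\<^sub>1 \<bullet> l\<^sub>2 \<bullet> \<tau>\<^sub>2 (b\<^sub>1, b\<^sub>2)) a \<cdot> k)
      = \<rho> (\<beta> b\<^sub>2 a, b\<^sub>1) \<cdot> \<nu> b\<^sub>1 (f l\<^sub>1 (\<beta> b\<^sub>2 a) \<cdot> (\<rho> (a, b\<^sub>2) \<cdot> \<nu> b\<^sub>2 (f l\<^sub>2 a \<cdot> k)))"
      by (rule K.eq_by_factors[OF rrb_cocycle_eqs(3)[OF z, of a b\<^sub>1 b\<^sub>2]])
        (simp_all add: nu_mult nu_comp nu_f_sigma f_mult_left K.m_ac)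
    then show "ext_action \<rho> (g\<^sub>1 \<otimes>\<^bsub>cocycle_group B L \<sigma> \<tau>\<^sub>2\<^esub> g\<^sub>2) h = ext_action \<rho> g\<^sub>1 (ext_action \<rho> g\<^sub>2 h)"
      by (simp add: g\<^sub>1 g\<^sub>2 h beta_comp)
  qed auto
  moreover have "ext_operator \<chi> h\<^sub>1 \<otimes>\<^bsub>cocycle_group B L \<sigma> \<tau>\<^sub>2\<^esub> ext_operator \<chi> h\<^sub>2
      = ext_operator \<chi> (h\<^sub>1 \<otimes>\<^bsub>cocycle_group A K \<mu> \<tau>\<^sub>1\<^esub> ext_action \<rho> (ext_operator \<chi> h\<^sub>1) h\<^sub>2)"
    if hh: "h\<^sub>1 \<in> carrier (cocycle_group A K \<mu> \<tau>\<^sub>1)" "h\<^sub>2 \<in> carrier (cocycle_group A K \<mu> \<tau>\<^sub>1)" for h\<^sub>1 h\<^sub>2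
  proof -
    obtain x k where h\<^sub>1: "h\<^sub>1 = (x, k)" by (cases h\<^sub>1)
    obtain y k' where h\<^sub>2: "h\<^sub>2 = (y, k')" by (cases h\<^sub>2)
    note [simp] = hh[unfolded h\<^sub>1 h\<^sub>2, simplified]
    have "\<sigma> (T y) (\<chi> x \<bullet> S (\<nu> (inv\<^bsub>B\<^esub> T x) k)) \<bullet> (\<chi> y \<bullet> S (\<nu> (inv\<^bsub>B\<^esub> T y) k')) \<bullet> \<tau>\<^sub>2 (T x, T y)
      = \<chi> (x \<otimes>\<^bsub>A\<^esub> \<beta> (T x) y) \<bullet> S (\<nu> (inv\<^bsub>B\<^esub> (T x \<otimes>\<^bsub>B\<^esub> T y))
        (\<mu> (\<beta> (T x) y) k \<cdot> (\<rho> (y, T x) \<cdot> \<nu> (T x) (f (\<chi> x \<bullet> S (\<nu> (inv\<^bsub>B\<^esub> T x) k)) y \<cdot> k'))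
          \<cdot> \<tau>\<^sub>1 (x, \<beta> (T x) y)))"
      by (rule L.eq_by_factors[OF rrb_cocycle_eqs(5)[OF z, of x y, symmetric]])
        (simp_all add: expand sigma_T_S L.m_ac)
    then show ?thesis
      by (simp add: h\<^sub>1 h\<^sub>2)
  qed
  ultimately show ?thesis
    using H G by (auto simp: Pi_iff)
qed

lemma rrb_ext_ext:
  assumes z: "rrb_cocycle \<tau>\<^sub>1 \<tau>\<^sub>2 \<rho> \<chi>"
  shows "rrb_ext RA RK (ext (\<tau>\<^sub>1, \<tau>\<^sub>2, \<rho>, \<chi>))"
proof -
  note [simp] = rrb_cocycleD[OF z]
  have "rrb_hom RK (cocycle_group A K \<mu> \<tau>\<^sub>1, cocycle_group B L \<sigma> \<tau>\<^sub>2, ext_action \<rho>, ext_operator \<chi>)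
      (\<lambda>k. (\<one>\<^bsub>A\<^esub>, k), \<lambda>l. (\<one>\<^bsub>B\<^esub>, l))"
    unfolding rrb_hom.simps by (auto simp: hom_def alpha_trivial)
  moreover have "rrb_hom (cocycle_group A K \<mu> \<tau>\<^sub>1, cocycle_group B L \<sigma> \<tau>\<^sub>2, ext_action \<rho>, ext_operator \<chi>) RA
      (fst, fst)"
    unfolding rrb_hom.simps by (auto simp: hom_def)
  moreover have "inj_on (Pair \<one>\<^bsub>A\<^esub>) (carrier K)" "inj_on (Pair \<one>\<^bsub>B\<^esub>) (carrier L)"
    by (auto simp: inj_on_def)
  moreover have "fst ` carrier (cocycle_group A K \<mu> \<tau>\<^sub>1) = carrier A" "fst ` carrier (cocycle_group B L \<sigma> \<tau>\<^sub>2) = carrier B"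
    by auto
  moreover have "Pair \<one>\<^bsub>A\<^esub> ` carrier K = kernel (cocycle_group A K \<mu> \<tau>\<^sub>1) A fst"
    "Pair \<one>\<^bsub>B\<^esub> ` carrier L = kernel (cocycle_group B L \<sigma> \<tau>\<^sub>2) B fst"
    by (auto simp: kernel_def)
  ultimately show ?thesis
    unfolding ext_eq rrb_ext.simps using rrb_group_ext[OF z] by blast
qed

lemma rrb_ext_equiv_coboundary:
  assumes z: "rrb_cocycle \<tau>\<^sub>1 \<tau>\<^sub>2 \<rho> \<chi>" and pq: "(p, q) \<in> carrier C1"
  shows "rrb_ext_equiv RK (ext (d1 (p, q) \<otimes>\<^bsub>C2\<^esub> (\<tau>\<^sub>1, \<tau>\<^sub>2, \<rho>, \<chi>))) (ext (\<tau>\<^sub>1, \<tau>\<^sub>2, \<rho>, \<chi>))"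
proof -
  have pq': "p \<in> carrier (cochains1 A K)" "q \<in> carrier (cochains1 B L)"
    using pq by auto
  note [simp] = rrb_cocycleD[OF z] pq'[THEN cochains1D(1)] pq'[THEN cochains1D(2)]
  obtain t\<^sub>1 t\<^sub>2 r c where w: "d1 (p, q) \<otimes>\<^bsub>C2\<^esub> (\<tau>\<^sub>1, \<tau>\<^sub>2, \<rho>, \<chi>) = (t\<^sub>1, t\<^sub>2, r, c)"
    by (metis prod.exhaust)
  have [simp]: "t\<^sub>1 (x, y) = p y \<cdot> inv\<^bsub>K\<^esub> (p (x \<otimes>\<^bsub>A\<^esub> y)) \<cdot> \<mu> y (p x) \<cdot> \<tau>\<^sub>1 (x, y)"
    if "x \<in> carrier A" "y \<in> carrier A" for x y
    using w that by (auto simp: cochains2_def mult_cochains bdry1_def)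
  have [simp]: "t\<^sub>2 (x, y) = q y \<bullet> inv\<^bsub>L\<^esub> (q (x \<otimes>\<^bsub>B\<^esub> y)) \<bullet> \<sigma> y (q x) \<bullet> \<tau>\<^sub>2 (x, y)"
    if "x \<in> carrier B" "y \<in> carrier B" for x y
    using w that by (auto simp: cochains2_def mult_cochains bdry1_def)
  have [simp]: "r (a, b) = \<nu> b (f (q b) a \<cdot> p a) \<cdot> inv\<^bsub>K\<^esub> (p (\<beta> b a)) \<cdot> \<rho> (a, b)"
    if "a \<in> carrier A" "b \<in> carrier B" for a b
    using w that by (auto simp: cochains2_def mult_cochains bdry1_def)
  have [simp]: "c a = S (\<nu> (inv\<^bsub>B\<^esub> T a) (p a)) \<bullet> inv\<^bsub>L\<^esub> (q (T a)) \<bullet> \<chi> a"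
    if "a \<in> carrier A" for a
    using w that by (auto simp: cochains1_def mult_cochains)
  \<comment> \<open>Translation of the fibres by \<open>p\<close> and \<open>q\<close>: the boundary
    factors are precisely what it produces in the two products, the action and the operator.\<close>
  let ?\<psi> = "\<lambda>(a, k). (a, k \<cdot> p a)" and ?\<eta> = "\<lambda>(b, l). (b, l \<bullet> q b)"
  have "rrb_hom (cocycle_group A K \<mu> t\<^sub>1, cocycle_group B L \<sigma> t\<^sub>2, ext_action r, ext_operator c)
      (cocycle_group A K \<mu> \<tau>\<^sub>1, cocycle_group B L \<sigma> \<tau>\<^sub>2, ext_action \<rho>, ext_operator \<chi>) (?\<psi>, ?\<eta>)"
    unfolding rrb_hom.simps
    by (auto simp: hom_def expand fractions)
  moreover have "bij_betw ?\<psi> (carrier (cocycle_group A K \<mu> t\<^sub>1)) (carrier (cocycle_group A K \<mu> \<tau>\<^sub>1))"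
    by (rule bij_betw_byWitness[of _ "\<lambda>(a, k). (a, k \<cdot> inv\<^bsub>K\<^esub> p a)"]) (auto simp: K.m_assoc)
  moreover have "bij_betw ?\<eta> (carrier (cocycle_group B L \<sigma> t\<^sub>2)) (carrier (cocycle_group B L \<sigma> \<tau>\<^sub>2))"
    by (rule bij_betw_byWitness[of _ "\<lambda>(b, l). (b, l \<bullet> inv\<^bsub>L\<^esub> q b)"]) (auto simp: L.m_assoc)
  ultimately show ?thesis
    unfolding w ext_eq rrb_ext_equiv.simps by (intro exI[of _ ?\<psi>] exI[of _ ?\<eta>]) auto
qed

section \<open>Sections, their cocycles, and the composite on classes\<close>

abbreviation "MA \<equiv> induced_brace (A, B, \<beta>, T)"
abbreviation "MK \<equiv> induced_brace (K, L, \<alpha>, S)"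
abbreviation "act_N \<equiv> induced_action (A, B, \<beta>, T) (K, L, \<alpha>, S) (\<nu>, \<mu>, \<sigma>, f)"

text \<open>The class contains brace extensions other than the constructed one, with other middle
  operations. The isomorphism \<psi> transports a section back to A \<times> K, where its cocycle
  can be computed in coordinates.\<close>

lemma section_cocycle_eq:
  assumes z: "rrb_cocycle \<tau>\<^sub>1 \<tau>\<^sub>2 \<rho> \<chi>"
    and E: "brace_ext MA MK \<E>" and equiv: "brace_ext_equiv MK (induced_brace_ext (ext (\<tau>\<^sub>1, \<tau>\<^sub>2, \<rho>, \<chi>))) \<E>"
    and s: "normalised_section MA \<E> s"
  obtains \<theta> where "\<theta> \<in> carrier (cochains1 A K)"
    "section_cocycle MA MK \<E> s = Phi (d1 (\<theta>, \<lambda>b\<in>carrier B. \<one>\<^bsub>L\<^esub>)) \<otimes>\<^bsub>ZN\<^esub> Phi (\<tau>\<^sub>1, \<tau>\<^sub>2, \<rho>, \<chi>)"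
proof -
  note [simp] = rrb_cocycleD[OF z]
  obtain E Eo i p where \<E>: "\<E> = ((E, Eo), i, p)" by (metis prod.exhaust)
  let ?H = "cocycle_group A K \<mu> \<tau>\<^sub>1"
  let ?Ho = "snd (induced_brace (?H, cocycle_group B L \<sigma> \<tau>\<^sub>2, ext_action \<rho>, ext_operator \<chi>))"
  obtain \<psi> where \<psi>: "\<psi> \<in> hom ?H E" "\<psi> \<in> hom ?Ho Eo" "bij_betw \<psi> (carrier ?H) (carrier E)"
    "\<And>k. k \<in> carrier K \<Longrightarrow> \<psi> (\<one>\<^bsub>A\<^esub>, k) = i k" "\<And>h. h \<in> carrier ?H \<Longrightarrow> p (\<psi> h) = fst h"
    using equiv unfolding \<E> ext_eq induced_brace_ext.simps induced_brace.simps brace_ext_equiv.simps brace_hom.simps snd_conv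
    by blast
  have skew: "skew_left_brace (E, Eo)" and inj: "inj_on i (carrier K)"
    using E unfolding \<E> induced_brace.simps brace_ext.simps by blast+
  interpret E: group E
    using skew by simp
  interpret H: group ?H
    by (rule rrb_group_props(1)[OF rrb_group_ext[OF z]])
  have s: "\<And>a. a \<in> carrier A \<Longrightarrow> s a \<in> carrier E" "\<And>a. a \<in> carrier A \<Longrightarrow> p (s a) = a" "s \<one>\<^bsub>A\<^esub> = \<one>\<^bsub>E\<^esub>"
    using s unfolding \<E> induced_brace.simps normalised_section.simps by blast+
  \<comment> \<open>The K-coordinate of the transported section; its A-coordinate is fixed because
    \<psi> respects the projections.\<close>
  define \<theta> where "\<theta> = (\<lambda>a\<in>carrier A. snd (inv_into (carrier ?H) \<psi> (s a)))"
  note b = bij_betw_inv_into_simps[OF \<psi>(3)]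
  have \<theta>_closed [simp]: "\<theta> a \<in> carrier K" and s_eq: "s a = \<psi> (a, \<theta> a)" if "a \<in> carrier A" for a
  proof -
    let ?h = "inv_into (carrier ?H) \<psi> (s a)"
    have "?h \<in> carrier ?H" "\<psi> ?h = s a"
      using b(1,2)[OF s(1)[OF that]] by auto
    moreover from this have "fst ?h = a"
      using \<psi>(5)[of ?h] s(2)[OF that] by simp
    ultimately have "?h = (a, \<theta> a)" "?h \<in> carrier ?H" "\<psi> ?h = s a"
      using that by (auto simp: \<theta>_def prod_eq_iff)
    then show "\<theta> a \<in> carrier K" "s a = \<psi> (a, \<theta> a)"
      by auto
  qed
  have "inv_into (carrier ?H) \<psi> (s \<one>\<^bsub>A\<^esub>) = \<one>\<^bsub>?H\<^esub>"
    using b(3)[OF H.one_closed] hom_one[OF \<psi>(1) H.is_group E.is_group] by (simp only: s(3))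
  then have \<theta>_one [simp]: "\<theta> \<one>\<^bsub>A\<^esub> = \<one>\<^bsub>K\<^esub>"
    by (simp add: \<theta>_def)
  have \<theta>: "\<theta> \<in> carrier (cochains1 A K)"
    by (auto simp: cochains1_def carrier_cochains) (auto simp: \<theta>_def)
  \<comment> \<open>Reads off coordinates: \<open>(a, \<theta> a \<cdot> k)\<close> is
    \<open>(a, \<theta> a)\<close> times \<open>(\<one>, k)\<close>, as
    \<open>\<tau>\<^sub>1\<close> is normalised, so left division by \<open>s a\<close> and
    inversion of \<open>i\<close> return k.\<close>
  have shift: "inv_into (carrier K) i (inv\<^bsub>E\<^esub> (s a) \<otimes>\<^bsub>E\<^esub> \<psi> (a, \<theta> a \<cdot> k)) = k" if "a \<in> carrier A" "k \<in> carrier K" for a k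
  proof -
    have "\<psi> (a, \<theta> a \<cdot> k) = \<psi> ((a, \<theta> a) \<otimes>\<^bsub>?H\<^esub> (\<one>\<^bsub>A\<^esub>, k))"
      using that by simp
    also have "\<dots> = s a \<otimes>\<^bsub>E\<^esub> i k"
      unfolding s_eq[OF that(1)] \<psi>(4)[OF that(2), symmetric]
      by (rule hom_mult[OF \<psi>(1)]) (use that in auto)
    finally have 1: "\<psi> (a, \<theta> a \<cdot> k) = s a \<otimes>\<^bsub>E\<^esub> i k" .
    have "i k \<in> carrier E"
      using \<psi>(4)[OF that(2)] hom_in_carrier[OF \<psi>(1), of "(\<one>\<^bsub>A\<^esub>, k)"] that by simp
    then have "inv\<^bsub>E\<^esub> (s a) \<otimes>\<^bsub>E\<^esub> \<psi> (a, \<theta> a \<cdot> k) = i k"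
      using s(1)[OF that(1)] unfolding 1 by (simp flip: E.m_assoc)
    then show ?thesis
      using inv_into_f_f[OF inj that(2)] by simp
  qed
  have dot: "inv_into (carrier K) i (inv\<^bsub>E\<^esub> (s (x \<otimes>\<^bsub>A\<^esub> y)) \<otimes>\<^bsub>E\<^esub> (s x \<otimes>\<^bsub>E\<^esub> s y))
      = bdry1 A K \<mu> \<theta> (x, y) \<cdot> \<tau>\<^sub>1 (x, y)" (is "?l = ?k") if "x \<in> carrier A" "y \<in> carrier A" for x y
  proof -
    have "s x \<otimes>\<^bsub>E\<^esub> s y = \<psi> ((x, \<theta> x) \<otimes>\<^bsub>?H\<^esub> (y, \<theta> y))"
      unfolding s_eq[OF that(1)] s_eq[OF that(2)]
      by (rule hom_mult[OF \<psi>(1), symmetric]) (use that in auto)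
    also have "\<dots> = \<psi> (x \<otimes>\<^bsub>A\<^esub> y, \<theta> (x \<otimes>\<^bsub>A\<^esub> y) \<cdot> ?k)"
      using that by (simp add: bdry1_def) (rule arg_cong[of _ _ \<psi>], simp add: K.fraction_simps K.m_ac)
    finally show ?thesis
      using shift[of "x \<otimes>\<^bsub>A\<^esub> y" ?k] that by (simp add: bdry1_def)
  qed
  have circ: "inv_into (carrier K) i (inv\<^bsub>E\<^esub> (s (x \<otimes>\<^bsub>A\<^esub> \<beta> (T x) y)) \<otimes>\<^bsub>E\<^esub> (s x \<otimes>\<^bsub>Eo\<^esub> s y))
      = \<mu> (\<beta> (T x) y) (\<theta> x) \<cdot> \<nu> (T x) (\<theta> y) \<cdot> \<nu> (T x) (f (S (\<nu> (inv\<^bsub>B\<^esub> (T x)) (\<theta> x))) y)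
      \<cdot> inv\<^bsub>K\<^esub> (\<theta> (x \<otimes>\<^bsub>A\<^esub> \<beta> (T x) y)) \<cdot> brace_part \<tau>\<^sub>1 \<rho> \<chi> (x, y)" (is "?l = ?k")
    if "x \<in> carrier A" "y \<in> carrier A" for x y
  proof -
    have [simp]: "brace_part \<tau>\<^sub>1 \<rho> \<chi> (x, y) \<in> carrier K"
      using that by (simp add: brace_part_def)
    have k: "?k \<in> carrier K"
      using that by simp
    have "s x \<otimes>\<^bsub>Eo\<^esub> s y = \<psi> ((x, \<theta> x) \<otimes>\<^bsub>?Ho\<^esub> (y, \<theta> y))"
      unfolding s_eq[OF that(1)] s_eq[OF that(2)]
      by (rule hom_mult[OF \<psi>(2), symmetric]) (use that in auto)
    \<comment> \<open>The operator value at \<open>(x, \<theta> x)\<close> contains \<open>S\<close>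
      of the twisted \<theta>, whence the \<open>f\<close> term in \<open>?k\<close>; the rest of
      the circle product is the value of \<open>brace_part\<close>.\<close>
    also have "(x, \<theta> x) \<otimes>\<^bsub>?Ho\<^esub> (y, \<theta> y) = (x \<otimes>\<^bsub>A\<^esub> \<beta> (T x) y, \<theta> (x \<otimes>\<^bsub>A\<^esub> \<beta> (T x) y) \<cdot> ?k)"
      using that by (simp add: brace_part_def f_mult_left nu_mult K.fraction_simps K.m_ac)
    finally show ?thesis
      using shift[of "x \<otimes>\<^bsub>A\<^esub> \<beta> (T x) y" ?k] that k by simp
  qed
  have "section_cocycle MA MK \<E> s = Phi (d1 (\<theta>, \<lambda>b\<in>carrier B. \<one>\<^bsub>L\<^esub>)) \<otimes>\<^bsub>ZN\<^esub> Phi (\<tau>\<^sub>1, \<tau>\<^sub>2, \<rho>, \<chi>)"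
    unfolding mult_ZN Phi_d1[OF trivial_cochain_in_C1[OF \<theta>]] Phi_simp mult_DirProd \<E>
      induced_brace.simps section_cocycle.simps
    by (auto simp: dot circ cochains2_def mult_cochains fun_eq_iff restrict_def simp del: T_circ)
  with \<theta> show thesis
    by (rule that)
qed

text \<open>Varying the member of the class and the section changes the section cocycle only by a
  factor \<open>Phi (d1 (\<theta>, \<one>))\<close> from \<open>BN\<close>, which the coset
  absorbs.\<close>

lemma Lambda_map_class:
  assumes z: "rrb_cocycle \<tau>\<^sub>1 \<tau>\<^sub>2 \<rho> \<chi>"
  shows "Lambda_map MA MK act_N (brace_ext_class MA MK (induced_brace_ext (ext (\<tau>\<^sub>1, \<tau>\<^sub>2, \<rho>, \<chi>))))
    = BN #>\<^bsub>ZN\<^esub> Phi (\<tau>\<^sub>1, \<tau>\<^sub>2, \<rho>, \<chi>)"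
  unfolding Lambda_map_def
proof (rule the_elem_image_const)
  let ?E = "induced_brace_ext (ext (\<tau>\<^sub>1, \<tau>\<^sub>2, \<rho>, \<chi>))"
  have K: "rrb_group RK"
    using module unfolding rrb_module.simps by blast
  have "brace_ext MA MK ?E"
    using rrb_ext_ext[OF z] K unfolding ext_eq by (rule brace_ext_induced)
  then have "?E \<in> brace_ext_class MA MK ?E"
    by (simp only: brace_ext_class_def mem_Collect_eq brace_ext_equiv_refl simp_thms)
  \<comment> \<open>The index set of the image must be inhabited for \<open>the_elem\<close> to have
    the intended value.\<close>
  moreover have "normalised_section MA ?E (\<lambda>a. (a, \<one>\<^bsub>K\<^esub>))"
    by (simp add: ext_eq)
  ultimately show "(SIGMA \<E>:brace_ext_class MA MK ?E. Collect (normalised_section MA \<E>)) \<noteq> {}"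
    by blast
next
  interpret ZN: comm_group ZN by (rule comm_group_ZN)
  fix x assume x: "x \<in> (SIGMA \<E>:brace_ext_class MA MK (induced_brace_ext (ext (\<tau>\<^sub>1, \<tau>\<^sub>2, \<rho>, \<chi>))).
    Collect (normalised_section MA \<E>))"
  obtain \<E> s where \<E>s: "x = (\<E>, s)" by (cases x)
  have E: "brace_ext MA MK \<E>" "brace_ext_equiv MK (induced_brace_ext (ext (\<tau>\<^sub>1, \<tau>\<^sub>2, \<rho>, \<chi>))) \<E>"
    "normalised_section MA \<E> s"
    using x unfolding \<E>s mem_Sigma_iff brace_ext_class_def mem_Collect_eq by blast+
  obtain \<theta> where \<theta>: "\<theta> \<in> carrier (cochains1 A K)" and
    eq: "section_cocycle MA MK \<E> s = Phi (d1 (\<theta>, \<lambda>b\<in>carrier B. \<one>\<^bsub>L\<^esub>)) \<otimes>\<^bsub>ZN\<^esub> Phi (\<tau>\<^sub>1, \<tau>\<^sub>2, \<rho>, \<chi>)"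
    using section_cocycle_eq[OF z E] .
  have w: "Phi (d1 (\<theta>, \<lambda>b\<in>carrier B. \<one>\<^bsub>L\<^esub>)) \<in> BN"
    unfolding BN_eq_image B2_RRB_def using trivial_cochain_in_C1[OF \<theta>] by (intro imageI)
  have w': "Phi (d1 (\<theta>, \<lambda>b\<in>carrier B. \<one>\<^bsub>L\<^esub>)) \<in> carrier ZN"
    using trivial_cochain_in_C1[OF \<theta>] by (intro Phi_in_ZN d1_in_ZR)
  have z': "Phi (\<tau>\<^sub>1, \<tau>\<^sub>2, \<rho>, \<chi>) \<in> carrier ZN"
    using z by (intro Phi_in_ZN) (simp only: Z2_RRB_iff)
  have "BN #>\<^bsub>ZN\<^esub> section_cocycle MA MK \<E> s = (BN #>\<^bsub>ZN\<^esub> Phi (d1 (\<theta>, \<lambda>b\<in>carrier B. \<one>\<^bsub>L\<^esub>))) #>\<^bsub>ZN\<^esub> Phi (\<tau>\<^sub>1, \<tau>\<^sub>2, \<rho>, \<chi>)"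
    unfolding eq by (rule ZN.coset_mult_assoc[OF subgroup.subset[OF subgroup_BN] w' z', symmetric])
  also have "\<dots> = BN #>\<^bsub>ZN\<^esub> Phi (\<tau>\<^sub>1, \<tau>\<^sub>2, \<rho>, \<chi>)"
    by (simp only: ZN.coset_join2[OF w' subgroup_BN w])
  finally show "(case x of (\<E>, s) \<Rightarrow> BN #>\<^bsub>ZN\<^esub> section_cocycle MA MK \<E> s) = BN #>\<^bsub>ZN\<^esub> Phi (\<tau>\<^sub>1, \<tau>\<^sub>2, \<rho>, \<chi>)"
    unfolding \<E>s case_prod_conv .
qed

text \<open>Members of the coset differ from the given cocycle by a boundary, and translating the
  fibres by the bounding cochain is an equivalence of the extensions.\<close>

lemma Psi_map_class:
  assumes z: "rrb_cocycle \<tau>\<^sub>1 \<tau>\<^sub>2 \<rho> \<chi>"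
  shows "Psi_map RA RK (\<nu>, \<mu>, \<sigma>, f) (BR #>\<^bsub>ZR\<^esub> (\<tau>\<^sub>1, \<tau>\<^sub>2, \<rho>, \<chi>)) = rrb_ext_class RA RK (ext (\<tau>\<^sub>1, \<tau>\<^sub>2, \<rho>, \<chi>))"
  unfolding Psi_map_def
proof (rule the_elem_image_const)
  interpret ZR: comm_group ZR by (rule comm_group_ZR)
  have z': "(\<tau>\<^sub>1, \<tau>\<^sub>2, \<rho>, \<chi>) \<in> carrier ZR"
    using z by (simp only: Z2_RRB_iff)
  show "BR #>\<^bsub>ZR\<^esub> (\<tau>\<^sub>1, \<tau>\<^sub>2, \<rho>, \<chi>) \<noteq> {}"
    using ZR.rcos_self[OF z' subgroup_BR] by blast
  fix x assume x: "x \<in> BR #>\<^bsub>ZR\<^esub> (\<tau>\<^sub>1, \<tau>\<^sub>2, \<rho>, \<chi>)"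
  then obtain p q where pq: "(p, q) \<in> carrier C1" "x = d1 (p, q) \<otimes>\<^bsub>ZR\<^esub> (\<tau>\<^sub>1, \<tau>\<^sub>2, \<rho>, \<chi>)"
    unfolding r_coset_def B2_RRB_def by auto
  have x': "x = d1 (p, q) \<otimes>\<^bsub>C2\<^esub> (\<tau>\<^sub>1, \<tau>\<^sub>2, \<rho>, \<chi>)"
    unfolding pq(2) Z2_RRB_def by simp
  have "x \<in> carrier ZR"
    unfolding pq(2) by (intro ZR.m_closed d1_in_ZR pq(1) z')
  then have "rrb_ext RA RK (ext x)"
    by (elim ZR_cases) (simp only: rrb_ext_ext)
  then show "rrb_ext_class RA RK (ext x) = rrb_ext_class RA RK (ext (\<tau>\<^sub>1, \<tau>\<^sub>2, \<rho>, \<chi>))"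
    using rrb_ext_ext[OF z] rrb_ext_equiv_coboundary[OF z pq(1)] unfolding x' by (rule rrb_ext_class_eqI)
qed

lemma Lambda_Pi_Psi_iso:
  "Lambda_map MA MK act_N \<circ> Pi_map RA RK \<circ> Psi_map RA RK (\<nu>, \<mu>, \<sigma>, f)
    \<in> iso (H2_RRB RA RK (\<nu>, \<mu>, \<sigma>, f)) (H2_N MA MK act_N)"
  unfolding H2_RRB_def H2_N_def
proof (rule FactGroup_isoI[OF comm_group_ZR comm_group_ZN subgroup_BR subgroup_BN Phi_hom Phi_image Phi_in_BN_iff])
  fix z assume "z \<in> carrier ZR"
  then obtain \<tau>\<^sub>1 \<tau>\<^sub>2 \<rho> \<chi> where z: "z = (\<tau>\<^sub>1, \<tau>\<^sub>2, \<rho>, \<chi>)" "rrb_cocycle \<tau>\<^sub>1 \<tau>\<^sub>2 \<rho> \<chi>"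
    by (rule ZR_cases)
  have K: "rrb_group RK"
    using module unfolding rrb_module.simps by blast
  show "(Lambda_map MA MK act_N \<circ> Pi_map RA RK \<circ> Psi_map RA RK (\<nu>, \<mu>, \<sigma>, f)) (BR #>\<^bsub>ZR\<^esub> z) = BN #>\<^bsub>ZN\<^esub> Phi z"
    unfolding o_apply z(1) Psi_map_class[OF z(2)] Pi_map_class[OF rrb_ext_ext[OF z(2)] K]
      Lambda_map_class[OF z(2)] ..
qed

lemma group_H2: "group (H2_RRB RA RK (\<nu>, \<mu>, \<sigma>, f))" "group (H2_N MA MK act_N)"
  unfolding H2_RRB_def H2_N_def
  by (intro normal.factorgroup_is_group comm_group.subgroup_imp_normal comm_group_ZR comm_group_ZN
      subgroup_BR subgroup_BN)+

end

theorem corollary4p6: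
  fixes A :: "'a monoid" and B :: "'b monoid" and \<beta> :: "'b \<Rightarrow> 'a \<Rightarrow> 'a" and T :: "'a \<Rightarrow> 'b"
    and K :: "'k monoid" and L :: "'l monoid" and \<alpha> :: "'l \<Rightarrow> 'k \<Rightarrow> 'k" and S :: "'k \<Rightarrow> 'l"
    and \<nu> :: "'b \<Rightarrow> 'k \<Rightarrow> 'k" and \<mu> :: "'a \<Rightarrow> 'k \<Rightarrow> 'k"
    and \<sigma> :: "'b \<Rightarrow> 'l \<Rightarrow> 'l" and f :: "'l \<Rightarrow> 'a \<Rightarrow> 'k"
    and \<A> :: "('a, 'b) rrb" and \<K> :: "('k, 'l) rrb" and act :: "('a, 'b, 'k, 'l) rrb_action"
  assumes "\<A> = (A, B, \<beta>, T)" and "\<K> = (K, L, \<alpha>, S)" and "act = (\<nu>, \<mu>, \<sigma>, f)"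
    and "rrb_group \<A>"
    and "rrb_module \<A> \<K> act"
    and "bij_betw T (carrier A) (carrier B)"
    and "bij_betw S (carrier K) (carrier L)"
    and "comm_group K" and "comm_group L"
  shows "group (H2_RRB \<A> \<K> act) \<and>
    group (H2_N (induced_brace \<A>) (induced_brace \<K>) (induced_action \<A> \<K> act)) \<and>
    Lambda_map (induced_brace \<A>) (induced_brace \<K>) (induced_action \<A> \<K> act)
      \<circ> Pi_map \<A> \<K> \<circ> Psi_map \<A> \<K> act
      \<in> iso (H2_RRB \<A> \<K> act)
            (H2_N (induced_brace \<A>) (induced_brace \<K>) (induced_action \<A> \<K> act))"
proof -
  interpret M: bij_rrb_module A B \<beta> T K L \<alpha> S \<nu> \<mu> \<sigma> f
    using assms by unfold_locales simp_all
  show ?thesis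
    unfolding assms(1-3) using M.group_H2 M.Lambda_Pi_Psi_iso by blast
qed

end
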